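(* Let $\gamma>0$ satisfy $\max_{1\le\mu\le M-1}r(\rho_\mu^-)<\gamma<\min_{1\le\nu\le N-1}r(\rho_\nu^+)$, where the exponents $\theta_j^\pm$ are admissible and such that $\max_{1\le\mu\le M-1}r(\rho_\mu^-)<\min_{1\le\nu\le N-1}r(\rho_\nu^+)$. Define $$Q(z,t)=-\sum_{\nu=1}^{N-1}\frac{\beta_\nu^+(t)}{z-\tilde\rho_\nu^+(t)}-\sum_{\mu=1}^{M}\frac{\beta_\mu^-(t)}{z-\tilde\rho_\mu^-(t)},$$ where $$\beta_j^\pm(t)=a_t^2\,\frac{(\partial_t h_t)(\rho_j^\pm(t))-\gamma}{h_t''(\rho_j^\pm(t))},\qquad \tilde\rho_j^\pm(t)=b_t+a_t\rho_j^\pm(t).$$ Then the solution of the PDE $$\frac{\partial f}{\partial t}(z,t)=-f'(z,t)\,Q(z,t),\qquad f(z,0)=z,\qquad z\in\mathbb{H},\ t\ge0,$$ is a multi-slit Loewner chain, with $f(\cdot,t)$ having range $$H_t=\mathbb{H}\setminus\Big[\bigcup_{\nu=1}^{N-1}\Gamma_\nu^+([0,t])\cup\bigcup_{\mu=1}^{M}\Gamma_\mu^-([0,t])\Big].$$ The trajectories of the tip points are the continuous curves $\Gamma_\nu^+(t)=h^{-1}(h_t(\rho_\nu^+(t))-\gamma t)$, $\nu=1,\dots,N-1$, and $\Gamma_\mu^-(t)=h^{-1}(h_t(\rho_\mu^-(t))-\gamma t)$, $\mu=1,\dots,M$, $t\ge0$. In particular, for every $\nu=1,\dots,N-1$, $\Gamma_\nu^+$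 emanates from $\rho_\nu^+(0)\in\mathbb{R}$ and converges, as $t\to+\infty$, to $k_{\mu_\nu}^-=k_{\mu_\nu}^-(0)\in\mathbb{R}$; and for every $\mu=1,\dots,M$, $\Gamma_\mu^-$ emanates from $\rho_\mu^-(0)\in\mathbb{R}$ and converges, as $t\to+\infty$, to $k_j^+=k_j^+(0)\in\mathbb{R}$ if and only if $h(\rho_\mu^-(0))\in S_j^+$.
   Context: $\mathbb{H}$ is the upper half-plane, $\log$ is the principal branch, $'$ denotes $\partial_z$. Parameters. $N\ge2$, $M\ge1$ are integers; $k_1^+<\dots<k_N^+<k_1^-<\dots<k_M^-$ are real; $b_1^+,\dots,b_N^+,b_1^-,\dots,b_M^->0$; $b^+=\sum_{j=1}^Nb_j^+$, $b^-=\sum_{j=1}^Mb_j^-$. Assume $b^+>b^-$, $\sum_{j=2}^Nb_j^+<b^-$, and $\sum_{j=\nu+1}^Nb_j^+\ne\sum_{j=1}^{\mu}b_j^-$ for all $1\le\nu\le N-1$, $1\le\mu\le M$. Time dependence. For positive exponents $\theta_2^+,\dots,\theta_{N-1}^+$, $\theta_1^-,\dots,\theta_M^-$ put, for $t\ge0$, $k_1^+(t)=k_1^+$, $k_N^+(t)=k_N^+$, $k_j^+(t)=k_N^++(k_j^+-k_N^+)e^{-\theta_j^+t}$ ($2\le j\le N-1$), $k_j^-(t)=k_N^++(k_j^--k_N^+)e^{-\theta_j^-t}$ ($1\le j\le M$), and $$h_t(z)=h(z,t)=\sum_{j=1}^Nb_j^+\log(z-k_j^+(t))-\sum_{j=1}^Mb_j^-\log(z-k_j^-(t)),$$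 $h=h_0$; $h_t$ is extended to real points other than the $k_j^\pm(t)$ by continuity from $\mathbb{H}$. $h_t$ is univalent on $\mathbb{H}$. The zeros of $h_t'$ are simple and real: $\rho_\nu^+(t)\in(k_\nu^+(t),k_{\nu+1}^+(t))$ ($1\le\nu\le N-1$), $\rho_\mu^-(t)\in(k_\mu^-(t),k_{\mu+1}^-(t))$ ($1\le\mu\le M-1$), $\rho_M^-(t)>k_M^-(t)$. The rates are $r(\rho_j^\pm)=\lim_{t\to+\infty}\frac1t\mathrm{Re}\,h_t(\rho_j^\pm(t))$. (If $M=1$, a maximum over the empty set is $-\infty$.) Heights and strips. $y_\nu^+=\mathrm{Im}\,h_t(\rho_\nu^+(t))=\pi(\sum_{j=\nu+1}^Nb_j^+-b^-)$ and $y_\mu^-=\mathrm{Im}\,h_t(\rho_\mu^-(t))=-\pi\sum_{j=\mu+1}^Mb_j^-$ do not depend on $t$. Put $S_1^+=\{y_1^+<\mathrm{Im}\,w<\pi(b^+-b^-)\}$, $S_\nu^+=\{y_\nu^+<\mathrm{Im}\,w<y_{\nu-1}^+\}$ ($2\le\nu\le N-1$), $S_N^+=\{-\pi b^-<\mathrm{Im}\,w<y_{N-1}^+\}$, $S_1^-=\{-\pi b^-<\mathrm{Im}\,w<y_1^-\}$, $S_\mu^-=\{y_{\mu-1}^-<\mathrm{Im}\,w<y_\mu^-\}$ ($2\le\mu\le M$). For $1\le\nu\le N-1$, $\mu_\nu\in\{1,\dots,M\}$ is the index with $\sum_{j=1}^{\mu_\nu-1}b_j^-<\sum_{j=\nu+1}^Nb_j^+<\sum_{j=1}^{\mu_\nu}b_j^-$,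 i.e. $h(\rho_\nu^+(0))\in S_{\mu_\nu}^-$. Admissible exponents: (E0) $\theta_2^+\le\dots\le\theta_{N-1}^+$ and $\theta_1^-\ge\dots\ge\theta_M^-$. (E1) For $2\le\nu\le N-1$, $1\le\mu\le M$: if one of $S_\nu^+$, $S_\mu^-$ is contained in the other, then $\theta_\nu^+=\theta_\mu^-$; otherwise the exponent of the strip lying higher is strictly smaller. (E2) The $\theta_\mu^-$ with $S_\mu^-\subset S_1^+$ (i.e. $\mu>\mu_1$) are all equal and strictly smaller than $\theta_{\mu_1}^-$; the $\theta_\mu^-$ with $S_\mu^-\subset S_N^+$ (i.e. $\mu<\mu_{N-1}$) are all equal and strictly larger than $\theta_{\mu_{N-1}}^-$. The chain. For $\gamma$ as in the claim, $h_t(\mathbb{H})-\gamma t\subset h(\mathbb{H})$, and $a_t>0$, $b_t\in\mathbb{R}$ are defined by the expansion at infinity $h^{-1}(h_t(z)-\gamma t)=a_tz+b_t+O(1/z)$. In the definition of the curves $\Gamma_j^\pm$, $h^{-1}$ denotes the inverse of $h:\mathbb{H}\to h(\mathbb{H})$, extended to the boundary at $t=0$ so that $\Gamma_j^\pm(0)=\rho_j^\pm(0)$. A multi-slit Loewner chain is a family $(f(\cdot,t))_{t\ge0}$ of conformal maps of $\mathbb{H}$ onto domains $H_t\subset\mathbb{H}$, decreasing in $t$, with $f(z,t)-z\to0$ as $z\to\infty$, such that $\mathbb{H}\setminus H_t$ consists of finitely many disjoint Jordan arcs (slits) growing from points of $\mathbb{R}$; the ends of the slits in $\mathbb{H}$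 are the tip points. *)

theory Defs
  imports
    "HOL-Complex_Analysis.Complex_Analysis"
    "HOL-Library.Landau_Symbols"
    "HOL-Library.Extended_Real"
begin

text \<open>
  Suffixes \<open>P\<close> and \<open>M\<close> stand for the superscripts \<open>+\<close> and \<open>-\<close>. Indexed quantities are functions
  on \<^typ>\<open>nat\<close> of which only the indices \<open>1..N\<close> or \<open>1..M\<close> matter (\<open>2..N-1\<close> for \<open>thP\<close>).
\<close>

record slit_data =
  nP :: nat
  nM :: nat
  kP :: "nat \<Rightarrow> real"
  kM :: "nat \<Rightarrow> real"
  bP :: "nat \<Rightarrow> real"
  bM :: "nat \<Rightarrow> real"
  thP :: "nat \<Rightarrow> real"
  thM :: "nat \<Rightarrow> real"

definition sumP :: "slit_data \<Rightarrow> real" where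
  "sumP d = (\<Sum>j=1..nP d. bP d j)"

definition sumM :: "slit_data \<Rightarrow> real" where
  "sumM d = (\<Sum>j=1..nM d. bM d j)"

definition standing_assumptions :: "slit_data \<Rightarrow> bool" where
  "standing_assumptions d \<longleftrightarrow>
     nP d \<ge> 2 \<and> nM d \<ge> 1 \<and>
     strict_mono_on {1..nP d} (kP d) \<and> kP d (nP d) < kM d 1 \<and> strict_mono_on {1..nM d} (kM d) \<and>
     (\<forall>j\<in>{1..nP d}. bP d j > 0) \<and> (\<forall>j\<in>{1..nM d}. bM d j > 0) \<and>
     sumP d > sumM d \<and>
     (\<Sum>j=2..nP d. bP d j) < sumM d \<and>
     (\<forall>\<nu>\<in>{1..nP d - 1}. \<forall>\<mu>\<in>{1..nM d}. (\<Sum>j=\<nu>+1..nP d. bP d j) \<noteq> (\<Sum>j=1..\<mu>. bM d j)) \<and>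
     (\<forall>j\<in>{2..nP d - 1}. thP d j > 0) \<and> (\<forall>j\<in>{1..nM d}. thM d j > 0)"

definition uhp :: "complex set" where
  "uhp = {z. Im z > 0}"

definition kPt :: "slit_data \<Rightarrow> nat \<Rightarrow> real \<Rightarrow> real" where
  "kPt d j t = (if j = 1 \<or> j = nP d then kP d j
                else kP d (nP d) + (kP d j - kP d (nP d)) * exp (- thP d j * t))"

definition kMt :: "slit_data \<Rightarrow> nat \<Rightarrow> real \<Rightarrow> real" where
  "kMt d j t = kP d (nP d) + (kM d j - kP d (nP d)) * exp (- thM d j * t)"

text \<open>
  \<^const>\<open>Ln\<close> has imaginary part \<open>\<pi>\<close> on the negative reals, so at real points other than the \<open>k\<^sub>j(t)\<close>
  the formula below already is the extension of \<open>h\<^sub>t\<close> by continuity from the upper half-plane;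
  see lemma \<open>continuous_on_h\<close>.
\<close>

definition h :: "slit_data \<Rightarrow> real \<Rightarrow> complex \<Rightarrow> complex" where
  "h d t z = (\<Sum>j=1..nP d. of_real (bP d j) * Ln (z - of_real (kPt d j t)))
           - (\<Sum>j=1..nM d. of_real (bM d j) * Ln (z - of_real (kMt d j t)))"

text \<open>
  The derivative in \<open>z\<close>, relative to the closed upper half-plane. In the open half-plane this is
  \<^const>\<open>deriv\<close>; on the real line \<^const>\<open>deriv\<close> would be meaningless, as the formula for \<open>h\<^sub>t\<close> jumps
  when the cut of \<^const>\<open>Ln\<close> is crossed. Lemmas \<open>dz_h\<close> and \<open>dz_dz_h\<close> evaluate it.
\<close>

definition dz :: "(complex \<Rightarrow> complex) \<Rightarrow> complex \<Rightarrow> complex" where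
  "dz f z = (THE D. (f has_field_derivative D) (at z within {w. Im w \<ge> 0}))"

definition dt_h :: "slit_data \<Rightarrow> real \<Rightarrow> complex \<Rightarrow> complex" where
  "dt_h d t z = vector_derivative (\<lambda>s. h d s z) (at t within {0..})"

definition rhoP :: "slit_data \<Rightarrow> nat \<Rightarrow> real \<Rightarrow> real" where
  "rhoP d \<nu> t = (THE x. kPt d \<nu> t < x \<and> x < kPt d (\<nu>+1) t \<and> dz (h d t) (of_real x) = 0)"

definition rhoM :: "slit_data \<Rightarrow> nat \<Rightarrow> real \<Rightarrow> real" where
  "rhoM d \<mu> t = (THE x. kMt d \<mu> t < x \<and> (\<mu> < nM d \<longrightarrow> x < kMt d (\<mu>+1) t) \<and>
                        dz (h d t) (of_real x) = 0)"

definition rateP :: "slit_data \<Rightarrow> nat \<Rightarrow> real" where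
  "rateP d \<nu> = Lim at_top (\<lambda>t. 1 / t * Re (h d t (of_real (rhoP d \<nu> t))))"

definition rateM :: "slit_data \<Rightarrow> nat \<Rightarrow> real" where
  "rateM d \<mu> = Lim at_top (\<lambda>t. 1 / t * Re (h d t (of_real (rhoM d \<mu> t))))"

text \<open>
  With \<open>yP d 0 = \<pi>(b\<^sup>+ - b\<^sup>-)\<close> and \<open>yP d N = yM d 0 = -\<pi>b\<^sup>-\<close>, the extremal strips
  \<open>S\<^sub>1\<^sup>+\<close>, \<open>S\<^sub>N\<^sup>+\<close> and \<open>S\<^sub>1\<^sup>-\<close> follow the same pattern as the others.
\<close>

definition yP :: "slit_data \<Rightarrow> nat \<Rightarrow> real" where
  "yP d \<nu> = pi * ((\<Sum>j=\<nu>+1..nP d. bP d j) - sumM d)"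

definition yM :: "slit_data \<Rightarrow> nat \<Rightarrow> real" where
  "yM d \<mu> = - pi * (\<Sum>j=\<mu>+1..nM d. bM d j)"

definition SP :: "slit_data \<Rightarrow> nat \<Rightarrow> complex set" where
  "SP d \<nu> = {w. yP d \<nu> < Im w \<and> Im w < yP d (\<nu> - 1)}"

definition SM :: "slit_data \<Rightarrow> nat \<Rightarrow> complex set" where
  "SM d \<mu> = {w. yM d (\<mu> - 1) < Im w \<and> Im w < yM d \<mu>}"

definition mu_idx :: "slit_data \<Rightarrow> nat \<Rightarrow> nat" where
  "mu_idx d \<nu> = (THE \<mu>. \<mu> \<in> {1..nM d} \<and>
      (\<Sum>j=1..\<mu> - 1. bM d j) < (\<Sum>j=\<nu>+1..nP d. bP d j) \<and>
      (\<Sum>j=\<nu>+1..nP d. bP d j) < (\<Sum>j=1..\<mu>. bM d j))"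

text \<open>
  Of two strips neither of which contains the other, the one lying higher is the one with the
  higher lower edge (equivalently, with the higher upper edge).
\<close>

definition admissible :: "slit_data \<Rightarrow> bool" where
  "admissible d \<longleftrightarrow>
     mono_on {2..nP d - 1} (thP d) \<and> antimono_on {1..nM d} (thM d) \<and>
     (\<forall>\<nu>\<in>{2..nP d - 1}. \<forall>\<mu>\<in>{1..nM d}.
        if SP d \<nu> \<subseteq> SM d \<mu> \<or> SM d \<mu> \<subseteq> SP d \<nu> then thP d \<nu> = thM d \<mu>
        else (yP d \<nu> > yM d (\<mu> - 1) \<longrightarrow> thP d \<nu> < thM d \<mu>) \<and>
             (yM d (\<mu> - 1) > yP d \<nu> \<longrightarrow> thM d \<mu> < thP d \<nu>)) \<and>
     (\<forall>\<mu>\<in>{1..nM d}. SM d \<mu> \<subseteq> SP d 1 \<longrightarrow>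
        thM d \<mu> < thM d (mu_idx d 1) \<and>
        (\<forall>\<mu>'\<in>{1..nM d}. SM d \<mu>' \<subseteq> SP d 1 \<longrightarrow> thM d \<mu>' = thM d \<mu>)) \<and>
     (\<forall>\<mu>\<in>{1..nM d}. SM d \<mu> \<subseteq> SP d (nP d) \<longrightarrow>
        thM d \<mu> > thM d (mu_idx d (nP d - 1)) \<and>
        (\<forall>\<mu>'\<in>{1..nM d}. SM d \<mu>' \<subseteq> SP d (nP d) \<longrightarrow> thM d \<mu>' = thM d \<mu>))"

definition h_inv :: "slit_data \<Rightarrow> complex \<Rightarrow> complex" where
  "h_inv d = the_inv_into uhp (h d 0)"

definition expansion :: "slit_data \<Rightarrow> real \<Rightarrow> real \<Rightarrow> real \<Rightarrow> real \<Rightarrow> bool" where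
  "expansion d \<gamma> t a b \<longleftrightarrow> a > 0 \<and>
     (\<lambda>z. h_inv d (h d t z - of_real (\<gamma> * t)) - (of_real a * z + of_real b))
       \<in> O[inf at_infinity (principal uhp)](\<lambda>z. 1 / z)"

definition coeff_a :: "slit_data \<Rightarrow> real \<Rightarrow> real \<Rightarrow> real" where
  "coeff_a d \<gamma> t = (THE a. \<exists>b. expansion d \<gamma> t a b)"

definition coeff_b :: "slit_data \<Rightarrow> real \<Rightarrow> real \<Rightarrow> real" where
  "coeff_b d \<gamma> t = (THE b. \<exists>a. expansion d \<gamma> t a b)"

text \<open>\<open>\<beta>\<close> and \<open>\<rho>\<close>-tilde belonging to the critical point \<open>\<rho>\<close> of \<open>h\<^sub>t\<close>.\<close>

definition beta :: "slit_data \<Rightarrow> real \<Rightarrow> real \<Rightarrow> real \<Rightarrow> complex" where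
  "beta d \<gamma> t \<rho> = of_real (coeff_a d \<gamma> t) ^ 2 *
     (dt_h d t (of_real \<rho>) - of_real \<gamma>) / dz (dz (h d t)) (of_real \<rho>)"

definition rho_tilde :: "slit_data \<Rightarrow> real \<Rightarrow> real \<Rightarrow> real \<Rightarrow> real" where
  "rho_tilde d \<gamma> t \<rho> = coeff_b d \<gamma> t + coeff_a d \<gamma> t * \<rho>"

definition Q :: "slit_data \<Rightarrow> real \<Rightarrow> complex \<Rightarrow> real \<Rightarrow> complex" where
  "Q d \<gamma> z t =
     - (\<Sum>\<nu>=1..nP d - 1. beta d \<gamma> t (rhoP d \<nu> t) / (z - of_real (rho_tilde d \<gamma> t (rhoP d \<nu> t))))
     - (\<Sum>\<mu>=1..nM d. beta d \<gamma> t (rhoM d \<mu> t) / (z - of_real (rho_tilde d \<gamma> t (rhoM d \<mu> t))))"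

text \<open>
  The value at \<open>t = 0\<close> is the boundary extension of \<open>h\<^sup>-\<^sup>1\<close>: there \<open>h\<^sub>0(\<rho>(0))\<close> is not in the image of
  the open half-plane.
\<close>

definition GammaP :: "slit_data \<Rightarrow> real \<Rightarrow> nat \<Rightarrow> real \<Rightarrow> complex" where
  "GammaP d \<gamma> \<nu> t = (if t = 0 then of_real (rhoP d \<nu> 0)
                     else h_inv d (h d t (of_real (rhoP d \<nu> t)) - of_real (\<gamma> * t)))"

definition GammaM :: "slit_data \<Rightarrow> real \<Rightarrow> nat \<Rightarrow> real \<Rightarrow> complex" where
  "GammaM d \<gamma> \<mu> t = (if t = 0 then of_real (rhoM d \<mu> 0)
                     else h_inv d (h d t (of_real (rhoM d \<mu> t)) - of_real (\<gamma> * t)))"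

text \<open>
  Classical solutions: jointly continuous, holomorphic in \<open>z\<close>, differentiable in \<open>t\<close> (from the right
  at \<open>t = 0\<close>). Only the values on \<open>uhp \<times> [0,\<infinity>)\<close> matter.
\<close>

definition pde_solution :: "(complex \<Rightarrow> real \<Rightarrow> complex) \<Rightarrow> (complex \<Rightarrow> real \<Rightarrow> complex) \<Rightarrow> bool" where
  "pde_solution q f \<longleftrightarrow>
     continuous_on (uhp \<times> {0..}) (\<lambda>(z, t). f z t) \<and>
     (\<forall>t\<ge>0. (\<lambda>z. f z t) holomorphic_on uhp) \<and>
     (\<forall>z\<in>uhp. f z 0 = z) \<and>
     (\<forall>z\<in>uhp. \<forall>t\<ge>0.
        ((\<lambda>s. f z s) has_vector_derivative - (deriv (\<lambda>w. f w t) z) * q z t) (at t within {0..}))"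

definition slit :: "(real \<Rightarrow> complex) \<Rightarrow> bool" where
  "slit g \<longleftrightarrow> arc g \<and> Im (pathstart g) = 0 \<and> g ` {0<..1} \<subseteq> uhp"

text \<open>
  The omitted set at time \<open>t\<close> consists of the disjoint slits \<open>G i ((0,t])\<close>, \<open>i \<in> I\<close>, growing from
  \<open>G i 0 \<in> \<real>\<close>; the end in the half-plane, i.e. the tip, of the \<open>i\<close>-th slit at time \<open>t\<close> is \<open>G i t\<close>.
\<close>

definition tip_trajectories :: "(complex \<Rightarrow> real \<Rightarrow> complex) \<Rightarrow> 'i set \<Rightarrow> ('i \<Rightarrow> real \<Rightarrow> complex) \<Rightarrow> bool" where
  "tip_trajectories f I G \<longleftrightarrow>
     (\<forall>i\<in>I. continuous_on {0..} (G i)) \<and>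
     (\<forall>t>0. \<forall>i\<in>I. slit (\<lambda>s. G i (s * t))) \<and>
     (\<forall>t\<ge>0. disjoint_family_on (\<lambda>i. G i ` {0..t}) I) \<and>
     (\<forall>t\<ge>0. uhp - (\<lambda>z. f z t) ` uhp = (\<Union>i\<in>I. G i ` {0<..t}))"

definition multi_slit_loewner_chain :: "(complex \<Rightarrow> real \<Rightarrow> complex) \<Rightarrow> bool" where
  "multi_slit_loewner_chain f \<longleftrightarrow>
     (\<forall>t\<ge>0. (\<lambda>z. f z t) holomorphic_on uhp \<and> inj_on (\<lambda>z. f z t) uhp \<and>
            (\<lambda>z. f z t) ` uhp \<subseteq> uhp \<and>
            ((\<lambda>z. f z t - z) \<longlongrightarrow> 0) (inf at_infinity (principal uhp))) \<and>
     (\<forall>s t. 0 \<le> s \<longrightarrow> s \<le> t \<longrightarrow> (\<lambda>z. f z t) ` uhp \<subseteq> (\<lambda>z. f z s) ` uhp) \<and>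
     (\<exists>(n::nat) G. tip_trajectories f {..<n} G)"

definition sing :: "slit_data \<Rightarrow> real \<Rightarrow> complex set" where
  "sing d t = (\<lambda>j. of_real (kPt d j t)) ` {1..nP d} \<union> (\<lambda>j. of_real (kMt d j t)) ` {1..nM d}"

lemma dz_eqI:
  assumes "(f has_field_derivative D) (at z within {w. Im w \<ge> 0})" "Im z \<ge> 0"
  shows "dz f z = D"
proof -
  let ?C = "{w. Im w \<ge> 0}"
  have "z islimpt ?C"
  proof (rule connected_imp_perfect)
    show "connected ?C" by (intro convex_connected convex_halfspace_Im_ge)
    show "z \<in> ?C" using assms by simp
    show "?C \<noteq> {a}" for a
    proof
      assume C: "?C = {a}"
      have "0 \<in> ?C" "1 \<in> ?C" by auto
      then have "0 = a" "1 = a" unfolding C by auto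
      then show False by simp
    qed
  qed
  then have "at z within ?C \<noteq> bot" by (simp add: trivial_limit_within)
  then have "E = D" if "(f has_field_derivative E) (at z within ?C)" for E
    using that assms(1) unfolding has_field_derivative_iff by (rule tendsto_unique)
  then show ?thesis
    unfolding dz_def by (intro the_equality assms(1))
qed

lemma has_field_derivative_Ln_closed_uhp:
  assumes "Im z \<ge> 0" "z \<noteq> of_real k"
  shows "((\<lambda>z. Ln (z - of_real k)) has_field_derivative 1 / (z - of_real k)) (at z within {w. Im w \<ge> 0})"
proof -
  let ?g = "\<lambda>z. Ln (- \<i> * (z - of_real k)) + \<i> * of_real pi / 2"
  have nonpos: "- \<i> * (z - of_real k) \<notin> \<real>\<^sub>\<le>\<^sub>0"
    using assms by (auto simp: complex_nonpos_Reals_iff complex_eq_iff)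
  have "(?g has_field_derivative 1 / (z - of_real k)) (at z within {w. Im w \<ge> 0})"
    using assms nonpos by (auto intro!: derivative_eq_intros simp: field_simps)
  moreover have "?g w = Ln (w - of_real k)" if "Im w \<ge> 0" "w \<noteq> of_real k" for w
    using Ln_times_ii[of "- \<i> * (w - of_real k)"] that by (simp flip: mult.assoc)
  moreover have "w \<noteq> of_real k" if "dist w z < dist z (of_real k)" for w
    using that by (metis dist_commute less_irrefl)
  moreover have "dist z (of_real k) > 0" using assms(2) by simp
  ultimately show ?thesis
    using assms(1) has_field_derivative_transform_within[of ?g "1 / (z - of_real k)" z
      "{w. Im w \<ge> 0}" "dist z (of_real k)" "\<lambda>z. Ln (z - of_real k)"] by simp
qed

lemma has_field_derivative_h:
  assumes "Im z \<ge> 0" "z \<notin> sing d t"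
  shows "(h d t has_field_derivative
           (\<Sum>j=1..nP d. of_real (bP d j) / (z - of_real (kPt d j t)))
         - (\<Sum>j=1..nM d. of_real (bM d j) / (z - of_real (kMt d j t)))) (at z within {w. Im w \<ge> 0})"
  unfolding h_def
proof (intro DERIV_diff DERIV_sum)
  fix j assume "j \<in> {1..nP d}"
  then have "z \<noteq> of_real (kPt d j t)" using assms(2) by (auto simp: sing_def)
  from DERIV_cmult[OF has_field_derivative_Ln_closed_uhp[OF assms(1) this]]
  show "((\<lambda>z. of_real (bP d j) * Ln (z - of_real (kPt d j t))) has_field_derivative
          of_real (bP d j) / (z - of_real (kPt d j t))) (at z within {w. Im w \<ge> 0})" by simp
next
  fix j assume "j \<in> {1..nM d}"
  then have "z \<noteq> of_real (kMt d j t)" using assms(2) by (auto simp: sing_def)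
  from DERIV_cmult[OF has_field_derivative_Ln_closed_uhp[OF assms(1) this]]
  show "((\<lambda>z. of_real (bM d j) * Ln (z - of_real (kMt d j t))) has_field_derivative
          of_real (bM d j) / (z - of_real (kMt d j t))) (at z within {w. Im w \<ge> 0})" by simp
qed

lemma continuous_on_h: "continuous_on ({z. Im z \<ge> 0} - sing d t) (h d t)"
  unfolding continuous_on_eq_continuous_within
proof
  fix z assume z: "z \<in> {z. Im z \<ge> 0} - sing d t"
  then have "continuous (at z within {z. Im z \<ge> 0}) (h d t)"
    using has_field_derivative_h by (intro DERIV_continuous) auto
  then show "continuous (at z within {z. Im z \<ge> 0} - sing d t) (h d t)"
    by (rule continuous_within_subset) auto
qed

lemma dz_h:
  assumes "Im z \<ge> 0" "z \<notin> sing d t"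
  shows "dz (h d t) z = (\<Sum>j=1..nP d. of_real (bP d j) / (z - of_real (kPt d j t)))
                      - (\<Sum>j=1..nM d. of_real (bM d j) / (z - of_real (kMt d j t)))"
  using assms by (intro dz_eqI has_field_derivative_h)

lemma dz_dz_h:
  assumes "Im z \<ge> 0" "z \<notin> sing d t"
  shows "dz (dz (h d t)) z = - (\<Sum>j=1..nP d. of_real (bP d j) / (z - of_real (kPt d j t)) ^ 2)
                             + (\<Sum>j=1..nM d. of_real (bM d j) / (z - of_real (kMt d j t)) ^ 2)"
proof (rule dz_eqI[OF _ assms(1)])
  let ?g = "\<lambda>z. (\<Sum>j=1..nP d. of_real (bP d j) / (z - of_real (kPt d j t)))
               - (\<Sum>j=1..nM d. of_real (bM d j) / (z - of_real (kMt d j t)))"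
  have deriv1: "((\<lambda>z. of_real b / (z - of_real k)) has_field_derivative - (of_real b / (z - of_real k) ^ 2))
          (at z within {w. Im w \<ge> 0})" if "z \<noteq> of_real k" for b k :: real
    using that by (auto intro!: derivative_eq_intros simp: power2_eq_square)
  have "(?g has_field_derivative
          (\<Sum>j=1..nP d. - (of_real (bP d j) / (z - of_real (kPt d j t)) ^ 2))
        - (\<Sum>j=1..nM d. - (of_real (bM d j) / (z - of_real (kMt d j t)) ^ 2))) (at z within {w. Im w \<ge> 0})"
    using assms(2) by (intro DERIV_diff DERIV_sum deriv1) (auto simp: sing_def)
  then have g: "(?g has_field_derivative
          - (\<Sum>j=1..nP d. of_real (bP d j) / (z - of_real (kPt d j t)) ^ 2)
        + (\<Sum>j=1..nM d. of_real (bM d j) / (z - of_real (kMt d j t)) ^ 2)) (at z within {w. Im w \<ge> 0})"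
    by (simp add: sum_negf)
  have "finite (sing d t)" by (simp add: sing_def)
  then have "open (- sing d t)" by (simp add: finite_imp_closed open_Compl)
  then obtain e where e: "e > 0" "ball z e \<subseteq> - sing d t"
    using assms(2) open_contains_ball by blast
  have eq: "?g w = dz (h d t) w" if "Im w \<ge> 0" "dist w z < e" for w
  proof -
    have "w \<in> ball z e" using that(2) by (simp add: dist_commute)
    then have "w \<notin> sing d t" using e(2) by blast
    then show ?thesis using dz_h[OF that(1)] by simp
  qed
  show "(dz (h d t) has_field_derivative
          - (\<Sum>j=1..nP d. of_real (bP d j) / (z - of_real (kPt d j t)) ^ 2)
        + (\<Sum>j=1..nM d. of_real (bM d j) / (z - of_real (kMt d j t)) ^ 2)) (at z within {w. Im w \<ge> 0})"
    by (rule has_field_derivative_transform_within[OF g e(1)]) (use assms(1) eq in auto)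
qed

end

theory Submission
  imports Defs
begin

text \<open>
  The functions \<open>h\<^sub>t\<close> are complex potentials of finitely many charges on the real line: \<open>N\<close> positive
  ones, to their right \<open>M\<close> negative ones, with positive total charge \<open>b\<^sup>+ - b\<^sup>-\<close>. The whole proof
  rests on one identity. With \<open>p = k\<^sub>N\<^sup>+\<close>, the rightmost positive charge, \<open>(z - p) h'(z)\<close> is the
  total charge plus a sum of terms \<open>q\<^sub>j (k\<^sub>j - p) / (z - k\<^sub>j)\<close> with all coefficients
  \<open>q\<^sub>j (k\<^sub>j - p) \<le> 0\<close> (\<open>shifted_dH\<close>). In the half-plane it therefore has positive imaginary part, so
  \<open>h\<close> read in the coordinate \<open>log (z - p)\<close>, which ranges over a strip, is univalent by the
  Noshiro-Warschawski criterion (\<open>inj_H\<close>). On the real line it is strictly increasing on every gap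
  between the charges, so the gap contains at most one critical point, and it is nondegenerate
  (\<open>shifted_strict_mono\<close>, \<open>ddH_crit_nonzero\<close>).

  The image of \<open>h\<close> is computed from its boundary values (\<open>image_H\<close>). Along each gap \<open>Im h\<close> is
  constant and \<open>Re h\<close> runs in from infinity, turns at the critical point and runs back; the boundary
  thus traces two horizontal lines and, between them, half-lines entering from the left (gaps
  between positive charges) and from the right (gaps between, or to the right of, negative charges),
  all at different heights. As \<open>h\<close> is proper, its image intersects each horizontal line in a set
  that is open and closed in the complement of these half-lines, hence is all of that complement.

  Consequently \<open>h\<^sub>t(\<bbbH>) - \<gamma>t\<close> is the domain \<open>h(\<bbbH>)\<close> with each half-line prolonged or shortened by the
  displacement of its tip, and everything depends on the tips moving inwards. Here the exponents
  enter. A critical point between two positive charges is the maximum of \<open>Re h\<^sub>t\<close> over its gap. Let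
  a point \<open>x\<close> of the gap move so that \<open>x - k\<^sub>N\<^sup>+\<close> is a multiple of \<open>e\<^sup>-\<^sup>\<theta>\<^sup>t\<close>, with \<open>\<theta>\<close> between the
  exponents of the two charges that bound the gap: then it stays in the gap, and \<open>Re h\<^sub>t(x)\<close>,
  examined term by term, grows at least at the speed \<open>r\<^sub>\<theta> = - \<Sum> q\<^sub>j min(\<theta>\<^sub>j, \<theta>)\<close> (\<open>flow_term\<close>). On
  the other hand every point of the gap at time \<open>t\<close> lies on such an orbit, up to a bounded factor,
  which gives the matching upper bound (\<open>bound_term\<close>). So the limiting rate is \<open>sup r\<^sub>\<theta>\<close>, and it is
  not only attained in the limit but is a lower bound of the speed at all times (\<open>channel.rate\<close>). As
  \<open>\<gamma>\<close> is smaller, the tip of the left half-line moves strictly to the right. The gaps between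
  negative charges are treated in the same way after a change of all signs, and the last tip of
  \<open>h\<^sub>t(\<bbbH>)\<close> never moves to the right, so that of \<open>h\<^sub>t(\<bbbH>) - \<gamma>t\<close> moves strictly to the left
  (\<open>tip_progress\<close>).

  The chain is \<open>f(z,t) = h\<^sup>-\<^sup>1(h\<^sub>t((z - b\<^sub>t) / a\<^sub>t) - \<gamma>t)\<close>. Comparing expansions at infinity gives
  \<open>a\<^sub>t = e\<^sup>-\<^sup>\<gamma>\<^sup>t\<^sup>/\<^sup>B\<close>, \<open>b\<^sub>t = (m\<^sub>0 - a\<^sub>t m\<^sub>t) / B\<close> with the total charge \<open>B\<close> and the first moment
  \<open>m\<^sub>t\<close> of the charges (\<open>expansion_a_coef_b_coef\<close>). Differentiating, the equation for \<open>f\<close> becomes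
  the partial fraction expansion of the rational function \<open>(\<partial>\<^sub>t h\<^sub>t - \<gamma>) / h\<^sub>t'\<close>, whose poles are
  the critical points (\<open>partial_fractions\<close>): its polynomial part is absorbed by \<open>a\<^sub>t\<close> and \<open>b\<^sub>t\<close>, its
  polar part is \<open>Q\<close> up to the factor \<open>- 1 / a\<^sub>t\<close>. A second solution is constant along the curves on
  which \<open>f\<close> is constant, hence agrees with \<open>f\<close> (\<open>pde_solution_unique\<close>). Finally a tip whose image
  moves to infinity inside a strip of \<open>h(\<bbbH>)\<close> converges to the charge at which \<open>h\<close> opens into that
  strip (\<open>Hinv_tendsto_left\<close>, \<open>Hinv_tendsto_right\<close>).
\<close>

section \<open>Univalence of the complex potential of real charges\<close>

lemma open_uhp: "open uhp"
  unfolding uhp_def by (rule open_halfspace_Im_gt)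

lemma convex_uhp: "convex uhp"
  unfolding uhp_def by (rule convex_halfspace_Im_gt)

text \<open>
  The Noshiro-Warschawski criterion: along the segment from \<open>a\<close> to \<open>b\<close> the imaginary part of
  \<open>f / (b - a)\<close> has derivative \<open>Im f' > 0\<close>, so it takes different values at the two ends.
\<close>

lemma inj_on_of_Im_deriv_pos:
  fixes f f' :: "complex \<Rightarrow> complex"
  assumes S: "convex S"
    and f: "\<And>z. z \<in> S \<Longrightarrow> (f has_field_derivative f' z) (at z)"
    and pos: "\<And>z. z \<in> S \<Longrightarrow> 0 < Im (f' z)"
  shows "inj_on f S"
proof (rule inj_onI, rule ccontr)
  fix a b assume ab: "a \<in> S" "b \<in> S" "f a = f b" "a \<noteq> b"
  define \<phi> where "\<phi> = (\<lambda>t::real. Im (f (a + of_real t * (b - a)) / (b - a)))"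
  have "\<exists>y. (\<phi> has_real_derivative y) (at t) \<and> 0 < y" if t: "0 \<le> t" "t \<le> 1" for t
  proof -
    let ?z = "a + of_real t * (b - a)"
    have "?z = (1 - t) *\<^sub>R a + t *\<^sub>R b" by (simp add: scaleR_conv_of_real algebra_simps)
    then have z: "?z \<in> S" using convexD_alt[OF S ab(1,2) t] by simp
    have "((\<lambda>w. f (a + w * (b - a)) / (b - a)) has_field_derivative f' ?z) (at (of_real t))"
      using ab(4)
      by (auto intro!: derivative_eq_intros DERIV_chain2[where f = f and g = "\<lambda>w. a + w * (b - a)", OF f[OF z]])
    then have "((\<lambda>t. f (a + of_real t * (b - a)) / (b - a)) has_vector_derivative f' ?z) (at t)"
      using has_vector_derivative_real_field by fastforce
    then have "(\<phi> has_real_derivative Im (f' ?z)) (at t)"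
      unfolding \<phi>_def by (rule has_field_derivative_Im)
    then show ?thesis using pos[OF z] by blast
  qed
  then have "\<phi> 0 < \<phi> 1" by (rule DERIV_pos_imp_increasing[OF zero_less_one])
  then show False using ab by (simp add: \<phi>_def)
qed

lemma Im_Ln_uhp:
  assumes "0 < Im z"
  shows "0 < Im (Ln (z - of_real k))" "Im (Ln (z - of_real k)) < pi"
proof -
  have "0 < Im (z - of_real k)" using assms by simp
  then show "0 < Im (Ln (z - of_real k))" "Im (Ln (z - of_real k)) < pi"
    using Im_Ln_pos_lt_imp by blast+
qed

lemma Im_Ln_mono:
  assumes z: "0 < Im z" and kl: "k \<le> l"
  shows "Im (Ln (z - of_real k)) \<le> Im (Ln (z - of_real l))"
proof (rule DERIV_nonneg_imp_nondecreasing[OF kl])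
  fix x :: real
  have "z - of_real x \<notin> \<real>\<^sub>\<le>\<^sub>0" using z by (auto simp: complex_nonpos_Reals_iff)
  then have "((\<lambda>w. Ln (z - w)) has_field_derivative - 1 / (z - of_real x)) (at (of_real x))"
    by (auto intro!: derivative_eq_intros simp: divide_inverse)
  then have "((\<lambda>x. Ln (z - of_real x)) has_vector_derivative - 1 / (z - of_real x)) (at x)"
    using has_vector_derivative_real_field by fastforce
  then have "((\<lambda>x. Im (Ln (z - of_real x))) has_real_derivative Im (- 1 / (z - of_real x))) (at x)"
    by (rule has_field_derivative_Im)
  moreover have "0 \<le> Im (- 1 / (z - of_real x))" using z by (simp add: Im_divide)
  ultimately show "\<exists>y. ((\<lambda>x. Im (Ln (z - of_real x))) has_real_derivative y) (at x) \<and> 0 \<le> y"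
    by blast
qed

text \<open>
  The two families of logarithmic poles are listed in one increasing sequence, with signed charges
  \<open>q\<close>: the first \<open>N\<close> are positive, the others negative. The last assumption says that no slit
  entering the image from the left has the height of one entering from the right.
\<close>

locale charges =
  fixes n N :: nat and q k :: "nat \<Rightarrow> real"
  assumes N_ge: "1 \<le> N" and N_less: "N < n"
    and k_mono: "strict_mono_on {1..n} k"
    and q_pos: "\<And>j. j \<in> {1..N} \<Longrightarrow> 0 < q j"
    and q_neg: "\<And>j. j \<in> {N<..n} \<Longrightarrow> q j < 0"
    and total_pos: "0 < (\<Sum>j=1..n. q j)"
    and generic: "\<And>i j. i \<in> {1..<N} \<Longrightarrow> j \<in> {N<..n} \<Longrightarrow> (\<Sum>l=i+1..n. q l) \<noteq> (\<Sum>l=j+1..n. q l)"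
begin

definition H :: "complex \<Rightarrow> complex" where
  "H z = (\<Sum>j=1..n. of_real (q j) * Ln (z - of_real (k j)))"

definition dH :: "complex \<Rightarrow> complex" where
  "dH z = (\<Sum>j=1..n. of_real (q j) / (z - of_real (k j)))"

definition S :: "complex set" where
  "S = (\<lambda>j. of_real (k j)) ` {1..n}"

text \<open>
  The closed half-plane without the charges, the set on which \<open>H\<close> is continuous.
\<close>

definition cuhp :: "complex set" where
  "cuhp = {z. 0 \<le> Im z} - S"

text \<open>
  The constant value of \<open>Im H\<close> on the \<open>i\<close>-th gap, see \<open>Im_H_gap\<close>.
\<close>

definition height :: "nat \<Rightarrow> real" where
  "height i = pi * (\<Sum>l=i+1..n. q l)"

definition gap :: "nat \<Rightarrow> real set" where
  "gap i = {x. (1 \<le> i \<longrightarrow> k i < x) \<and> (i < n \<longrightarrow> x < k (i + 1))}"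

lemma k_less: "i \<in> {1..n} \<Longrightarrow> j \<in> {1..n} \<Longrightarrow> i < j \<Longrightarrow> k i < k j"
  using k_mono by (auto simp: strict_mono_on_def)

lemma k_le: "i \<in> {1..n} \<Longrightarrow> j \<in> {1..n} \<Longrightarrow> i \<le> j \<Longrightarrow> k i \<le> k j"
  using k_less[of i j] by (cases "i = j") auto

lemma k_inj: "i \<in> {1..n} \<Longrightarrow> j \<in> {1..n} \<Longrightarrow> k i = k j \<Longrightarrow> i = j"
  by (metis k_less less_irrefl linorder_neqE_nat)

lemma uhp_subset_cuhp: "uhp \<subseteq> cuhp"
  by (auto simp: uhp_def cuhp_def S_def)

lemma finite_S: "finite S" by (simp add: S_def)

lemma has_field_derivative_H_closed:
  assumes "z \<in> cuhp"
  shows "(H has_field_derivative dH z) (at z within {w. 0 \<le> Im w})"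
  unfolding H_def dH_def
proof (rule DERIV_sum)
  fix j assume j: "j \<in> {1..n}"
  then have "z \<noteq> of_real (k j)" "0 \<le> Im z" using assms by (auto simp: cuhp_def S_def)
  from DERIV_cmult[OF has_field_derivative_Ln_closed_uhp[OF this(2,1)]]
  show "((\<lambda>z. of_real (q j) * Ln (z - of_real (k j))) has_field_derivative
          of_real (q j) / (z - of_real (k j))) (at z within {w. 0 \<le> Im w})" by simp
qed

lemma has_field_derivative_H:
  assumes "z \<in> uhp"
  shows "(H has_field_derivative dH z) (at z)"
proof -
  have "(H has_field_derivative dH z) (at z within uhp)"
    using assms uhp_subset_cuhp
    by (intro DERIV_subset[OF has_field_derivative_H_closed]) (auto simp: uhp_def)
  then show ?thesis by (simp only: at_within_open[OF assms open_uhp])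
qed

lemma holomorphic_H: "H holomorphic_on uhp"
  using has_field_derivative_H open_uhp holomorphic_on_open by blast

lemma continuous_on_H: "continuous_on cuhp H"
  unfolding continuous_on_eq_continuous_within
proof
  fix z assume "z \<in> cuhp"
  then have "continuous (at z within {w. 0 \<le> Im w}) H"
    using DERIV_continuous has_field_derivative_H_closed by blast
  then show "continuous (at z within cuhp) H"
    by (rule continuous_within_subset) (auto simp: cuhp_def)
qed

text \<open>
  All coefficients of the sum on the right have the same sign, see \<open>moment_neg\<close>: the \<open>q\<^sub>j\<close> change
  sign where \<open>k\<^sub>j - k\<^sub>N\<close> does, as no negative charge lies to the left of a positive one.
\<close>

lemma shifted_dH:
  assumes "z \<notin> S"
  shows "(z - of_real (k N)) * dH z =
     of_real (\<Sum>j=1..n. q j) + (\<Sum>j=1..n. of_real (q j * (k j - k N)) / (z - of_real (k j)))"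
proof -
  have "(z - of_real (k N)) * dH z = (\<Sum>j=1..n. of_real (q j) + of_real (q j * (k j - k N)) / (z - of_real (k j)))"
    unfolding dH_def sum_distrib_left
  proof (rule sum.cong)
    fix j assume "j \<in> {1..n}"
    then have "z - of_real (k j) \<noteq> 0" using assms by (auto simp: S_def)
    then show "(z - of_real (k N)) * (of_real (q j) / (z - of_real (k j))) =
        of_real (q j) + of_real (q j * (k j - k N)) / (z - of_real (k j))"
      by (simp add: field_simps)
  qed simp
  then show ?thesis by (simp add: sum.distrib)
qed

lemma moment_neg:
  assumes "j \<in> {1..n}"
  shows "q j * (k j - k N) \<le> 0" "j \<noteq> N \<Longrightarrow> q j * (k j - k N) < 0"
proof -
  show "j \<noteq> N \<Longrightarrow> q j * (k j - k N) < 0"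
  proof (cases "j < N")
    case True
    then show ?thesis using assms q_pos[of j] k_less[of j N] N_less by (auto intro!: mult_pos_neg)
  next
    case False
    assume "j \<noteq> N"
    then show ?thesis using False assms q_neg[of j] k_less[of N j] N_ge N_less by (auto intro!: mult_neg_pos)
  qed
  then show "q j * (k j - k N) \<le> 0" by (cases "j = N") auto
qed

lemma Im_shifted_dH_pos:
  assumes "z \<in> uhp"
  shows "0 < Im ((z - of_real (k N)) * dH z)"
proof -
  have z: "0 < Im z" using assms by (simp add: uhp_def)
  have "z \<notin> S" using z by (auto simp: S_def)
  have *: "Im (of_real c / (z - of_real a)) = - c * (Im z / (cmod (z - of_real a))^2)" for a c :: real
    by (simp add: Im_divide cmod_power2)
  have pos: "0 < Im z / (cmod (z - of_real a))^2" for a :: real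
    using z by (auto intro!: divide_pos_pos)
  have "0 < (\<Sum>j=1..n. - (q j * (k j - k N)) * (Im z / (cmod (z - of_real (k j)))^2))"
  proof (rule sum_pos2[of _ n])
    show "0 < - (q n * (k n - k N)) * (Im z / (cmod (z - of_real (k n)))^2)"
      using moment_neg(2)[of n] N_less pos by (intro mult_pos_pos) auto
    show "0 \<le> - (q j * (k j - k N)) * (Im z / (cmod (z - of_real (k j)))^2)" if "j \<in> {1..n}" for j
      using moment_neg(1)[OF that] pos less_imp_le by (intro mult_nonneg_nonneg) auto
  qed (use N_less in auto)
  then show ?thesis
    unfolding shifted_dH[OF \<open>z \<notin> S\<close>] plus_complex.sel Im_sum * by simp
qed

lemma dH_nonzero: "z \<in> uhp \<Longrightarrow> dH z \<noteq> 0"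
  using Im_shifted_dH_pos[of z] by auto

text \<open>
  The substitution \<open>z = k\<^sub>N + exp \<zeta>\<close> turns the half-plane into a convex strip, and the derivative of
  \<open>H\<close> with respect to \<open>\<zeta>\<close> is \<open>(z - k\<^sub>N) H'(z)\<close>.
\<close>

lemma inj_H: "inj_on H uhp"
proof -
  let ?T = "{\<zeta>. 0 < Im \<zeta> \<and> Im \<zeta> < pi}"
  let ?e = "\<lambda>\<zeta>. of_real (k N) + exp \<zeta>"
  have e: "?e \<zeta> \<in> uhp" if "\<zeta> \<in> ?T" for \<zeta>
    using that by (auto simp: uhp_def Im_exp intro!: mult_pos_pos sin_gt_zero)
  have inj: "inj_on (\<lambda>\<zeta>. H (?e \<zeta>)) ?T"
  proof (rule inj_on_of_Im_deriv_pos[where f' = "\<lambda>\<zeta>. exp \<zeta> * dH (?e \<zeta>)"])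
    have "?T = {\<zeta>. 0 < Im \<zeta>} \<inter> {\<zeta>. Im \<zeta> < pi}" by auto
    then show "convex ?T"
      by (metis convex_Int convex_halfspace_Im_gt convex_halfspace_Im_lt)
    fix \<zeta> assume \<zeta>: "\<zeta> \<in> ?T"
    have "(?e has_field_derivative exp \<zeta>) (at \<zeta>)" by (auto intro!: derivative_eq_intros)
    from DERIV_chain2[where f = H and g = ?e, OF has_field_derivative_H[OF e[OF \<zeta>]] this]
    show "((\<lambda>\<zeta>. H (?e \<zeta>)) has_field_derivative exp \<zeta> * dH (?e \<zeta>)) (at \<zeta>)"
      by (simp add: mult.commute)
    show "0 < Im (exp \<zeta> * dH (?e \<zeta>))"
      using Im_shifted_dH_pos[OF e[OF \<zeta>]] by simp
  qed
  show ?thesis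
  proof (rule inj_onI)
    have *: "?e (Ln (z - of_real (k N))) = z \<and> Ln (z - of_real (k N)) \<in> ?T" if "z \<in> uhp" for z
    proof -
      have "z - of_real (k N) \<noteq> 0" using that by (auto simp: uhp_def)
      then show ?thesis using that Im_Ln_uhp[of z "k N"] by (simp add: uhp_def)
    qed
    fix z w assume "z \<in> uhp" "w \<in> uhp" and eq: "H z = H w"
    note z = *[OF this(1)] and w = *[OF this(2)]
    have Ln_eq: "Ln (z - of_real (k N)) = Ln (w - of_real (k N))"
      by (rule inj_onD[OF inj _ z[THEN conjunct2] w[THEN conjunct2]])
         (simp only: z[THEN conjunct1] w[THEN conjunct1] eq)
    have "z = ?e (Ln (z - of_real (k N)))" by (rule z[THEN conjunct1, symmetric])
    also have "\<dots> = ?e (Ln (w - of_real (k N)))" by (simp only: Ln_eq)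
    also have "\<dots> = w" by (rule w[THEN conjunct1])
    finally show "z = w" .
  qed
qed

section \<open>Boundary values of the potential\<close>

lemma height_step: "i \<in> {1..n} \<Longrightarrow> height (i - 1) = height i + pi * q i"
proof -
  assume "i \<in> {1..n}"
  then have "{i - 1 + 1..n} = insert i {i + 1..n}" by auto
  then have "(\<Sum>l=i-1+1..n. q l) = q i + (\<Sum>l=i+1..n. q l)" by simp
  then show ?thesis unfolding height_def by (simp only: distrib_left)
qed

lemma height_n: "height n = 0" by (simp add: height_def)

lemma height_diff:
  assumes "i \<le> j" "j \<le> n"
  shows "height i - height j = pi * (\<Sum>l=i+1..j. q l)"
proof -
  have "{i+1..n} = {i+1..j} \<union> {j+1..n}" using assms by auto
  then have "(\<Sum>l=i+1..n. q l) = (\<Sum>l=i+1..j. q l) + (\<Sum>l=j+1..n. q l)"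
    by (simp add: sum.union_disjoint)
  then show ?thesis by (simp add: height_def algebra_simps)
qed

lemma height_decreasing: "i < j \<Longrightarrow> j \<le> N \<Longrightarrow> height j < height i"
proof -
  assume ij: "i < j" "j \<le> N"
  then have "0 < (\<Sum>l=i+1..j. q l)" by (intro sum_pos q_pos) auto
  then show ?thesis using height_diff[of i j] ij N_less by (smt (verit) less_imp_le_nat pi_gt_zero mult_pos_pos order_trans)
qed

lemma height_increasing: "N \<le> i \<Longrightarrow> i < j \<Longrightarrow> j \<le> n \<Longrightarrow> height i < height j"
proof -
  assume ij: "N \<le> i" "i < j" "j \<le> n"
  then have "0 < (\<Sum>l=i+1..j. - q l)" using q_neg by (intro sum_pos) force+
  then have "(\<Sum>l=i+1..j. q l) < 0" by (simp add: sum_negf)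
  then show ?thesis using height_diff[of i j] ij by (smt (verit) less_imp_le_nat pi_gt_zero mult_pos_neg)
qed

lemma height_0_pos: "0 < height 0"
  using total_pos by (simp add: height_def)

lemma height_bounds:
  assumes "i \<in> {1..n} - {N}"
  shows "height N < height i" "height i < height 0"
proof -
  show "height N < height i"
    using assms height_decreasing[of i N] height_increasing[of N i] by (cases "i < N") auto
  show "height i < height 0"
  proof (cases "i < N")
    case True then show ?thesis using assms height_decreasing[of 0 i] by auto
  next
    case False
    then have "height i \<le> height n" using assms height_increasing[of i n] by (cases "i = n") auto
    then show ?thesis using height_n height_0_pos by simp
  qed
qed

text \<open>
  Distinct gaps are mapped to distinct horizontal lines: \<open>height\<close> first decreases and then
  increases, and the genericity assumption excludes coincidences between the two branches.
\<close>

lemma inj_height: "inj_on height {0..n}"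
proof -
  have ne: "height i \<noteq> height j" if ij: "i < j" "j \<le> n" for i j
  proof -
    consider "j \<le> N" | "N \<le> i" | "i < N" "N < j" by linarith
    then show ?thesis
    proof cases
      case 1 then show ?thesis using height_decreasing[of i j] ij by simp
    next
      case 2 then show ?thesis using height_increasing[of i j] ij by simp
    next
      case 3
      show ?thesis
      proof (cases "i = 0")
        case True then show ?thesis using height_bounds[of j] ij 3 by auto
      next
        case False
        then show ?thesis using generic[of i j] ij 3 by (auto simp: height_def)
      qed
    qed
  qed
  show ?thesis
  proof (rule inj_onI)
    fix i j assume "i \<in> {0..n}" "j \<in> {0..n}" "height i = height j"
    then show "i = j" using ne[of i j] ne[of j i] by (metis atLeastAtMost_iff linorder_neqE_nat)
  qed
qed

lemma gap_less_iff:
  assumes "x \<in> gap i" "i \<le> n" "j \<in> {1..n}"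
  shows "x < k j \<longleftrightarrow> i < j" "x \<noteq> k j"
proof -
  have "x < k j" if "i < j"
    using assms that k_le[of "i+1" j] by (auto simp: gap_def)
  moreover have "k j < x" if "j \<le> i"
    using assms that k_le[of j i] by (auto simp: gap_def)
  ultimately show "x < k j \<longleftrightarrow> i < j" "x \<noteq> k j" by (meson linorder_not_le less_asym less_irrefl)+
qed

lemma gap_cuhp: "x \<in> gap i \<Longrightarrow> i \<le> n \<Longrightarrow> of_real x \<in> cuhp"
  using gap_less_iff(2)[of x i] unfolding cuhp_def S_def by fastforce

lemma real_in_gap:
  assumes "of_real x \<in> cuhp"
  obtains i where "i \<le> n" "x \<in> gap i"
proof -
  let ?A = "{0} \<union> {j \<in> {1..n}. k j < x}"
  define i where "i = Max ?A"
  have i: "i \<in> ?A" unfolding i_def by (rule Max_in) auto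
  have "x < k (i + 1)" if "i < n"
  proof -
    have "i + 1 \<notin> ?A"
    proof
      assume "i + 1 \<in> ?A"
      then have "i + 1 \<le> Max ?A" by (intro Max_ge) auto
      then show False by (simp add: i_def)
    qed
    then have "\<not> k (i + 1) < x" using that by auto
    moreover have "x \<noteq> k (i + 1)" using assms that by (auto simp: cuhp_def S_def)
    ultimately show ?thesis by simp
  qed
  then have "i \<le> n" "x \<in> gap i" using i by (auto simp: gap_def)
  then show ?thesis by (rule that)
qed

lemma Re_H:
  assumes "z \<notin> S"
  shows "Re (H z) = (\<Sum>j=1..n. q j * ln (cmod (z - of_real (k j))))"
  unfolding H_def Re_sum
proof (rule sum.cong)
  fix j assume "j \<in> {1..n}"
  then have "z - of_real (k j) \<noteq> 0" using assms by (auto simp: S_def)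
  then show "Re (of_real (q j) * Ln (z - of_real (k j))) = q j * ln (cmod (z - of_real (k j)))" by simp
qed simp

lemma Im_H: "Im (H z) = (\<Sum>j=1..n. q j * Im (Ln (z - of_real (k j))))"
  by (simp add: H_def)

lemma Im_H_gap:
  assumes "x \<in> gap i" "i \<le> n"
  shows "Im (H (of_real x)) = height i"
proof -
  have "Im (Ln (of_real x - of_real (k j))) = (if i < j then pi else 0)" if "j \<in> {1..n}" for j
  proof -
    have "of_real x - of_real (k j) = (of_real (x - k j) :: complex)" by simp
    moreover have "x - k j \<noteq> 0" "x - k j < 0 \<longleftrightarrow> i < j" using gap_less_iff[OF assms that] by auto
    ultimately show ?thesis by (simp add: Ln_of_real' del: of_real_diff)
  qed
  then have "Im (H (of_real x)) = (\<Sum>j=1..n. if j \<in> {i+1..n} then pi * q j else 0)"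
    unfolding Im_H by (intro sum.cong) auto
  also have "\<dots> = height i"
    unfolding height_def sum_distrib_left by (subst sum.inter_restrict[symmetric]) (auto intro!: sum.cong)
  finally show ?thesis .
qed

text \<open>
  For the upper bound all arguments are compared with the one at \<open>k\<^sub>N\<close>: the arguments at positive
  charges are smaller, those at negative charges, which are subtracted, are larger. The lower bound
  drops the positive charges and replaces the arguments at the negative ones by \<open>\<pi>\<close>.
\<close>

lemma Im_H_bounds:
  assumes "z \<in> uhp"
  shows "height N < Im (H z)" "Im (H z) < height 0"
proof -
  have z: "0 < Im z" using assms by (simp add: uhp_def)
  define \<alpha> where "\<alpha> j = Im (Ln (z - of_real (k j)))" for j
  have \<alpha>: "0 < \<alpha> j" "\<alpha> j < pi" for j using Im_Ln_uhp[OF z] by (auto simp: \<alpha>_def)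
  have mono: "\<alpha> i \<le> \<alpha> j" if "i \<in> {1..n}" "j \<in> {1..n}" "i \<le> j" for i j
    using Im_Ln_mono[OF z k_le[OF that]] by (simp add: \<alpha>_def)
  have "(\<Sum>j=1..n. q j * \<alpha> j) \<le> (\<Sum>j=1..n. q j * \<alpha> N)"
  proof (rule sum_mono)
    fix j assume j: "j \<in> {1..n}"
    show "q j * \<alpha> j \<le> q j * \<alpha> N"
    proof (cases "j \<le> N")
      case True then show ?thesis using j q_pos[of j] mono[of j N] N_less by (intro mult_left_mono) auto
    next
      case False then show ?thesis using j q_neg[of j] mono[of N j] N_ge by (intro mult_left_mono_neg) auto
    qed
  qed
  also have "\<dots> = \<alpha> N * (\<Sum>j=1..n. q j)" by (simp add: sum_distrib_left mult.commute)
  also have "\<dots> < pi * (\<Sum>j=1..n. q j)" using \<alpha> total_pos by (intro mult_strict_right_mono) auto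
  finally show "Im (H z) < height 0" unfolding Im_H by (simp add: height_def \<alpha>_def)
  have "height N = (\<Sum>j=1..n. if j \<in> {N+1..n} then pi * q j else 0)"
    unfolding height_def sum_distrib_left by (subst sum.inter_restrict[symmetric]) (auto intro!: sum.cong)
  also have "\<dots> < (\<Sum>j=1..n. q j * \<alpha> j)"
  proof (rule sum_strict_mono)
    fix j assume j: "j \<in> {1..n}"
    show "(if j \<in> {N+1..n} then pi * q j else 0) < q j * \<alpha> j"
    proof (cases "j \<le> N")
      case True then show ?thesis using j q_pos[of j] \<alpha> by auto
    next
      case False then show ?thesis using j q_neg[of j] \<alpha>(2)[of j] by auto
    qed
  qed (use N_less in auto)
  finally show "height N < Im (H z)" unfolding Im_H by (simp add: \<alpha>_def)
qed

end

section \<open>Estimates of the argument\<close>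

lemma Im_Ln_eq_arctan:
  assumes "0 < Re z"
  shows "Im (Ln z) = arctan (Im z / Re z)"
proof -
  have "z \<noteq> 0" using assms by auto
  then have b: "\<bar>Im (Ln z)\<bar> < pi / 2" using assms Re_Ln_pos_lt by blast
  have "exp (Ln z) = z" using \<open>z \<noteq> 0\<close> by simp
  then have "Re z = exp (Re (Ln z)) * cos (Im (Ln z))" "Im z = exp (Re (Ln z)) * sin (Im (Ln z))"
    by (metis Re_exp, metis Im_exp)
  then have "Im z / Re z = tan (Im (Ln z))" by (simp add: tan_def)
  then show ?thesis using b by (simp add: arctan_tan abs_less_iff)
qed

lemma abs_Im_Ln_le:
  assumes "0 < Re z"
  shows "\<bar>Im (Ln z)\<bar> \<le> \<bar>Im z\<bar> / Re z"
  using abs_arctan_le[of "Im z / Re z"] assms by (simp add: Im_Ln_eq_arctan)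

lemma Im_Ln_ge:
  assumes "0 < Im z"
  shows "Im z / cmod z \<le> Im (Ln z)"
proof -
  have "z \<noteq> 0" using assms by auto
  then have "exp (Ln z) = z" by simp
  then have "Im z = cmod z * sin (Im (Ln z))"
    using Im_exp[of "Ln z"] \<open>z \<noteq> 0\<close> by simp
  then have "Im z / cmod z = sin (Im (Ln z))" using \<open>z \<noteq> 0\<close> by simp
  also have "\<dots> \<le> Im (Ln z)" using assms Im_Ln_pos_lt_imp[of z] by (intro sin_x_le_x) auto
  finally show ?thesis .
qed

text \<open>
  No multiple of \<open>2\<pi>\<i>\<close> occurs: the imaginary part of the right-hand side exceeds \<open>-\<pi>/2\<close> and is less
  than \<open>3\<pi>/2\<close>, and values in \<open>(\<pi>, 3\<pi>/2)\<close> would put \<open>z - c\<close> into the lower half-plane.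
\<close>

lemma Ln_minus_eq_add:
  assumes "0 < Im z" "\<bar>c\<bar> < cmod z"
  shows "Ln (z - of_real c) = Ln z + Ln (1 - of_real c / z)"
proof -
  let ?s = "Ln z + Ln (1 - of_real c / z)"
  have z0: "z \<noteq> 0" using assms by auto
  have "cmod (of_real c / z) < 1" using assms z0 by (simp add: norm_divide)
  then have re: "0 < Re (1 - of_real c / z)" using abs_Re_le_cmod[of "of_real c / z"] by simp
  then have nz: "1 - of_real c / z \<noteq> 0" by auto
  have e: "exp ?s = z - of_real c" using z0 nz by (simp add: exp_add field_simps)
  have "\<bar>Im (Ln (1 - of_real c / z))\<bar> < pi / 2" using re nz Re_Ln_pos_lt by blast
  moreover have "0 < Im (Ln z)" "Im (Ln z) < pi" using assms Im_Ln_pos_lt_imp by auto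
  ultimately have b: "- pi < Im ?s" "Im ?s < 2 * pi" unfolding abs_less_iff plus_complex.sel by linarith+
  have "Im ?s \<le> pi"
  proof (rule ccontr)
    assume "\<not> Im ?s \<le> pi"
    then have "sin (Im ?s) < 0" using b by (intro sin_lt_zero) auto
    then have "Im (exp ?s) < 0" unfolding Im_exp by (intro mult_pos_neg) auto
    then show False using assms e by simp
  qed
  then show ?thesis using Ln_unique[OF e b(1)] by simp
qed

context charges
begin

section \<open>Properness of the potential\<close>

text \<open>
  The electrostatic potential \<open>Re H\<close>. Unlike \<open>H\<close> it has no cuts, so its limits at the charges and at
  infinity can be taken in the whole plane.
\<close>

definition V :: "complex \<Rightarrow> real" where
  "V z = (\<Sum>j=1..n. q j * ln (cmod (z - of_real (k j))))"

lemma Re_H_eq_V: "z \<in> cuhp \<Longrightarrow> Re (H z) = V z"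
  by (simp add: Re_H V_def cuhp_def)

lemma V_near_charge:
  assumes i: "i \<in> {1..n}"
  shows "i \<le> N \<Longrightarrow> filterlim V at_bot (at (of_real (k i)))"
    and "N < i \<Longrightarrow> filterlim V at_top (at (of_real (k i)))"
proof -
  let ?a = "of_real (k i) :: complex"
  let ?r = "\<lambda>z. \<Sum>j\<in>{1..n}-{i}. q j * ln (cmod (z - of_real (k j)))"
  have V: "V = (\<lambda>z. ?r z + q i * ln (cmod (z - ?a)))"
    unfolding V_def using i by (subst sum.remove[of _ i]) (auto simp: fun_eq_iff)
  have "isCont (\<lambda>z. q j * ln (cmod (z - of_real (k j)))) ?a" if j: "j \<in> {1..n} - {i}" for j
  proof -
    have "k i \<noteq> k j" using k_inj[of i j] i j by auto
    then have "cmod (?a - of_real (k j)) \<noteq> 0" by simp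
    then show ?thesis by (intro continuous_intros) auto
  qed
  then have r: "(?r \<longlongrightarrow> ?r ?a) (at ?a)"
    by (intro tendsto_sum) (auto simp: isCont_def)
  have "filterlim (\<lambda>z. cmod (z - ?a)) (at_right 0) (at ?a)"
    unfolding filterlim_at by (auto intro!: tendsto_eq_intros simp: eventually_at_filter)
  then have l: "filterlim (\<lambda>z. ln (cmod (z - ?a))) at_bot (at ?a)"
    by (rule filterlim_compose[OF ln_at_0])
  show "filterlim V at_bot (at ?a)" if "i \<le> N"
  proof -
    have "filterlim (\<lambda>z. q i * ln (cmod (z - ?a))) at_bot (at ?a)"
      using that i q_pos by (intro filterlim_tendsto_pos_mult_at_bot[OF tendsto_const _ l]) auto
    then show ?thesis unfolding V by (rule filterlim_tendsto_add_at_bot_iff[THEN iffD2, OF r])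
  qed
  show "filterlim V at_top (at ?a)" if "N < i"
  proof -
    have "filterlim (\<lambda>z. - ln (cmod (z - ?a))) at_top (at ?a)"
      using l by (simp add: filterlim_uminus_at_top)
    then have "filterlim (\<lambda>z. (- q i) * - ln (cmod (z - ?a))) at_top (at ?a)"
      using that i q_neg by (intro filterlim_tendsto_pos_mult_at_top[OF tendsto_const]) auto
    then have "filterlim (\<lambda>z. q i * ln (cmod (z - ?a))) at_top (at ?a)" by simp
    then show ?thesis unfolding V by (rule filterlim_tendsto_add_at_top[OF r])
  qed
qed

lemma V_at_infinity: "filterlim V at_top at_infinity"
proof -
  let ?B = "\<Sum>j=1..n. q j"
  let ?r = "\<lambda>z. \<Sum>j=1..n. q j * ln (cmod (1 - of_real (k j) / z))"
  have inv: "((\<lambda>z::complex. of_real c / z) \<longlongrightarrow> 0) at_infinity" for c :: real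
    by (rule tendsto_divide_0[OF tendsto_const filterlim_ident])
  have "((\<lambda>z. q j * ln (cmod (1 - of_real (k j) / z))) \<longlongrightarrow> q j * ln (cmod (1 - 0))) at_infinity" for j
    by (intro tendsto_intros inv) auto
  then have r: "(?r \<longlongrightarrow> (\<Sum>j=1..n. q j * ln (cmod (1 - 0)))) at_infinity"
    by (intro tendsto_sum)
  have "filterlim (\<lambda>z::complex. ?B * ln (cmod z)) at_top at_infinity"
    using total_pos
    by (intro filterlim_tendsto_pos_mult_at_top[OF tendsto_const]
          filterlim_compose[OF ln_at_top filterlim_norm_at_top])
  then have lim: "filterlim (\<lambda>z. ?r z + ?B * ln (cmod z)) at_top at_infinity"
    using filterlim_tendsto_add_at_top[OF r] by blast
  have "\<forall>\<^sub>F z in at_infinity. \<forall>j\<in>{1..n}. cmod (of_real (k j) / z) < 1"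
    using tendsto_norm[OF inv] by (intro eventually_ball_finite ballI order_tendstoD(2)[where y = "0::real"]) auto
  moreover have "\<forall>\<^sub>F z::complex in at_infinity. z \<noteq> 0"
    by (rule eventually_not_equal_at_infinity)
  ultimately have "\<forall>\<^sub>F z in at_infinity. ?r z + ?B * ln (cmod z) = V z"
  proof eventually_elim
    case (elim z)
    have "ln (cmod (z - of_real (k j))) = ln (cmod (1 - of_real (k j) / z)) + ln (cmod z)" if "j \<in> {1..n}" for j
    proof -
      have "1 - of_real (k j) / z \<noteq> 0" using elim(1) that by fastforce
      moreover have "z - of_real (k j) = (1 - of_real (k j) / z) * z" using elim(2) by (simp add: field_simps)
      ultimately show ?thesis using elim(2) by (simp add: norm_mult ln_mult)
    qed
    then show ?case by (simp add: V_def distrib_left sum.distrib sum_distrib_right)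
  qed
  then show ?thesis using lim by (simp add: filterlim_cong)
qed

lemma V_large_near_boundary:
  assumes "0 < \<epsilon>"
  obtains e R where "0 < e" "e \<le> \<epsilon>" "1 / \<epsilon> \<le> R" 
    "\<And>z j. j \<in> {1..N} \<Longrightarrow> z \<noteq> of_real (k j) \<Longrightarrow> cmod (z - of_real (k j)) < e \<Longrightarrow> V z < - C"
    "\<And>z j. j \<in> {N<..n} \<Longrightarrow> z \<noteq> of_real (k j) \<Longrightarrow> cmod (z - of_real (k j)) < e \<Longrightarrow> C < V z"
    "\<And>z. R < cmod z \<Longrightarrow> C < V z"
proof -
  define P where "P j z \<longleftrightarrow> (if j \<le> N then V z < - C else C < V z)" for j z
  have "\<exists>e>0. \<forall>z. z \<noteq> of_real (k j) \<longrightarrow> cmod (z - of_real (k j)) < e \<longrightarrow> P j z" if j: "j \<in> {1..n}" for j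
  proof -
    have "\<forall>\<^sub>F z in at (of_real (k j)). P j z"
      using V_near_charge[OF j] by (cases "j \<le> N") (auto simp: P_def filterlim_at_top_dense filterlim_at_bot_dense)
    then show ?thesis by (auto simp: eventually_at dist_norm)
  qed
  then obtain ee where ee: "\<And>j. j \<in> {1..n} \<Longrightarrow> 0 < ee j"
    "\<And>j z. j \<in> {1..n} \<Longrightarrow> z \<noteq> of_real (k j) \<Longrightarrow> cmod (z - of_real (k j)) < ee j \<Longrightarrow> P j z"
    by metis
  define e where "e = Min (insert \<epsilon> (ee ` {1..n}))"
  have e: "0 < e" "e \<le> \<epsilon>" "\<And>j. j \<in> {1..n} \<Longrightarrow> e \<le> ee j"
  proof -
    show "0 < e" unfolding e_def using assms ee(1) by (subst Min_gr_iff) auto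
    show "e \<le> \<epsilon>" unfolding e_def by (rule Min_le) auto
    show "e \<le> ee j" if "j \<in> {1..n}" for j unfolding e_def using that by (intro Min_le) auto
  qed
  obtain R where R: "\<And>z. R \<le> cmod z \<Longrightarrow> C < V z"
    using V_at_infinity by (auto simp: filterlim_at_top_dense eventually_at_infinity)
  show ?thesis
  proof (rule that[OF e(1,2), of "max R (1 / \<epsilon>)"])
    fix z j assume "j \<in> {1..N}" "z \<noteq> of_real (k j)" "cmod (z - of_real (k j)) < e"
    then show "V z < - C" using ee(2)[of j z] e(3)[of j] N_less by (auto simp: P_def)
  next
    fix z j assume "j \<in> {N<..n}" "z \<noteq> of_real (k j)" "cmod (z - of_real (k j)) < e"
    then show "C < V z" using ee(2)[of j z] e(3)[of j] N_less by (auto simp: P_def)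
  qed (use R in auto)
qed

text \<open>
  What is left of the closed half-plane after removing neighbourhoods of the charges and of
  infinity.
\<close>

definition core :: "real \<Rightarrow> real \<Rightarrow> complex set" where
  "core e R = {z. 0 \<le> Im z} \<inter> cball 0 R - (\<Union>j\<in>{1..n}. ball (of_real (k j)) e)"

lemma compact_core: "compact (core e R)"
  unfolding core_def
  by (intro compact_diff closed_Int_compact closed_halfspace_Im_ge compact_cball open_UN ballI open_ball)

lemma core_subset: "0 < e \<Longrightarrow> core e R \<subseteq> cuhp"
  by (auto simp: core_def cuhp_def S_def)

text \<open>
  Properness of \<open>H\<close>: as \<open>Re H\<close> tends to infinity at the charges and at infinity, it can only stay
  bounded on a compact part of the domain. Boundary limits of the inverse function are obtained from
  this by compactness.
\<close>

lemma bounded_level_in_compact: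
  obtains K where "compact K" "K \<subseteq> cuhp" "\<And>z. z \<in> cuhp \<Longrightarrow> \<bar>Re (H z)\<bar> \<le> C \<Longrightarrow> z \<in> K"
proof -
  obtain e R where e1: "0 < e" and "e \<le> 1" "1 / 1 \<le> R" and e2:
    "\<And>z j. j \<in> {1..N} \<Longrightarrow> z \<noteq> of_real (k j) \<Longrightarrow> cmod (z - of_real (k j)) < e \<Longrightarrow> V z < - C"
    "\<And>z j. j \<in> {N<..n} \<Longrightarrow> z \<noteq> of_real (k j) \<Longrightarrow> cmod (z - of_real (k j)) < e \<Longrightarrow> C < V z"
    "\<And>z. R < cmod z \<Longrightarrow> C < V z"
    by (rule V_large_near_boundary[OF zero_less_one, of "C"]) blast
  note e = e1 e2
  show ?thesis
  proof (rule that[OF compact_core core_subset[OF e(1)]])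
    fix z assume z: "z \<in> cuhp" "\<bar>Re (H z)\<bar> \<le> C"
    then have V: "- C \<le> V z" "V z \<le> C" by (auto simp: Re_H_eq_V)
    have "e \<le> cmod (z - of_real (k j))" if j: "j \<in> {1..n}" for j
    proof -
      have "z \<noteq> of_real (k j)" using z j by (auto simp: cuhp_def S_def)
      then show ?thesis using V e(2,3)[of j z] j by (cases "j \<le> N") force+
    qed
    moreover have "cmod z \<le> R" using V e(4)[of z] by force
    ultimately show "z \<in> core e R" using z by (force simp: core_def cuhp_def dist_norm norm_minus_commute not_less[symmetric])
  qed
qed

lemma closure_image_H:
  assumes "w \<in> closure (H ` uhp)"
  obtains z where "z \<in> cuhp" "H z = w"
proof -
  define C where "C = \<bar>Re w\<bar> + 1"
  obtain K where K: "compact K" "K \<subseteq> cuhp" "\<And>z. z \<in> cuhp \<Longrightarrow> \<bar>Re (H z)\<bar> \<le> C \<Longrightarrow> z \<in> K"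
    using bounded_level_in_compact by blast
  have "compact (H ` K)"
    using K continuous_on_H continuous_on_subset by (intro compact_continuous_image) blast
  then have cl: "closed (H ` K)" by (rule compact_imp_closed)
  have "w \<in> closure (H ` K)"
    unfolding closure_approachable
  proof (intro allI impI)
    fix e :: real assume "0 < e"
    then have "0 < min e 1" by simp
    then obtain z where z: "z \<in> uhp" "dist (H z) w < min e 1"
      using assms unfolding closure_approachable by blast
    then have "\<bar>Re (H z) - Re w\<bar> < 1"
      using abs_Re_le_cmod[of "H z - w"] by (simp add: dist_norm)
    then have "z \<in> K" using z uhp_subset_cuhp by (intro K(3)) (auto simp: C_def)
    then show "\<exists>y\<in>H ` K. dist y w < e" using z by auto
  qed
  then show ?thesis using cl that K(2) by auto
qed

lemma continuous_within_H: "z \<in> cuhp \<Longrightarrow> continuous (at z within cuhp) H"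
  using continuous_on_H by (simp add: continuous_on_eq_continuous_within)

lemma uhp_near_real:
  assumes x: "of_real x \<in> cuhp" and T: "open T" "H (of_real x) \<in> T" and d: "0 < d"
  obtains z where "z \<in> uhp" "cmod (z - of_real x) < d" "H z \<in> T"
proof -
  obtain r where r: "0 < r" "ball (H (of_real x)) r \<subseteq> T"
    using T open_contains_ball by blast
  obtain e where e: "0 < e" "\<And>z. z \<in> cuhp \<Longrightarrow> dist z (of_real x) < e \<Longrightarrow> dist (H z) (H (of_real x)) < r"
    using continuous_within_H[OF x] r(1) unfolding continuous_within_eps_delta by blast
  have e: "0 < e" "\<And>z. z \<in> cuhp \<Longrightarrow> dist z (of_real x) < e \<Longrightarrow> H z \<in> T"
    using e r(2) by (auto simp: dist_commute)
  define z where "z = of_real x + \<i> * of_real (min e d / 2)"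
  have "0 < min e d / 2" using e d by simp
  then have "z \<in> uhp" "cmod (z - of_real x) < min e d" using e d
    by (auto simp: z_def uhp_def norm_mult simp del: of_real_divide)
  then show ?thesis using that[of z] e uhp_subset_cuhp by (auto simp: dist_norm)
qed

text \<open>
  If the value \<open>H x\<close> were also taken at \<open>z\<close>, then \<open>H\<close> would map a small disc about \<open>z\<close> onto a
  neighbourhood of \<open>H x\<close>, which contains the values at points of the half-plane near \<open>x\<close>. That
  contradicts injectivity.
\<close>

lemma H_uhp_neq_H_real:
  assumes z: "z \<in> uhp" and x: "of_real x \<in> cuhp"
  shows "H z \<noteq> H (of_real x)"
proof
  assume eq: "H z = H (of_real x)"
  define d where "d = Im z / 2"
  have d: "0 < d" using z by (simp add: d_def uhp_def)
  have sub: "ball z d \<subseteq> uhp"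
  proof
    fix w assume "w \<in> ball z d"
    then have "\<bar>Im (z - w)\<bar> < d" using abs_Im_le_cmod[of "z - w"] by (simp add: dist_norm)
    then have "\<bar>Im z - Im w\<bar> < Im z / 2" by (simp add: d_def)
    moreover have "0 < Im z" using z by (simp add: uhp_def)
    ultimately have "0 < Im w" by linarith
    then show "w \<in> uhp" by (simp add: uhp_def)
  qed
  have "open (H ` ball z d)"
    using holomorphic_on_subset[OF holomorphic_H sub] inj_on_subset[OF inj_H sub]
    by (intro open_mapping_thm3) auto
  moreover have "H (of_real x) \<in> H ` ball z d" using eq d by (metis centre_in_ball image_eqI)
  ultimately obtain w where w: "w \<in> uhp" "cmod (w - of_real x) < d" "H w \<in> H ` ball z d"
    using uhp_near_real[OF x _ _ d] by blast
  then have "w \<in> ball z d" using inj_H sub by (auto dest!: inj_onD)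
  then have "\<bar>Im z - Im w\<bar> < d" using abs_Im_le_cmod[of "z - w"] by (simp add: dist_norm)
  moreover have "\<bar>Im w\<bar> < d" using w abs_Im_le_cmod[of "w - of_real x"] by simp
  ultimately show False using d_def by linarith
qed

section \<open>Critical points between the charges\<close>

definition g :: "real \<Rightarrow> real" where
  "g x = (\<Sum>j=1..n. q j / (x - k j))"

text \<open>
  Slits with \<open>i < N\<close> enter the image from the left and end at a maximum of \<open>Re H\<close> on the gap, those
  with \<open>i > N\<close> enter from the right and end at a minimum. Multiplication by \<open>sg i\<close> makes both a
  maximum.
\<close>

definition sg :: "nat \<Rightarrow> real" where
  "sg i = (if i < N then 1 else -1)"

lemma dH_real: "dH (of_real x) = of_real (g x)"
  by (simp add: dH_def g_def)

lemma g_shifted: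
  assumes "x \<in> gap i" "i \<le> n"
  shows "(x - k N) * g x = (\<Sum>j=1..n. q j) + (\<Sum>j=1..n. q j * (k j - k N) / (x - k j))"
proof -
  have "of_real x \<notin> S" using gap_cuhp[OF assms] by (simp add: cuhp_def)
  from shifted_dH[OF this] show ?thesis
    unfolding dH_real of_real_sum[symmetric] of_real_diff[symmetric] of_real_mult[symmetric] of_real_divide[symmetric]
      of_real_add[symmetric] of_real_eq_iff .
qed

lemma is_interval_gap: "x \<in> gap i \<Longrightarrow> y \<in> gap i \<Longrightarrow> x \<le> z \<Longrightarrow> z \<le> y \<Longrightarrow> z \<in> gap i"
  by (auto simp: gap_def)

text \<open>
  Every summand of \<open>shifted_dH\<close> is nondecreasing on a gap, as its coefficient is not positive. Hence
  \<open>g\<close>, which is \<open>H'\<close> on the real line, has at most one zero there.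
\<close>

lemma shifted_strict_mono:
  assumes x: "x \<in> gap i" and y: "y \<in> gap i" and i: "i \<le> n" and xy: "x < y"
  shows "(x - k N) * g x < (y - k N) * g y"
proof -
  have inv: "inverse (y - k j) < inverse (x - k j)" if "j \<in> {1..n}" for j
    using gap_less_iff[OF x i that] gap_less_iff[OF y i that] xy
    by (cases "i < j") (auto intro: less_imp_inverse_less less_imp_inverse_less_neg)
  have "(\<Sum>j=1..n. q j * (k j - k N) / (x - k j)) < (\<Sum>j=1..n. q j * (k j - k N) / (y - k j))"
  proof (rule sum_strict_mono_ex1)
    show "\<forall>j\<in>{1..n}. q j * (k j - k N) / (x - k j) \<le> q j * (k j - k N) / (y - k j)"
      unfolding divide_inverse using moment_neg(1) inv less_imp_le by (intro ballI mult_left_mono_neg) auto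
    have "q n * (k n - k N) / (x - k n) < q n * (k n - k N) / (y - k n)"
      unfolding divide_inverse using moment_neg(2)[of n] inv[of n] N_less by (intro mult_strict_left_mono_neg) auto
    then show "\<exists>j\<in>{1..n}. q j * (k j - k N) / (x - k j) < q j * (k j - k N) / (y - k j)"
      using N_less by (intro bexI[of _ n]) auto
  qed simp
  then show ?thesis using g_shifted[OF x i] g_shifted[OF y i] by simp
qed

definition RV :: "real \<Rightarrow> real" where
  "RV x = (\<Sum>j=1..n. q j * ln \<bar>x - k j\<bar>)"

lemma V_of_real: "V (of_real x) = RV x"
proof -
  have "cmod (of_real x - of_real (k j)) = \<bar>x - k j\<bar>" for j
    by (metis norm_of_real of_real_diff)
  then show ?thesis by (simp add: V_def RV_def)
qed

lemma H_of_real: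
  assumes "x \<in> gap i" "i \<le> n"
  shows "H (of_real x) = Complex (RV x) (height i)"
  using Im_H_gap[OF assms] Re_H_eq_V[OF gap_cuhp[OF assms]] by (simp add: V_of_real complex_eq_iff)

lemma DERIV_RV:
  assumes "x \<in> gap i" "i \<le> n"
  shows "(RV has_real_derivative g x) (at x)"
  unfolding RV_def g_def
proof (rule DERIV_sum)
  fix j assume j: "j \<in> {1..n}"
  have "x - k j \<noteq> 0" using gap_less_iff(2)[OF assms j] by simp
  have "((\<lambda>u. ln (u^2) / 2) has_real_derivative 1 / u) (at u)" if "u \<noteq> 0" for u :: real
    using that by (auto intro!: derivative_eq_intros zero_less_power2[THEN iffD2] simp: power2_eq_square zero_less_mult_iff)
  note * = this[OF \<open>x - k j \<noteq> 0\<close>]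
  have "((\<lambda>x. x - k j) has_real_derivative 1) (at x)" by (auto intro!: derivative_eq_intros)
  from DERIV_chain2[where f = "\<lambda>u. ln (u^2) / 2" and g = "\<lambda>x. x - k j", OF * this]
  have d: "((\<lambda>x. ln ((x - k j)^2) / 2) has_real_derivative 1 / (x - k j)) (at x)"
    by simp
  have "ln ((x - k j)^2) / 2 = ln \<bar>x - k j\<bar>" for x
  proof (cases "x = k j")
    case False
    then have "ln (\<bar>x - k j\<bar>^2) = 2 * ln \<bar>x - k j\<bar>" by (subst ln_realpow) auto
    then show ?thesis by simp
  qed simp
  then have "((\<lambda>x. ln \<bar>x - k j\<bar>) has_real_derivative 1 / (x - k j)) (at x)" using d by simp
  from DERIV_cmult[OF this, of "q j"]
  show "((\<lambda>x. q j * ln \<bar>x - k j\<bar>) has_real_derivative q j / (x - k j)) (at x)" by simp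
qed

text \<open>
  On the gaps in question \<open>sg i * RV\<close> tends to \<open>-\<infinity>\<close> at both ends. The last gap ends at infinity,
  where the potential tends to \<open>+\<infinity>\<close> because the total charge is positive.
\<close>

lemma RV_escapes:
  assumes i: "i \<in> {1..n} - {N}" and x: "x \<in> gap i"
  shows "\<exists>y\<in>gap i. y < x \<and> sg i * RV y < v" "\<exists>y\<in>gap i. x < y \<and> sg i * RV y < v"
proof -
  obtain e R where e1: "0 < e" and "e \<le> 1" "1 / 1 \<le> R" and e2:
    "\<And>z j. j \<in> {1..N} \<Longrightarrow> z \<noteq> of_real (k j) \<Longrightarrow> cmod (z - of_real (k j)) < e \<Longrightarrow> V z < - \<bar>v\<bar>"
    "\<And>z j. j \<in> {N<..n} \<Longrightarrow> z \<noteq> of_real (k j) \<Longrightarrow> cmod (z - of_real (k j)) < e \<Longrightarrow> \<bar>v\<bar> < V z"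
    "\<And>z. R < cmod z \<Longrightarrow> \<bar>v\<bar> < V z"
    by (rule V_large_near_boundary[OF zero_less_one, of "\<bar>v\<bar>"]) blast
  note e = e1 e2
  have near: "sg i * RV y < v" if "j \<in> {1..n}" "y \<noteq> k j" "\<bar>y - k j\<bar> < e" "i < N \<longleftrightarrow> j \<le> N" for y j
  proof -
    have "cmod (of_real y - of_real (k j)) < e" using that(3) by (metis norm_of_real of_real_diff)
    then show ?thesis using e(2,3)[of j "of_real y"] that by (cases "i < N") (auto simp: sg_def V_of_real)
  qed
  have ki: "k i < x" using x i by (auto simp: gap_def)
  define m where "m = min (e / 2) ((x - k i) / 2)"
  have m: "0 < m" "m < e" "m < x - k i" using ki e(1) by (auto simp: m_def min_def field_simps)
  have "k i + m \<in> gap i" "k i + m < x" using x m by (auto simp: gap_def)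
  moreover have "sg i * RV (k i + m) < v" using i m by (intro near[of i]) auto
  ultimately show "\<exists>y\<in>gap i. y < x \<and> sg i * RV y < v" by blast
  show "\<exists>y\<in>gap i. x < y \<and> sg i * RV y < v"
  proof (cases "i = n")
    case True
    define y where "y = max x \<bar>R\<bar> + 1"
    have "R < cmod (of_real y)" by (simp add: y_def)
    then have "sg i * RV y < v" using e(4)[of "of_real y"] True N_less by (simp add: sg_def V_of_real)
    moreover have "y \<in> gap i" "x < y" using x True by (auto simp: gap_def y_def)
    ultimately show ?thesis by blast
  next
    case False
    then have ki: "x < k (i + 1)" using x i by (auto simp: gap_def)
    define m where "m = min (e / 2) ((k (i + 1) - x) / 2)"
    have m: "0 < m" "m < e" "m < k (i + 1) - x" using ki e(1) by (auto simp: m_def min_def field_simps)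
    have "k (i + 1) - m \<in> gap i" "x < k (i + 1) - m" using x m by (auto simp: gap_def)
    moreover have "sg i * RV (k (i + 1) - m) < v" using i m False by (intro near[of "i + 1"]) auto
    ultimately show ?thesis by blast
  qed
qed

lemma gap_nonempty:
  assumes "i \<le> n" obtains x where "x \<in> gap i"
proof -
  consider "i = 0" | "i = n" | "1 \<le> i" "i < n" using assms by linarith
  then show ?thesis
  proof cases
    case 1 then show ?thesis using that[of "k 1 - 1"] by (auto simp: gap_def)
  next
    case 2 then show ?thesis using that[of "k n + 1"] by (auto simp: gap_def)
  next
    case 3
    then have "k i < k (i + 1)" by (intro k_less) auto
    then show ?thesis using that[of "(k i + k (i + 1)) / 2"] 3 by (auto simp: gap_def)
  qed
qed

text \<open>
  As \<open>sg i * RV\<close> takes smaller values on both sides of \<open>x\<close>, its derivative is positive somewhere to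
  the left and negative somewhere to the right, and it vanishes in between.
\<close>

lemma critical_exists:
  assumes i: "i \<in> {1..n} - {N}"
  shows "\<exists>x\<in>gap i. g x = 0"
proof -
  obtain x where x: "x \<in> gap i" using gap_nonempty[of i] i by auto
  obtain y1 where y1: "y1 \<in> gap i" "y1 < x" "sg i * RV y1 < sg i * RV x" using RV_escapes(1)[OF i x] by blast
  obtain y2 where y2: "y2 \<in> gap i" "x < y2" "sg i * RV y2 < sg i * RV x" using RV_escapes(2)[OF i x] by blast
  have d: "(RV has_real_derivative g t) (at t)" if "t \<in> gap i" for t
    using DERIV_RV[OF that] i by auto
  obtain a where a: "y1 < a" "a < x" "RV x - RV y1 = (x - y1) * g a"
    using MVT2[of y1 x RV g] d y1 x is_interval_gap[OF y1(1) x] by blast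
  obtain b where b: "x < b" "b < y2" "RV y2 - RV x = (y2 - x) * g b"
    using MVT2[of x y2 RV g] d y2 x is_interval_gap[OF x y2(1)] by blast
  have "sg i * (RV x - RV y1) > 0" "sg i * (RV y2 - RV x) < 0" using y1 y2 by (auto simp: right_diff_distrib)
  then have "(x - y1) * (sg i * g a) > 0" "(y2 - x) * (sg i * g b) < 0"
    unfolding a b by (simp_all add: mult.left_commute)
  then have sgn: "sg i * g a > 0" "sg i * g b < 0" using y1 y2 by (auto simp: zero_less_mult_iff mult_less_0_iff)
  have "a \<in> gap i" "b \<in> gap i" using is_interval_gap[OF y1(1) y2(1)] a b by auto
  have "continuous_on {a..b} (\<lambda>x. sg i * g x)"
    unfolding g_def using gap_less_iff(2) is_interval_gap[OF \<open>a \<in> gap i\<close> \<open>b \<in> gap i\<close>] i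
    by (intro continuous_intros) (auto, fastforce)
  then obtain c where "a \<le> c" "c \<le> b" "sg i * g c = 0"
    using IVT2'[of "\<lambda>x. sg i * g x" b 0 a] sgn a b by auto
  then show ?thesis using is_interval_gap[OF \<open>a \<in> gap i\<close> \<open>b \<in> gap i\<close>] by (intro bexI[of _ c]) (auto simp: sg_def split: if_splits)
qed

lemma critical_unique:
  assumes "i \<le> n" "x \<in> gap i" "y \<in> gap i" "g x = 0" "g y = 0"
  shows "x = y"
  using shifted_strict_mono[of x i y] shifted_strict_mono[of y i x] assms by (cases x y rule: linorder_cases) auto

definition crit :: "nat \<Rightarrow> real" where
  "crit i = (THE x. x \<in> gap i \<and> g x = 0)"

lemma crit:
  assumes i: "i \<in> {1..n} - {N}"
  shows "crit i \<in> gap i" "g (crit i) = 0" "\<And>x. x \<in> gap i \<Longrightarrow> g x = 0 \<Longrightarrow> x = crit i"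
proof -
  have "\<exists>!x. x \<in> gap i \<and> g x = 0"
    using critical_exists[OF i] critical_unique[of i] i by (metis DiffD1 atLeastAtMost_iff)
  from theI'[OF this] show 1: "crit i \<in> gap i" "g (crit i) = 0" by (auto simp: crit_def)
  show "x = crit i" if "x \<in> gap i" "g x = 0" for x
    using that critical_unique[of i x "crit i"] 1 i by auto
qed

lemma g_sign:
  assumes i: "i \<in> {1..n} - {N}" and x: "x \<in> gap i"
  shows "x < crit i \<Longrightarrow> 0 < sg i * g x" "crit i < x \<Longrightarrow> sg i * g x < 0"
proof -
  have N: "(if i < N then x < k N else k N < x)"
    using gap_less_iff[OF x, of N] i N_ge N_less by force
  have "i \<le> n" using i by simp
  show "0 < sg i * g x" if "x < crit i"
    using shifted_strict_mono[OF x crit(1)[OF i] \<open>i \<le> n\<close> that] crit(2)[OF i] N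
    by (auto simp: sg_def mult_less_0_iff split: if_splits)
  show "sg i * g x < 0" if "crit i < x"
    using shifted_strict_mono[OF crit(1)[OF i] x \<open>i \<le> n\<close> that] crit(2)[OF i] N
    by (auto simp: sg_def zero_less_mult_iff split: if_splits)
qed

definition tip :: "nat \<Rightarrow> real" where
  "tip i = RV (crit i)"

lemma RV_less_tip:
  assumes i: "i \<in> {1..n} - {N}" and x: "x \<in> gap i" "x \<noteq> crit i"
  shows "sg i * RV x < sg i * tip i"
proof -
  have d: "((\<lambda>t. sg i * RV t) has_real_derivative sg i * g t) (at t)" if "t \<in> gap i" for t
    using DERIV_cmult[OF DERIV_RV[OF that]] i by auto
  note c = crit(1)[OF i]
  consider "x < crit i" | "crit i < x" using x by linarith
  then show ?thesis
  proof cases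
    case 1
    from MVT2[OF 1, of "\<lambda>t. sg i * RV t" "\<lambda>t. sg i * g t"] d is_interval_gap[OF x(1) c]
    obtain z where z: "x < z" "z < crit i" "sg i * RV (crit i) - sg i * RV x = (crit i - x) * (sg i * g z)"
      by blast
    have "0 < sg i * g z" using g_sign(1)[OF i] is_interval_gap[OF x(1) c] z by simp
    then have "0 < (crit i - x) * (sg i * g z)" using 1 by simp
    then show ?thesis using z(3) by (simp add: tip_def)
  next
    case 2
    from MVT2[OF 2, of "\<lambda>t. sg i * RV t" "\<lambda>t. sg i * g t"] d is_interval_gap[OF c x(1)]
    obtain z where z: "crit i < z" "z < x" "sg i * RV x - sg i * RV (crit i) = (x - crit i) * (sg i * g z)"
      by blast
    have "sg i * g z < 0" using g_sign(2)[OF i] is_interval_gap[OF c x(1)] z by simp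
    then have "(x - crit i) * (sg i * g z) < 0" using 2 by (simp add: mult_pos_neg)
    then show ?thesis using z(3) by (simp add: tip_def)
  qed
qed

lemma RV_gap_image:
  assumes i: "i \<in> {1..n} - {N}" and v: "sg i * v \<le> sg i * tip i"
  obtains x where "x \<in> gap i" "RV x = v"
proof -
  note c = crit(1)[OF i]
  obtain y where y: "y \<in> gap i" "y < crit i" "sg i * RV y < sg i * v" using RV_escapes(1)[OF i c] by blast
  have "continuous_on {y..crit i} (\<lambda>t. sg i * RV t)"
  proof (intro continuous_intros DERIV_continuous_on[where D = g])
    fix t assume "t \<in> {y..crit i}"
    then have "t \<in> gap i" using is_interval_gap[OF y(1) c] by simp
    then show "(RV has_real_derivative g t) (at t within {y..crit i})"
      using DERIV_RV i by (auto intro: has_field_derivative_at_within)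
  qed
  then obtain x where "y \<le> x" "x \<le> crit i" "sg i * RV x = sg i * v"
    using IVT'[of "\<lambda>t. sg i * RV t" y "sg i * v" "crit i"] y v by (auto simp: tip_def)
  then show ?thesis using that[of x] is_interval_gap[OF y(1) c] by (auto simp: sg_def split: if_splits)
qed

section \<open>The image of the half-plane\<close>

text \<open>
  The other points of a slit have a preimage on either side of the critical point; the tip has only
  this one, since the maximum is strict and different gaps have different heights.
\<close>

lemma H_real_eq_tip:
  assumes i: "i \<in> {1..n} - {N}" and z: "z \<in> cuhp" and eq: "H z = H (of_real (crit i))"
  shows "z = of_real (crit i)"
proof -
  have c: "of_real (crit i) \<in> cuhp" "i \<le> n" using crit(1)[OF i] gap_cuhp i by auto
  have "z \<notin> uhp" using H_uhp_neq_H_real[OF _ c(1)] eq by blast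
  then have "z = of_real (Re z)" using z by (auto simp: uhp_def cuhp_def complex_eq_iff)
  moreover obtain j where j: "j \<le> n" "Re z \<in> gap j" using real_in_gap z calculation by metis
  ultimately have "H z = Complex (RV (Re z)) (height j)" using H_of_real by metis
  moreover have "H z = Complex (tip i) (height i)" using H_of_real[OF crit(1)[OF i]] i eq by (simp add: tip_def)
  ultimately have eqs: "RV (Re z) = tip i" "height j = height i" by auto
  then have "j = i" using inj_height i j by (auto dest: inj_onD)
  then have "Re z = crit i" using RV_less_tip[OF i, of "Re z"] eqs j by force
  then show ?thesis using \<open>z = of_real (Re z)\<close> by simp
qed

definition free :: "complex \<Rightarrow> bool" where
  "free w \<longleftrightarrow> (\<forall>i\<in>{1..n} - {N}. Im w = height i \<longrightarrow> sg i * tip i < sg i * Re w)"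

text \<open>
  Every horizontal line meets the complement of the slits in a connected set \<open>X\<close>, a line or a ray.
  The points of the image on that line form a subset of \<open>X\<close> that is open, because \<open>H\<close> is an open
  map, and closed in \<open>X\<close>, because a limit of values of \<open>H\<close> is a value or a boundary value. So it
  suffices to find one point of the image on each line, and these exist since \<open>Im H\<close> comes close to
  both extreme heights and the half-plane is connected.
\<close>

lemma image_H: "H ` uhp = {w. height N < Im w \<and> Im w < height 0 \<and> free w}"
proof (intro equalityI subsetI)
  fix w assume "w \<in> H ` uhp"
  then obtain z where z: "z \<in> uhp" "w = H z" by blast
  have "free w"
    unfolding free_def
  proof (intro ballI impI, rule ccontr)
    fix i assume i: "i \<in> {1..n} - {N}" and "Im w = height i" and "\<not> sg i * tip i < sg i * Re w"
    then obtain x where x: "x \<in> gap i" "RV x = Re w" using RV_gap_image[OF i, of "Re w"] by force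
    then have "H (of_real x) = w" using H_of_real[of x i] i \<open>Im w = height i\<close> by (auto simp: complex_eq_iff)
    then show False using H_uhp_neq_H_real[OF z(1) gap_cuhp[OF x(1)]] z i by auto
  qed
  then show "w \<in> {w. height N < Im w \<and> Im w < height 0 \<and> free w}" using Im_H_bounds z by auto
next
  fix w assume "w \<in> {w. height N < Im w \<and> Im w < height 0 \<and> free w}"
  then have w: "height N < Im w" "Im w < height 0" "free w" by auto
  define y where "y = Im w"
  have close: "\<exists>z\<in>uhp. \<bar>Im (H z) - height i\<bar> < d" if i: "i \<le> n" and d: "0 < d" for i d
  proof -
    obtain x where x: "x \<in> gap i" using gap_nonempty[OF i] by blast
    have "H (of_real x) \<in> ball (H (of_real x)) d" using d by simp
    then obtain z where "z \<in> uhp" "H z \<in> ball (H (of_real x)) d"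
      using uhp_near_real[OF gap_cuhp[OF x i] open_ball _ zero_less_one] by blast
    then show ?thesis using abs_Im_le_cmod[of "H z - H (of_real x)"] Im_H_gap[OF x i]
      by (intro bexI[of _ z]) (auto simp: dist_norm norm_minus_commute)
  qed
  have "y \<in> (\<lambda>z. Im (H z)) ` uhp"
  proof -
    have "connected ((\<lambda>z. Im (H z)) ` uhp)"
      using holomorphic_on_imp_continuous_on[OF holomorphic_H] convex_connected[OF convex_uhp]
      by (intro connected_continuous_image continuous_intros)
    moreover obtain z1 where "z1 \<in> uhp" "Im (H z1) < y" using close[of N "y - height N"] w N_less by (force simp: y_def)
    moreover obtain z2 where "z2 \<in> uhp" "y < Im (H z2)" using close[of 0 "height 0 - y"] w by (force simp: y_def)
    ultimately show ?thesis by (meson connectedD_interval image_eqI less_imp_le)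
  qed
  then obtain z0 where z0: "z0 \<in> uhp" "Im (H z0) = y" by auto
  \<comment> \<open>the abscissae of points off the slits (\<open>X\<close>), of the image (\<open>A\<close>), off its closure (\<open>B\<close>) at height \<open>y\<close>\<close>
  define X where "X = {x. \<forall>i\<in>{1..n} - {N}. y = height i \<longrightarrow> sg i * tip i < sg i * x}"
  define A where "A = {x. Complex x y \<in> H ` uhp}"
  define B where "B = {x. Complex x y \<notin> closure (H ` uhp)}"
  have "X = (\<Inter>i\<in>{i \<in> {1..n} - {N}. y = height i}. {x. sg i * tip i < sg i * x})" by (auto simp: X_def)
  moreover have "convex {x. sg i * tip i < sg i * x}" for i
  proof -
    have "{x. sg i * tip i < sg i * x} = (if i < N then {tip i<..} else {..<tip i})" by (auto simp: sg_def)
    then show ?thesis by auto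
  qed
  ultimately have "connected X" by (simp add: convex_connected convex_INT)
  have cont: "continuous_on UNIV (\<lambda>x. Complex x y)" by (intro continuous_intros)
  have "open A" unfolding A_def
    using open_vimage[OF open_mapping_thm3[OF holomorphic_H open_uhp inj_H] cont] by (simp add: vimage_def)
  have "open B" unfolding B_def
    using open_vimage[OF open_Compl[OF closed_closure] cont] by (simp add: vimage_def)
  have "A \<inter> B = {}" using closure_subset[of "H ` uhp"] unfolding A_def B_def by blast
  have "X \<subseteq> A \<union> B"
  proof
    fix x assume x: "x \<in> X"
    show "x \<in> A \<union> B"
    proof (rule ccontr)
      assume nx: "x \<notin> A \<union> B"
      then obtain z where z: "z \<in> cuhp" "H z = Complex x y" by (auto simp: B_def elim: closure_image_H)
      then have "z \<notin> uhp" using nx unfolding A_def by (metis (mono_tags) UnCI image_eqI mem_Collect_eq)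
      then have zr: "z = of_real (Re z)" using z by (auto simp: uhp_def cuhp_def complex_eq_iff)
      then obtain j where j: "j \<le> n" "Re z \<in> gap j" using real_in_gap z by metis
      then have "Complex x y = Complex (RV (Re z)) (height j)" using H_of_real z zr by metis
      then have e: "x = RV (Re z)" "y = height j" by auto
      then have j': "j \<in> {1..n} - {N}" using w j by (auto simp: y_def intro: Suc_leI gr0I)
      then have "sg j * tip j < sg j * x" using x e by (auto simp: X_def)
      then show False using RV_less_tip[OF j' j(2)] e by (cases "Re z = crit j") (auto simp: tip_def)
    qed
  qed
  then have "A \<inter> X = {} \<or> B \<inter> X = {}"
    using connectedD[OF \<open>connected X\<close> \<open>open A\<close> \<open>open B\<close>] \<open>A \<inter> B = {}\<close> by auto
  moreover have "Re (H z0) \<in> A" using z0 by (auto simp: A_def complex_eq_iff intro!: image_eqI[of _ _ z0])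
  moreover have "Re (H z0) \<in> X"
  proof -
    have "Re (H z0) \<notin> - X" 
    proof
      assume "Re (H z0) \<in> - X"
      then obtain i where i: "i \<in> {1..n} - {N}" "y = height i" "sg i * Re (H z0) \<le> sg i * tip i" by (force simp: X_def)
      then obtain x where x: "x \<in> gap i" "RV x = Re (H z0)" using RV_gap_image[of i "Re (H z0)"] by force
      then have "H (of_real x) = H z0" using H_of_real[of x i] i z0 by (auto simp: complex_eq_iff)
      then show False using H_uhp_neq_H_real[OF z0(1) gap_cuhp[OF x(1)]] i by auto
    qed
    then show ?thesis by simp
  qed
  ultimately have "X \<subseteq> A" using \<open>X \<subseteq> A \<union> B\<close> by blast
  moreover have "Re w \<in> X" using w(3) by (auto simp: X_def free_def y_def)
  ultimately show "w \<in> H ` uhp" by (auto simp: A_def y_def complex_eq_iff)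
qed

end

section \<open>Asymptotics at infinity and near the charges\<close>

lemma norm_Ln_minus_le:
  assumes "cmod u \<le> 1 / 2"
  shows "cmod (Ln (1 - u) + u) \<le> 4 * cmod u ^ 2"
proof -
  let ?S = "cball (0::complex) (1 / 2)"
  let ?f = "\<lambda>i::nat. if i = 0 then (\<lambda>u. Ln (1 - u)) else if i = 1 then (\<lambda>u. - 1 / (1 - u)) else (\<lambda>u. - 1 / (1 - u)^2)"
  have re: "1 / 2 \<le> Re (1 - x)" if "x \<in> ?S" for x
    using that abs_Re_le_cmod[of x] by (auto simp: dist_norm)
  have "cmod (?f 0 u - (\<Sum>i\<le>1. ?f i 0 * (u - 0)^i / fact i)) \<le> 4 * cmod (u - 0)^(Suc 1) / fact 1"
  proof (rule complex_Taylor[where S = ?S])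
    fix i x assume x: "x \<in> ?S" and "i \<le> (1::nat)"
    then consider "i = 0" | "i = 1" by linarith
    then show "(?f i has_field_derivative ?f (Suc i) x) (at x within ?S)"
    proof cases
      case 1
      have "1 - x \<notin> \<real>\<^sub>\<le>\<^sub>0" using re[OF x] by (auto simp: complex_nonpos_Reals_iff)
      note L = has_field_derivative_Ln[OF this]
      have "((\<lambda>u. 1 - u) has_field_derivative - 1) (at x within ?S)" by (auto intro!: derivative_eq_intros)
      from DERIV_chain2[where f = Ln and g = "\<lambda>u. 1 - u", OF L this]
      have "((\<lambda>u. Ln (1 - u)) has_field_derivative - 1 / (1 - x)) (at x within ?S)"
        by (rule DERIV_cong) (simp only: divide_inverse mult.commute)
      then show ?thesis using 1 by simp
    next
      case 2
      have "1 - x \<noteq> 0" using re[OF x] by auto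
      then have "((\<lambda>u. - 1 / (1 - u)) has_field_derivative - 1 / (1 - x)^2) (at x within ?S)"
        by (auto intro!: derivative_eq_intros simp: power2_eq_square)
      then show ?thesis using 2 by simp
    qed
  next
    fix x assume x: "x \<in> ?S"
    have c: "1 / 2 \<le> cmod (1 - x)" using re[OF x] complex_Re_le_cmod[of "1 - x"] by linarith
    then have "(1 / 2)^2 \<le> cmod (1 - x)^2" by (intro power_mono) auto
    then have "1 / cmod (1 - x)^2 \<le> 1 / (1 / 2)^2" using c by (intro divide_left_mono) (auto intro!: mult_pos_pos zero_less_power)
    then show "cmod (?f (Suc 1) x) \<le> 4" by (simp add: norm_divide norm_power norm_mult power2_eq_square)
  qed (use assms in auto)
  then show ?thesis by (simp add: power2_eq_square)
qed

lemma norm_exp_minus_le: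
  assumes "cmod u \<le> 1"
  shows "cmod (exp u - 1 - u) \<le> exp 1 * cmod u ^ 2"
proof -
  have "cmod (exp u - (\<Sum>i\<le>1. exp 0 * (u - 0)^i / fact i)) \<le> exp 1 * cmod (u - 0)^(Suc 1) / fact 1"
  proof (rule complex_Taylor[where S = "cball 0 1" and f = "\<lambda>i. exp"])
    fix x :: complex assume "x \<in> cball 0 1"
    then have "cmod x \<le> 1" by simp
    then show "cmod (exp x) \<le> exp 1" using norm_exp[of x] by (smt (verit) exp_le_cancel_iff)
  qed (use assms in \<open>auto intro!: derivative_eq_intros\<close>)
  then show ?thesis by (simp add: power2_eq_square algebra_simps)
qed

lemma bigo_cmult:
  fixes f :: "'a \<Rightarrow> complex"
  assumes "f \<in> O[F](g)"
  shows "(\<lambda>x. c * f x) \<in> O[F](g)"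
proof -
  obtain C where C: "\<forall>\<^sub>F x in F. norm (f x) \<le> C * norm (g x)" by (rule landau_o.bigE[OF assms]) (rule that)
  have "\<forall>\<^sub>F x in F. norm (c * f x) \<le> (norm c * C) * norm (g x)"
    using C by eventually_elim (simp add: norm_mult mult_left_mono mult.assoc)
  then show ?thesis by (rule bigoI)
qed

text \<open>
  If \<open>B log w + O(1/w)\<close> and \<open>B log z - c + O(1/z)\<close> agree, then \<open>w = a z exp D\<close> with a small
  remainder \<open>D\<close>. First this gives \<open>w \<sim> a z\<close>, so that \<open>D = O(1/z)\<close>; inserting
  \<open>1/w = 1/(az) + O(1/z\<^sup>2)\<close> into \<open>D\<close> yields the constant term.
\<close>

lemma asymptotically_linear:
  fixes F :: "complex filter" and w E0 Et :: "complex \<Rightarrow> complex" and B c s0 st a b :: real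
  assumes z: "filterlim (\<lambda>z. z) at_infinity F" and w: "filterlim w at_infinity F"
    and B: "B \<noteq> 0"
    and eq: "\<forall>\<^sub>F z in F. of_real B * Ln (w z) + E0 (w z) = of_real B * Ln z - of_real c + Et z"
    and E0: "(\<lambda>\<zeta>. E0 \<zeta> + of_real s0 / \<zeta>) \<in> O[at_infinity](\<lambda>\<zeta>. (1 / \<zeta>)^2)"
    and Et: "(\<lambda>\<zeta>. Et \<zeta> + of_real st / \<zeta>) \<in> O[at_infinity](\<lambda>\<zeta>. (1 / \<zeta>)^2)"
    and a: "a = exp (- c / B)" and b: "b = (s0 - a * st) / B"
  shows "(\<lambda>z. w z - (of_real a * z + of_real b)) \<in> O[F](\<lambda>z. 1 / z)"
proof -
  have a0: "a \<noteq> 0" using a by simp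
  have z0: "\<forall>\<^sub>F z in F. z \<noteq> 0" using filterlim_at_infinity_imp_eventually_ne[OF z] .
  have w0: "\<forall>\<^sub>F z in F. w z \<noteq> 0" using filterlim_at_infinity_imp_eventually_ne[OF w] .
  have Lz: "((\<lambda>z. 1 / z) \<longlongrightarrow> 0) F" by (rule tendsto_divide_0[OF tendsto_const z])
  have Lw: "((\<lambda>z. 1 / w z) \<longlongrightarrow> 0) F" by (rule tendsto_divide_0[OF tendsto_const w])
  define P where "P z = Et z + of_real st / z" for z
  define Q where "Q z = E0 (w z) + of_real s0 / w z" for z
  have P: "P \<in> O[F](\<lambda>z. (1 / z)^2)"
    unfolding P_def using landau_o.big.compose[OF Et z] by simp
  have Q: "Q \<in> O[F](\<lambda>z. (1 / w z)^2)"
    unfolding Q_def using landau_o.big.compose[OF E0 w] by simp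
  have small: "(f \<longlongrightarrow> 0) F" if fg: "f \<in> O[F](g)" "(g \<longlongrightarrow> 0) F" for f g :: "complex \<Rightarrow> complex"
  proof -
    obtain C where C: "\<forall>\<^sub>F z in F. cmod (f z) \<le> C * cmod (g z)" by (rule landau_o.bigE[OF fg(1)]) (rule that)
    have "((\<lambda>z. C * cmod (g z)) \<longlongrightarrow> 0) F" using tendsto_mult_right_zero[OF tendsto_norm_zero[OF fg(2)]] .
    then show ?thesis by (rule Lim_null_comparison[OF C])
  qed
  have P0: "(P \<longlongrightarrow> 0) F" using small[OF P] tendsto_power[OF Lz, of 2] by simp
  have Q0: "(Q \<longlongrightarrow> 0) F" using small[OF Q] tendsto_power[OF Lw, of 2] by simp
  define D where "D z = (Et z - E0 (w z)) / of_real B" for z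
  have D_eq: "D z = (P z - Q z - of_real st * (1 / z) + of_real s0 * (1 / w z)) / of_real B" for z
    by (simp add: D_def P_def Q_def)
  have D0: "(D \<longlongrightarrow> 0) F"
  proof -
    have "((\<lambda>z. (P z - Q z - of_real st * (1 / z) + of_real s0 * (1 / w z)) / of_real B)
        \<longlongrightarrow> (0 - 0 - of_real st * 0 + of_real s0 * 0) / of_real B) F"
      by (rule Lz Lw P0 Q0 tendsto_const tendsto_add tendsto_diff tendsto_mult tendsto_divide | simp add: B)+
    then show ?thesis by (simp add: D_eq[abs_def])
  qed
  have w_eq: "\<forall>\<^sub>F z in F. w z = of_real a * z * exp (D z)"
    using eq z0 w0
  proof eventually_elim
    case (elim z)
    have "of_real B * Ln (w z) = of_real B * (Ln z + (D z - of_real (c / B)))"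
    proof -
      have BD: "of_real B * D z = Et z - E0 (w z)" using B by (simp add: D_def)
      have Bc: "of_real B * of_real (c / B) = (of_real c :: complex)" using B by simp
      show ?thesis using elim(1) BD Bc by algebra
    qed
    then have "Ln (w z) = Ln z + (D z - of_real (c / B))" using B by simp
    then have "exp (Ln (w z)) = z * (exp (D z) * exp (- of_real (c / B)))"
      using elim(2) by (simp add: exp_add exp_diff exp_minus divide_inverse)
    also have "exp (- of_real (c / B) :: complex) = of_real a"
      unfolding a by (simp flip: exp_of_real)
    finally show ?case using elim(3) by (simp add: mult_ac)
  qed
  have expD: "((\<lambda>z. exp (D z)) \<longlongrightarrow> 1) F" using tendsto_exp[OF D0] by simp
  have "((\<lambda>z. 1 / (of_real a * exp (D z))) \<longlongrightarrow> 1 / of_real a) F"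
    by (rule tendsto_eq_intros expD refl | simp add: a0)+
  moreover have "\<forall>\<^sub>F z in F. 1 / (of_real a * exp (D z)) = (1 / w z) / (1 / z)"
    using w_eq z0 by eventually_elim (simp add: a0)
  ultimately have "((\<lambda>z. (1 / w z) / (1 / z)) \<longlongrightarrow> 1 / of_real a) F"
    by (rule Lim_transform_eventually)
  then have wO: "(\<lambda>z. 1 / w z) \<in> O[F](\<lambda>z. 1 / z)"
    by (rule bigoI_tendsto) (use z0 in \<open>auto elim: eventually_mono\<close>)
  have QO: "Q \<in> O[F](\<lambda>z. (1 / z)^2)"
    using landau_o.big_trans[OF Q landau_o.big.mult[OF wO wO, folded power2_eq_square]] .
  have sq: "(\<lambda>z::complex. (1 / z)^2) \<in> O[F](\<lambda>z. 1 / z)"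
  proof -
    have "((\<lambda>z. (1 / z)^2 / (1 / z)) \<longlongrightarrow> 0) F"
    proof -
      have "(\<lambda>z::complex. (1 / z)^2 / (1 / z)) = (\<lambda>z. 1 / z)" by (auto simp: power2_eq_square)
      then show ?thesis using Lz by (simp only:)
    qed
    then show ?thesis by (rule bigoI_tendsto) (use z0 in \<open>auto elim: eventually_mono\<close>)
  qed
  have "D = (\<lambda>z. of_real (1 / B) * (P z - Q z - of_real st * (1 / z) + of_real s0 * (1 / w z)))"
    by (simp add: D_eq[abs_def])
  moreover have "\<dots> \<in> O[F](\<lambda>z. 1 / z)"
    by (intro bigo_cmult sum_in_bigo wO landau_o.big_refl landau_o.big_trans[OF P sq] landau_o.big_trans[OF QO sq])
  ultimately have DO: "D \<in> O[F](\<lambda>z. 1 / z)" by simp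
  define R where "R z = exp (D z) - 1 - D z" for z
  have "R \<in> O[F](\<lambda>z. D z ^ 2)"
  proof (rule bigoI)
    have "\<forall>\<^sub>F z in F. cmod (D z) < 1" using order_tendstoD(2)[OF tendsto_norm[OF D0], of 1] by simp
    then show "\<forall>\<^sub>F z in F. cmod (R z) \<le> exp 1 * cmod (D z ^ 2)"
      by eventually_elim (use norm_exp_minus_le in \<open>auto simp: R_def norm_power\<close>)
  qed
  then have R: "R \<in> O[F](\<lambda>z. (1 / z)^2)"
    using landau_o.big_trans[OF _ landau_o.big.mult[OF DO DO, folded power2_eq_square]] by blast
  have e1: "(\<lambda>z. exp (D z) - 1) \<in> O[F](\<lambda>z. 1 / z)"
    using sum_in_bigo(1)[OF landau_o.big_trans[OF R sq] DO] by (simp add: R_def)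
  \<comment> \<open>the error of \<open>1/(az)\<close> as an approximation of \<open>1/w\<close>\<close>
  define U where "U z = (exp (D z) - 1) * (1 / w z)" for z
  have U: "U \<in> O[F](\<lambda>z. (1 / z)^2)"
    unfolding U_def power2_eq_square by (rule landau_o.big.mult[OF e1 wO])
  define Y where "Y z = of_real (a / B) * (P z - Q z) + of_real a * R z - of_real (a * s0 / B) * U z" for z
  have Y: "Y \<in> O[F](\<lambda>z. (1 / z)^2)"
    unfolding Y_def by (intro bigo_cmult sum_in_bigo P QO R U)
  have mem: "(\<lambda>z. z * Y z) \<in> O[F](\<lambda>z. z * (1 / z)^2)"
    by (rule landau_o.big.mult[OF landau_o.big_refl Y])
  have fe: "(\<lambda>z::complex. z * (1 / z)^2) = (\<lambda>z. 1 / z)"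
    by (auto simp: power2_eq_square)
  have ev: "\<forall>\<^sub>F z in F. z * Y z = w z - (of_real a * z + of_real b)"
    using w_eq z0 w0
  proof eventually_elim
    case (elim z)
    have U': "z * U z = z / w z * exp (D z) - z / w z" by (simp add: U_def algebra_simps diff_divide_distrib)
    have "exp (D z) \<noteq> 0" by simp
    then have "z / w z * exp (D z) = 1 / of_real a" unfolding elim(1) using elim(2) a0 by (simp add: field_simps)
    then have zw: "z / w z = 1 / of_real a - z * U z" using U' by simp
    have "w z = of_real a * z * (1 + D z + R z)" using elim(1) by (simp add: R_def)
    also have "\<dots> = of_real a * z + of_real (a / B) * (z * (P z - Q z) - of_real st + of_real s0 * (z / w z)) + of_real a * z * R z"
      unfolding D_eq using elim(2) B by (simp add: field_simps)
    also have "\<dots> = of_real a * z + of_real b + z * Y z"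
      unfolding zw b Y_def using a0 B by (simp add: field_simps)
    finally show ?case by simp
  qed
  from mem[unfolded fe] show ?thesis by (rule landau_o.big.in_cong[OF ev, THEN iffD1])
qed

context charges
begin

lemma height_antimono: "i \<le> j \<Longrightarrow> j \<le> N \<Longrightarrow> height j \<le> height i"
  using height_decreasing[of i j] by (cases "i = j") auto

lemma height_mono: "N \<le> i \<Longrightarrow> i \<le> j \<Longrightarrow> j \<le> n \<Longrightarrow> height i \<le> height j"
  using height_increasing[of i j] by (cases "i = j") auto

text \<open>
  Near a charge only its own argument varies, between \<open>0\<close> and \<open>\<pi>\<close>; the others are almost constant,
  and with them \<open>Im H\<close> has the values on the two adjacent gaps as its extremes.
\<close>

lemma Im_H_near_charge:
  assumes i: "i \<in> {1..n}" and \<delta>: "0 < \<delta>"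
  shows "\<exists>e>0. \<forall>z\<in>uhp. cmod (z - of_real (k i)) < e \<longrightarrow>
    min (height i) (height (i - 1)) - \<delta> < Im (H z) \<and> Im (H z) < max (height i) (height (i - 1)) + \<delta>"
proof -
  let ?a = "of_real (k i) :: complex"
  let ?C = "{w. 0 \<le> Im w}"
  define G where "G z = (\<Sum>j\<in>{1..n}-{i}. q j * Im (Ln (z - of_real (k j))))" for z
  have "continuous (at ?a within ?C) (\<lambda>z. q j * Im (Ln (z - of_real (k j))))" if j: "j \<in> {1..n} - {i}" for j
  proof -
    have "k i \<noteq> k j" using k_inj[of i j] i j by auto
    then have "continuous (at ?a within ?C) (\<lambda>z. Ln (z - of_real (k j)))"
      using has_field_derivative_Ln_closed_uhp[of ?a "k j"] by (intro DERIV_continuous) auto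
    then show ?thesis by (intro continuous_mult continuous_const continuous_Im)
  qed
  then have "continuous (at ?a within ?C) G" unfolding G_def by (intro continuous_sum)
  then obtain e where e: "0 < e" "\<And>z. z \<in> ?C \<Longrightarrow> dist z ?a < e \<Longrightarrow> dist (G z) (G ?a) < \<delta>"
    using \<delta> unfolding continuous_within_eps_delta by blast
  have "Im (Ln (?a - of_real (k j))) = (if i < j then pi else 0)" if "j \<in> {1..n} - {i}" for j
  proof -
    have "k i < k j \<longleftrightarrow> i < j" "k i \<noteq> k j" using k_less[of i j] k_less[of j i] k_inj[of i j] that i
      by (metis DiffD1 DiffD2 insertCI less_asym linorder_neqE_nat, metis DiffD1 DiffD2 insertCI)
    moreover have "?a - of_real (k j) = (of_real (k i - k j) :: complex)" by simp
    ultimately show ?thesis by (simp add: Ln_of_real' del: of_real_diff)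
  qed
  then have "G ?a = (\<Sum>j\<in>{1..n}-{i}. if j \<in> {i+1..n} then pi * q j else 0)"
    unfolding G_def by (intro sum.cong) auto
  also have "\<dots> = height i"
    unfolding height_def sum_distrib_left by (subst sum.inter_restrict[symmetric]) (use i in \<open>auto intro!: sum.cong\<close>)
  finally have Ga: "G ?a = height i" .
  have "min (height i) (height (i - 1)) - \<delta> < Im (H z) \<and> Im (H z) < max (height i) (height (i - 1)) + \<delta>"
    if z: "z \<in> uhp" "cmod (z - ?a) < e" for z
  proof -
    have z': "0 < Im z" using z by (simp add: uhp_def)
    have H: "Im (H z) = G z + q i * Im (Ln (z - ?a))"
      unfolding Im_H G_def using i by (subst sum.remove[of _ i]) auto
    have "\<bar>G z - height i\<bar> < \<delta>" using e(2)[of z] z z' Ga by (simp add: dist_norm dist_real_def)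
    moreover have "height (i - 1) = height i + pi * q i" using height_step[OF i] .
    moreover have "min 0 (pi * q i) \<le> q i * Im (Ln (z - ?a))" "q i * Im (Ln (z - ?a)) \<le> max 0 (pi * q i)"
    proof -
      note b = Im_Ln_uhp[OF z', of "k i"]
      show "min 0 (pi * q i) \<le> q i * Im (Ln (z - ?a))"
      proof (cases "0 \<le> q i")
        case True then show ?thesis using b by (auto intro: min.coboundedI1)
      next
        case False
        then have "q i * pi \<le> q i * Im (Ln (z - ?a))" using b by (intro mult_left_mono_neg) auto
        then show ?thesis by (simp add: mult.commute min.coboundedI2)
      qed
      show "q i * Im (Ln (z - ?a)) \<le> max 0 (pi * q i)"
      proof (cases "0 \<le> q i")
        case True
        then have "q i * Im (Ln (z - ?a)) \<le> q i * pi" using b by (intro mult_left_mono) auto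
        then show ?thesis by (simp add: mult.commute max.coboundedI2)
      next
        case False
        then have "q i * Im (Ln (z - ?a)) \<le> 0" using b by (intro mult_nonpos_nonneg) auto
        then show ?thesis by simp
      qed
    qed
    ultimately show ?thesis unfolding H by (auto simp: min_def max_def abs_less_iff split: if_splits)
  qed
  then show ?thesis using e(1) by blast
qed

text \<open>
  The part of \<open>H\<close> that remains at infinity after the logarithm of the total charge is split off.
\<close>

definition Eps :: "complex \<Rightarrow> complex" where
  "Eps z = (\<Sum>j=1..n. of_real (q j) * Ln (1 - of_real (k j) / z))"

lemma H_eq_Eps:
  assumes "z \<in> uhp" "\<And>j. j \<in> {1..n} \<Longrightarrow> \<bar>k j\<bar> < cmod z"
  shows "H z = of_real (\<Sum>j=1..n. q j) * Ln z + Eps z"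
proof -
  have "H z = (\<Sum>j=1..n. of_real (q j) * (Ln z + Ln (1 - of_real (k j) / z)))"
    unfolding H_def using assms by (intro sum.cong refl) (simp add: Ln_minus_eq_add uhp_def)
  then show ?thesis by (simp add: Eps_def distrib_left sum.distrib sum_distrib_right)
qed

lemma Eps_asymp:
  "(\<lambda>z. Eps z + of_real (\<Sum>j=1..n. q j * k j) / z) \<in> O[at_infinity](\<lambda>z. (1 / z)^2)"
proof -
  have "(\<lambda>z. of_real (q j) * (Ln (1 - of_real (k j) / z) + of_real (k j) / z)) \<in> O[at_infinity](\<lambda>z. (1 / z)^2)" for j
  proof -
    have "((\<lambda>z::complex. of_real (k j) / z) \<longlongrightarrow> 0) at_infinity"
      by (rule tendsto_divide_0[OF tendsto_const filterlim_ident])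
    then have "\<forall>\<^sub>F z::complex in at_infinity. cmod (of_real (k j) / z) < 1 / 2"
      using order_tendstoD(2)[OF tendsto_norm, of _ 0 at_infinity "1/2"] by fastforce
    then have "\<forall>\<^sub>F z in at_infinity. cmod (of_real (q j) * (Ln (1 - of_real (k j) / z) + of_real (k j) / z))
        \<le> (\<bar>q j\<bar> * (4 * (k j)^2)) * cmod ((1 / z)^2)"
    proof eventually_elim
      case (elim z)
      have "cmod (Ln (1 - of_real (k j) / z) + of_real (k j) / z) \<le> 4 * (k j)^2 * cmod ((1 / z)^2)"
        using norm_Ln_minus_le[of "of_real (k j) / z"] elim
        by (simp add: norm_divide norm_power power_divide)
      then have "\<bar>q j\<bar> * cmod (Ln (1 - of_real (k j) / z) + of_real (k j) / z) \<le> \<bar>q j\<bar> * (4 * (k j)^2 * cmod ((1 / z)^2))"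
        by (intro mult_left_mono) auto
      then show ?case by (simp only: norm_mult norm_of_real mult.assoc)
    qed
    then show ?thesis by (rule bigoI)
  qed
  then have "(\<lambda>z. \<Sum>j=1..n. of_real (q j) * (Ln (1 - of_real (k j) / z) + of_real (k j) / z)) \<in> O[at_infinity](\<lambda>z. (1 / z)^2)"
    by (rule big_sum_in_bigo)
  then show ?thesis by (simp add: Eps_def distrib_left sum.distrib sum_divide_distrib)
qed

text \<open>
  The image of a neighbourhood of infinity and that of a neighbourhood of the last charge both
  contain points whose height is close to \<open>0\<close>, the height of the last slit, and are on different
  sides of it. This lemma and the next separate them. Here the main term is at least of order
  \<open>Im z / |z|\<close>, whereas \<open>Eps\<close>, an analytic function of \<open>1/z\<close> with real coefficients, contributes
  \<open>O(Im z / |z|\<^sup>2)\<close>.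
\<close>

lemma Im_H_pos_at_infinity: "\<exists>R. \<forall>z\<in>uhp. R < cmod z \<longrightarrow> 0 < Im (H z)"
proof -
  let ?B = "\<Sum>j=1..n. q j"
  define M where "M = (\<Sum>j=1..n. \<bar>k j\<bar>)"
  define C where "C = (\<Sum>j=1..n. \<bar>q j\<bar> * (2 * \<bar>k j\<bar>))"
  have M: "\<bar>k j\<bar> \<le> M" if "j \<in> {1..n}" for j unfolding M_def using that by (intro member_le_sum) auto
  have M0: "0 \<le> M" "0 \<le> C" by (auto simp: M_def C_def intro!: sum_nonneg)
  have "0 < Im (H z)" if z: "z \<in> uhp" "2 * M + 1 + C / ?B < cmod z" for z
  proof -
    have C0: "0 \<le> C / ?B" using M0 total_pos by simp
    have z0: "0 < Im z" "0 < cmod z" using z C0 M0 by (auto simp: uhp_def)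
    have k: "2 * \<bar>k j\<bar> \<le> cmod z" "\<bar>k j\<bar> < cmod z" if "j \<in> {1..n}" for j using M[OF that] z C0 M0 by linarith+
    have "\<bar>Im (Ln (1 - of_real (k j) / z))\<bar> \<le> 2 * \<bar>k j\<bar> * (Im z / cmod z ^ 2)" if j: "j \<in> {1..n}" for j
    proof -
      have "cmod (of_real (k j) / z) \<le> 1 / 2" using k[OF j] z0 by (simp add: norm_divide field_simps)
      then have re: "1 / 2 \<le> Re (1 - of_real (k j) / z)" using abs_Re_le_cmod[of "of_real (k j) / z"] by simp
      have im: "\<bar>Im (1 - of_real (k j) / z)\<bar> = \<bar>k j\<bar> * (Im z / cmod z ^ 2)"
        using z0 by (simp add: Im_divide cmod_power2 abs_mult)
      have "\<bar>Im (Ln (1 - of_real (k j) / z))\<bar> \<le> \<bar>Im (1 - of_real (k j) / z)\<bar> / Re (1 - of_real (k j) / z)"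
        using re by (intro abs_Im_Ln_le) auto
      also have "\<dots> \<le> \<bar>Im (1 - of_real (k j) / z)\<bar> / (1 / 2)"
        using re by (intro divide_left_mono) auto
      finally show ?thesis unfolding im by (simp add: mult_ac)
    qed
    then have "\<bar>Im (of_real (q j) * Ln (1 - of_real (k j) / z))\<bar> \<le> \<bar>q j\<bar> * (2 * \<bar>k j\<bar> * (Im z / cmod z ^ 2))"
      if "j \<in> {1..n}" for j
      using that by (simp add: abs_mult mult_left_mono del: times_divide_eq_right)
    then have "\<bar>Im (Eps z)\<bar> \<le> (\<Sum>j=1..n. \<bar>q j\<bar> * (2 * \<bar>k j\<bar> * (Im z / cmod z ^ 2)))"
      unfolding Eps_def Im_sum by (intro order_trans[OF sum_abs sum_mono])
    also have "\<dots> = C * (Im z / cmod z ^ 2)" unfolding C_def sum_distrib_right by (intro sum.cong) auto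
    also have "\<dots> < ?B * (Im z / cmod z)"
    proof -
      have "C < ?B * cmod z" using z C0 M0 total_pos by (simp add: field_simps)
         (smt (verit) M0 mult_nonneg_nonneg)
      then have "C / cmod z < ?B" using z0 by (simp add: field_simps)
      then have "C / cmod z * (Im z / cmod z) < ?B * (Im z / cmod z)" using z0 by (intro mult_strict_right_mono) auto
      then show ?thesis by (simp add: power2_eq_square)
    qed
    also have "\<dots> \<le> ?B * Im (Ln z)" using total_pos Im_Ln_ge[OF z0(1)] by (intro mult_left_mono) auto
    finally have "\<bar>Im (Eps z)\<bar> < ?B * Im (Ln z)" .
    then show ?thesis using H_eq_Eps[OF z(1) k(2)] by (simp add: abs_less_iff)
  qed
  then show ?thesis by blast
qed

text \<open>
  The argument at the last charge is at least \<open>Im z / |z - k\<^sub>n|\<close>, while the others are \<open>O(Im z)\<close>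
  since \<open>z\<close> lies to the right of their vertices.
\<close>

lemma Im_H_neg_near_last: "\<exists>e>0. \<forall>z\<in>uhp. cmod (z - of_real (k n)) < e \<longrightarrow> Im (H z) < 0"
proof -
  have n: "n \<in> {1..n}" "1 < n" using N_less N_ge by auto
  define d where "d = (k n - k (n - 1)) / 2"
  have d: "0 < d" using k_less[of "n - 1" n] n by (auto simp: d_def)
  have dj: "2 * d \<le> k n - k j" if "j \<in> {1..n} - {n}" for j
    using k_le[of j "n - 1"] that n by (auto simp: d_def)
  define C where "C = (\<Sum>j\<in>{1..n}-{n}. \<bar>q j\<bar> / d)"
  have C: "0 \<le> C" unfolding C_def using d by (intro sum_nonneg) auto
  have qn: "q n < 0" using q_neg[of n] N_less by simp
  have "Im (H z) < 0" if z: "z \<in> uhp" "cmod (z - of_real (k n)) < min d (- q n / (C + 1))" for z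
  proof -
    have z0: "0 < Im z" using z by (simp add: uhp_def)
    let ?r = "cmod (z - of_real (k n))"
    have r: "0 < ?r" "?r < d" "?r * (C + 1) < - q n" using z z0 C by (auto simp: field_simps)
    have "q j * Im (Ln (z - of_real (k j))) \<le> \<bar>q j\<bar> / d * Im z" if j: "j \<in> {1..n} - {n}" for j
    proof -
      have "\<bar>Re z - k n\<bar> < d" using r abs_Re_le_cmod[of "z - of_real (k n)"] by simp
      then have re: "d \<le> Re (z - of_real (k j))" using dj[OF j] by simp
      have "\<bar>Im (Ln (z - of_real (k j)))\<bar> \<le> Im z / Re (z - of_real (k j))"
        using abs_Im_Ln_le[of "z - of_real (k j)"] re d z0 by simp
      also have "\<dots> \<le> Im z / d" using re d z0 by (intro divide_left_mono) auto
      finally have "\<bar>q j\<bar> * \<bar>Im (Ln (z - of_real (k j)))\<bar> \<le> \<bar>q j\<bar> * (Im z / d)" by (intro mult_left_mono) auto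
      then show ?thesis by (simp add: abs_mult[symmetric])
    qed
    then have "(\<Sum>j\<in>{1..n}-{n}. q j * Im (Ln (z - of_real (k j)))) \<le> C * Im z"
      unfolding C_def sum_distrib_right by (intro sum_mono)
    moreover have "q n * Im (Ln (z - of_real (k n))) \<le> q n * (Im z / ?r)"
      using Im_Ln_ge[of "z - of_real (k n)"] z0 qn by (intro mult_left_mono_neg) auto
    moreover have "C * Im z + q n * (Im z / ?r) < 0"
    proof -
      have "C * ?r + ?r < - q n" using r(3) by (simp add: algebra_simps)
      then have "C * ?r + q n < 0" using r(1) by linarith
      then have "(C * ?r + q n) * (Im z / ?r) < 0" using z0 r by (intro mult_neg_pos) auto
      then show ?thesis using r by (simp add: field_simps)
    qed
    ultimately show ?thesis unfolding Im_H using n by (subst sum.remove[of _ n]) auto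
  qed
  moreover have "0 < min d (- q n / (C + 1))" using d C qn by (simp add: divide_neg_pos)
  ultimately show ?thesis by blast
qed

section \<open>Boundary behaviour of the inverse function\<close>

definition Hinv :: "complex \<Rightarrow> complex" where
  "Hinv = the_inv_into uhp H"

lemma Hinv_H: "z \<in> uhp \<Longrightarrow> Hinv (H z) = z"
  unfolding Hinv_def by (rule the_inv_into_f_f[OF inj_H])

lemma Hinv_in_uhp: "w \<in> H ` uhp \<Longrightarrow> Hinv w \<in> uhp"
  using Hinv_H by auto

lemma H_Hinv: "w \<in> H ` uhp \<Longrightarrow> H (Hinv w) = w"
  using Hinv_H by auto

lemma open_image_H: "open (H ` uhp)"
  by (rule open_mapping_thm3[OF holomorphic_H open_uhp inj_H])

lemma has_field_derivative_Hinv: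
  assumes "w \<in> H ` uhp"
  shows "(Hinv has_field_derivative 1 / dH (Hinv w)) (at w)"
proof -
  obtain h where h: "h holomorphic_on H ` uhp" "\<And>z. z \<in> uhp \<Longrightarrow> deriv H z * deriv h (H z) = 1"
    "\<And>z. z \<in> uhp \<Longrightarrow> h (H z) = z"
    using holomorphic_has_inverse[OF holomorphic_H open_uhp inj_H] by blast
  obtain z where z: "z \<in> uhp" "w = H z" using assms by blast
  have "(h has_field_derivative deriv h w) (at w)"
    using holomorphic_derivI[OF h(1) open_image_H assms] .
  moreover have "deriv h w = 1 / dH (Hinv w)"
    using h(2)[OF z(1)] DERIV_imp_deriv[OF has_field_derivative_H[OF z(1)]] dH_nonzero[OF z(1)] z Hinv_H
    by (simp add: field_simps)
  ultimately have "(h has_field_derivative 1 / dH (Hinv w)) (at w)" by simp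
  then show ?thesis
    by (rule has_field_derivative_transform_within_open[OF _ open_image_H assms]) (use h(3) Hinv_H in auto)
qed

lemma continuous_on_Hinv: "continuous_on (H ` uhp) Hinv"
  using has_field_derivative_Hinv by (meson DERIV_continuous continuous_at_imp_continuous_on)

lemma Hinv_escapes:
  assumes "0 < \<epsilon>"
  obtains C where
    "\<And>w. w \<in> H ` uhp \<Longrightarrow> Re w < - C \<Longrightarrow> \<exists>j\<in>{1..N}. cmod (Hinv w - of_real (k j)) < \<epsilon>"
    "\<And>w. w \<in> H ` uhp \<Longrightarrow> C < Re w \<Longrightarrow>
       (\<exists>j\<in>{N<..n}. cmod (Hinv w - of_real (k j)) < \<epsilon>) \<or> 1 / \<epsilon> < cmod (Hinv w)"
proof -
  obtain e R where e: "0 < e" "e \<le> \<epsilon>" "1 / \<epsilon> \<le> R"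
    "\<And>z j. j \<in> {1..N} \<Longrightarrow> z \<noteq> of_real (k j) \<Longrightarrow> cmod (z - of_real (k j)) < e \<Longrightarrow> V z < - 0"
    "\<And>z j. j \<in> {N<..n} \<Longrightarrow> z \<noteq> of_real (k j) \<Longrightarrow> cmod (z - of_real (k j)) < e \<Longrightarrow> 0 < V z"
    "\<And>z. R < cmod z \<Longrightarrow> 0 < V z"
    by (rule V_large_near_boundary[OF assms, of 0]) blast
  have "compact (H ` core e R)"
    by (intro compact_continuous_image compact_core continuous_on_subset[OF continuous_on_H core_subset[OF e(1)]])
  then obtain C0 where C0: "\<And>w. w \<in> H ` core e R \<Longrightarrow> cmod w \<le> C0"
    using compact_imp_bounded bounded_iff by metis
  define C where "C = \<bar>C0\<bar>"
  have C: "cmod (H z) \<le> C" if "z \<in> core e R" for z using C0[of "H z"] that by (auto simp: C_def)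
  have *: "(\<exists>j\<in>{1..n}. cmod (z - of_real (k j)) < e) \<or> R < cmod z" if "z \<in> uhp" "C < \<bar>Re (H z)\<bar>" for z
  proof (rule ccontr)
    assume "\<not> ?thesis"
    then have "z \<in> core e R" using that(1) by (force simp: core_def uhp_def dist_norm norm_minus_commute)
    then show False using C[of z] abs_Re_le_cmod[of "H z"] that(2) by simp
  qed
  show ?thesis
  proof (rule that)
    fix w assume w: "w \<in> H ` uhp" "Re w < - C"
    then obtain z where z: "z \<in> uhp" "w = H z" by blast
    then have V: "V z < - C" "0 \<le> C" using w Re_H_eq_V uhp_subset_cuhp by (auto simp: C_def)
    have nz: "z \<noteq> of_real (k j)" for j using z by (auto simp: uhp_def)
    have "(\<exists>j\<in>{1..n}. cmod (z - of_real (k j)) < e) \<or> R < cmod z" using * z w V(2) by simp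
    moreover have "\<not> R < cmod z" using e(6)[of z] V by force
    ultimately obtain j where j: "j \<in> {1..n}" "cmod (z - of_real (k j)) < e" by blast
    then have "j \<le> N" using e(5)[OF _ nz, of j] V by force
    then show "\<exists>j\<in>{1..N}. cmod (Hinv w - of_real (k j)) < \<epsilon>" using j z e(2) by (intro bexI[of _ j]) (auto simp: Hinv_H)
  next
    fix w assume w: "w \<in> H ` uhp" "C < Re w"
    then obtain z where z: "z \<in> uhp" "w = H z" by blast
    then have V: "C < V z" "0 \<le> C" using w Re_H_eq_V uhp_subset_cuhp by (auto simp: C_def)
    have nz: "z \<noteq> of_real (k j)" for j using z by (auto simp: uhp_def)
    have "(\<exists>j\<in>{1..n}. cmod (z - of_real (k j)) < e) \<or> R < cmod z" using * z w V(2) by simp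
    then show "(\<exists>j\<in>{N<..n}. cmod (Hinv w - of_real (k j)) < \<epsilon>) \<or> 1 / \<epsilon> < cmod (Hinv w)"
    proof
      assume "\<exists>j\<in>{1..n}. cmod (z - of_real (k j)) < e"
      then obtain j where j: "j \<in> {1..n}" "cmod (z - of_real (k j)) < e" by blast
      then have "N < j" using e(4)[OF _ nz, of j] V by force
      then show ?thesis using j z e(2) by (intro disjI1 bexI[of _ j]) (auto simp: Hinv_H)
    qed (use z e(3) in \<open>auto simp: Hinv_H\<close>)
  qed
qed

text \<open>
  As \<open>Re w \<rightarrow> -\<infinity>\<close> the preimage must approach one of the positive charges. Near any charge but the
  \<open>i\<close>-th the height \<open>y\<close> is not taken.
\<close>

lemma Hinv_tendsto_left:
  fixes w :: "'a \<Rightarrow> complex"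
  assumes im: "\<forall>\<^sub>F x in F. w x \<in> H ` uhp" "\<forall>\<^sub>F x in F. Im (w x) = y"
    and re: "filterlim (\<lambda>x. Re (w x)) at_bot F"
    and i: "i \<in> {1..N}" and y: "height i < y" "y < height (i - 1)"
  shows "((\<lambda>x. Hinv (w x)) \<longlongrightarrow> of_real (k i)) F"
proof (rule tendstoI)
  fix \<epsilon> :: real assume \<epsilon>: "0 < \<epsilon>"
  have other: "\<exists>e>0. \<forall>z\<in>uhp. cmod (z - of_real (k j)) < e \<longrightarrow> Im (H z) \<noteq> y" if j: "j \<in> {1..N} - {i}" for j
  proof -
    have j': "j \<in> {1..n}" "height j < height (j - 1)" using j N_less by (auto intro: height_decreasing)
    consider "j < i" | "i < j" using j by force
    then show ?thesis
    proof cases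
      case 1
      then have "height (i - 1) \<le> height j" using i height_antimono[of j "i - 1"] by auto
      then have "0 < height j - y" using y by simp
      from Im_H_near_charge[OF j'(1) this] j'(2) show ?thesis by (force simp: min_def)
    next
      case 2
      then have "height (j - 1) \<le> height i" using j height_antimono[of i "j - 1"] by auto
      then have "0 < y - height (j - 1)" using y by simp
      from Im_H_near_charge[OF j'(1) this] j'(2) show ?thesis by (force simp: max_def)
    qed
  qed
  then obtain ee where ee: "\<And>j. j \<in> {1..N} - {i} \<Longrightarrow> 0 < ee j"
    "\<And>j z. j \<in> {1..N} - {i} \<Longrightarrow> z \<in> uhp \<Longrightarrow> cmod (z - of_real (k j)) < ee j \<Longrightarrow> Im (H z) \<noteq> y"
    by metis
  define \<epsilon>' where "\<epsilon>' = Min (insert \<epsilon> (ee ` ({1..N} - {i})))"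
  have \<epsilon>': "0 < \<epsilon>'" unfolding \<epsilon>'_def using \<epsilon> ee(1) by (subst Min_gr_iff) auto
  have le: "\<epsilon>' \<le> \<epsilon>" "\<And>j. j \<in> {1..N} - {i} \<Longrightarrow> \<epsilon>' \<le> ee j" unfolding \<epsilon>'_def by (rule Min_le; auto)+
  obtain C where C: "\<And>w. w \<in> H ` uhp \<Longrightarrow> Re w < - C \<Longrightarrow> \<exists>j\<in>{1..N}. cmod (Hinv w - of_real (k j)) < \<epsilon>'"
    using Hinv_escapes[OF \<epsilon>'] by metis
  have "\<forall>\<^sub>F x in F. Re (w x) < - C" using re by (simp add: filterlim_at_bot_dense)
  then show "\<forall>\<^sub>F x in F. dist (Hinv (w x)) (of_real (k i)) < \<epsilon>"
    using im
  proof eventually_elim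
    case (elim x)
    then obtain j where j: "j \<in> {1..N}" "cmod (Hinv (w x) - of_real (k j)) < \<epsilon>'" using C by blast
    have "j = i"
    proof (rule ccontr)
      assume "j \<noteq> i"
      then have "Im (H (Hinv (w x))) \<noteq> y" using ee(2)[of j "Hinv (w x)"] j le(2)[of j] Hinv_in_uhp elim by auto
      then show False using H_Hinv elim by simp
    qed
    then show ?case using j le(1) by (simp add: dist_norm)
  qed
qed

text \<open>
  The analogue for negative charges. In this direction \<open>Re H\<close> is also large near infinity, but there
  \<open>Im H > 0 > y\<close>.
\<close>

lemma Hinv_tendsto_right:
  fixes w :: "'a \<Rightarrow> complex"
  assumes im: "\<forall>\<^sub>F x in F. w x \<in> H ` uhp" "\<forall>\<^sub>F x in F. Im (w x) = y"
    and re: "filterlim (\<lambda>x. Re (w x)) at_top F"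
    and i: "i \<in> {N<..n}" and y: "height (i - 1) < y" "y < height i"
  shows "((\<lambda>x. Hinv (w x)) \<longlongrightarrow> of_real (k i)) F"
proof (rule tendstoI)
  fix \<epsilon> :: real assume \<epsilon>: "0 < \<epsilon>"
  have other: "\<exists>e>0. \<forall>z\<in>uhp. cmod (z - of_real (k j)) < e \<longrightarrow> Im (H z) \<noteq> y" if j: "j \<in> {N<..n} - {i}" for j
  proof -
    have j': "j \<in> {1..n}" "height (j - 1) < height j" using j N_less by (auto intro: height_increasing)
    consider "j < i" | "i < j" using j by force
    then show ?thesis
    proof cases
      case 1
      then have "height j \<le> height (i - 1)" using i j height_mono[of j "i - 1"] by auto
      then have "0 < y - height j" using y by simp
      from Im_H_near_charge[OF j'(1) this] j'(2) show ?thesis by (force simp: max_def)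
    next
      case 2
      then have "height i \<le> height (j - 1)" using i j height_mono[of i "j - 1"] by auto
      then have "0 < height (j - 1) - y" using y by simp
      from Im_H_near_charge[OF j'(1) this] j'(2) show ?thesis by (force simp: min_def)
    qed
  qed
  then obtain ee where ee: "\<And>j. j \<in> {N<..n} - {i} \<Longrightarrow> 0 < ee j"
    "\<And>j z. j \<in> {N<..n} - {i} \<Longrightarrow> z \<in> uhp \<Longrightarrow> cmod (z - of_real (k j)) < ee j \<Longrightarrow> Im (H z) \<noteq> y"
    by metis
  obtain R where R: "\<And>z. z \<in> uhp \<Longrightarrow> R < cmod z \<Longrightarrow> 0 < Im (H z)" using Im_H_pos_at_infinity by blast
  have "y < 0" using y i height_increasing[of i n] height_n by (cases "i = n") auto
  define \<epsilon>' where "\<epsilon>' = Min (insert \<epsilon> (insert (1 / (\<bar>R\<bar> + 1)) (ee ` ({N<..n} - {i}))))"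
  have \<epsilon>': "0 < \<epsilon>'" unfolding \<epsilon>'_def using \<epsilon> ee(1) by (subst Min_gr_iff) auto
  have le: "\<epsilon>' \<le> \<epsilon>" "\<epsilon>' \<le> 1 / (\<bar>R\<bar> + 1)" "\<And>j. j \<in> {N<..n} - {i} \<Longrightarrow> \<epsilon>' \<le> ee j"
    unfolding \<epsilon>'_def by (rule Min_le; auto)+
  have R': "R < 1 / \<epsilon>'" using le(2) \<epsilon>' by (simp add: field_simps)  (smt (verit) mult_le_cancel_right mult.commute)
  obtain C where C: "\<And>w. w \<in> H ` uhp \<Longrightarrow> C < Re w \<Longrightarrow>
       (\<exists>j\<in>{N<..n}. cmod (Hinv w - of_real (k j)) < \<epsilon>') \<or> 1 / \<epsilon>' < cmod (Hinv w)"
    using Hinv_escapes[OF \<epsilon>'] by metis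
  have "\<forall>\<^sub>F x in F. C < Re (w x)" using re by (simp add: filterlim_at_top_dense)
  then show "\<forall>\<^sub>F x in F. dist (Hinv (w x)) (of_real (k i)) < \<epsilon>"
    using im
  proof eventually_elim
    case (elim x)
    have "\<not> 1 / \<epsilon>' < cmod (Hinv (w x))"
      using R[of "Hinv (w x)"] R' Hinv_in_uhp H_Hinv elim \<open>y < 0\<close> by force
    then obtain j where j: "j \<in> {N<..n}" "cmod (Hinv (w x) - of_real (k j)) < \<epsilon>'" using C elim by blast
    have "j = i"
    proof (rule ccontr)
      assume "j \<noteq> i"
      then have "Im (H (Hinv (w x))) \<noteq> y" using ee(2)[of j "Hinv (w x)"] j le(3)[of j] Hinv_in_uhp elim by auto
      then show False using H_Hinv elim by simp
    qed
    then show ?case using j le(1) by (simp add: dist_norm)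
  qed
qed

text \<open>
  Positive height excludes the negative charges, the only other places where \<open>Re H\<close> is large.
\<close>

lemma Hinv_at_infinity:
  fixes w :: "'a \<Rightarrow> complex"
  assumes im: "\<forall>\<^sub>F x in F. w x \<in> H ` uhp" "\<forall>\<^sub>F x in F. 0 < Im (w x)"
    and re: "filterlim (\<lambda>x. Re (w x)) at_top F"
  shows "filterlim (\<lambda>x. Hinv (w x)) at_infinity F"
  unfolding filterlim_at_infinity[OF order_refl]
proof (intro allI impI)
  fix r :: real assume r: "0 < r"
  have "\<exists>e>0. \<forall>z\<in>uhp. cmod (z - of_real (k j)) < e \<longrightarrow> Im (H z) \<le> 0" if j: "j \<in> {N<..n}" for j
  proof (cases "j = n")
    case True then show ?thesis using Im_H_neg_near_last by (meson less_imp_le)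
  next
    case False
    have j': "j \<in> {1..n}" "height (j - 1) < height j" using j N_less by (auto intro: height_increasing)
    have "0 < - height j" using False j height_increasing[of j n] height_n by auto
    from Im_H_near_charge[OF j'(1) this] j'(2) show ?thesis by (force simp: max_def)
  qed
  then obtain ee where ee: "\<And>j. j \<in> {N<..n} \<Longrightarrow> 0 < ee j"
    "\<And>j z. j \<in> {N<..n} \<Longrightarrow> z \<in> uhp \<Longrightarrow> cmod (z - of_real (k j)) < ee j \<Longrightarrow> Im (H z) \<le> 0"
    by metis
  define \<epsilon> where "\<epsilon> = Min (insert (1 / r) (ee ` {N<..n}))"
  have \<epsilon>: "0 < \<epsilon>" unfolding \<epsilon>_def using r ee(1) by (subst Min_gr_iff) auto
  have le: "\<epsilon> \<le> 1 / r" "\<And>j. j \<in> {N<..n} \<Longrightarrow> \<epsilon> \<le> ee j" unfolding \<epsilon>_def by (rule Min_le; auto)+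
  obtain C where C: "\<And>w. w \<in> H ` uhp \<Longrightarrow> C < Re w \<Longrightarrow>
       (\<exists>j\<in>{N<..n}. cmod (Hinv w - of_real (k j)) < \<epsilon>) \<or> 1 / \<epsilon> < cmod (Hinv w)"
    using Hinv_escapes[OF \<epsilon>] by metis
  have "\<forall>\<^sub>F x in F. C < Re (w x)" using re by (simp add: filterlim_at_top_dense)
  then show "\<forall>\<^sub>F x in F. r \<le> cmod (Hinv (w x))"
    using im
  proof eventually_elim
    case (elim x)
    have "\<not> cmod (Hinv (w x) - of_real (k j)) < \<epsilon>" if j: "j \<in> {N<..n}" for j
    proof
      assume "cmod (Hinv (w x) - of_real (k j)) < \<epsilon>"
      then have "Im (H (Hinv (w x))) \<le> 0" using ee(2)[OF j, of "Hinv (w x)"] le(2)[OF j] Hinv_in_uhp elim by auto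
      then show False using H_Hinv elim by simp
    qed
    then have "1 / \<epsilon> < cmod (Hinv (w x))" using C elim by blast
    moreover have "r \<le> 1 / \<epsilon>" using le(1) \<epsilon> r by (simp add: field_simps)
    ultimately show ?case by simp
  qed
qed

text \<open>
  This replaces the continuous extension of the inverse to a tip: on a compact set off the critical
  point \<open>H\<close> stays away from the tip.
\<close>

lemma Hinv_tendsto_crit:
  fixes w :: "'a \<Rightarrow> complex"
  assumes im: "\<forall>\<^sub>F x in F. w x \<in> H ` uhp" and i: "i \<in> {1..n} - {N}"
    and w: "(w \<longlongrightarrow> H (of_real (crit i))) F"
  shows "((\<lambda>x. Hinv (w x)) \<longlongrightarrow> of_real (crit i)) F"
proof (rule tendstoI)
  fix \<epsilon> :: real assume \<epsilon>: "0 < \<epsilon>"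
  let ?c = "of_real (crit i) :: complex"
  define C where "C = \<bar>Re (H ?c)\<bar> + 1"
  obtain K where K: "compact K" "K \<subseteq> cuhp" "\<And>z. z \<in> cuhp \<Longrightarrow> \<bar>Re (H z)\<bar> \<le> C \<Longrightarrow> z \<in> K"
    using bounded_level_in_compact by blast
  let ?K = "K - ball ?c \<epsilon>"
  have "compact (H ` ?K)"
    using K by (intro compact_continuous_image compact_diff continuous_on_subset[OF continuous_on_H]) auto
  then have "open (- (H ` ?K))" by (simp add: compact_imp_closed open_Compl)
  moreover have "H ?c \<in> - (H ` ?K)"
  proof
    assume "H ?c \<in> H ` ?K"
    then obtain z where z: "z \<in> K" "z \<notin> ball ?c \<epsilon>" "H z = H ?c" by auto
    then have "z = ?c" using H_real_eq_tip[OF i] K(2) by blast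
    then show False using z \<epsilon> by simp
  qed
  ultimately have 1: "\<forall>\<^sub>F x in F. w x \<in> - (H ` ?K)" using w by (rule topological_tendstoD[rotated 1])
  have 2: "\<forall>\<^sub>F x in F. dist (w x) (H ?c) < 1" using w by (rule tendstoD) simp
  show "\<forall>\<^sub>F x in F. dist (Hinv (w x)) ?c < \<epsilon>"
    using 1 2 im
  proof eventually_elim
    case (elim x)
    let ?z = "Hinv (w x)"
    have z: "?z \<in> uhp" "H ?z = w x" using Hinv_in_uhp H_Hinv elim by auto
    have "\<bar>Re (w x) - Re (H ?c)\<bar> < 1" using elim abs_Re_le_cmod[of "w x - H ?c"] by (simp add: dist_norm)
    then have "?z \<in> K" using z uhp_subset_cuhp by (intro K(3)) (auto simp: C_def)
    then have "?z \<in> ball ?c \<epsilon>" using elim z by (metis ComplD DiffI image_eqI)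
    then show ?case by (simp add: dist_commute)
  qed
qed

end

section \<open>Uniqueness for the transport equation\<close>

text \<open>
  A solution is only known to be jointly continuous and differentiable in each variable. For total
  differentiability the mixed increment \<open>(g y1 y2 - g y1 s) - (g z y2 - g z s)\<close> has to be
  \<open>o(|y1 - z|)\<close>. It is the increment of the holomorphic function \<open>g \<cdot> y2 - g \<cdot> s\<close>, which is
  uniformly small on a disc when \<open>y2\<close> is near \<open>s\<close>, and then so is its derivative by Cauchy's
  estimate.
\<close>

lemma pde_solution_has_derivative:
  assumes g: "pde_solution q g" and z: "z \<in> uhp" and s: "0 < s"
  shows "((\<lambda>x. g (fst x) (snd x)) has_derivative
     (\<lambda>x. deriv (\<lambda>w. g w s) z * fst x + of_real (snd x) * - (deriv (\<lambda>w. g w s) z * q z s))) (at (z, s))"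
proof -
  define A where "A = deriv (\<lambda>w. g w s) z"
  have holo: "(\<lambda>w. g w t) holomorphic_on uhp" if "0 \<le> t" for t
    using g that unfolding pde_solution_def by blast
  have cont: "continuous_on (uhp \<times> {0..}) (\<lambda>x. g (fst x) (snd x))"
    using g unfolding pde_solution_def by (simp add: case_prod_beta')
  have dz: "((\<lambda>w. g w s) has_field_derivative A) (at z)"
    unfolding A_def by (rule holomorphic_derivI[OF holo open_uhp z]) (use s in simp)
  have "((\<lambda>t. g z t) has_vector_derivative - A * q z s) (at s within {0..})"
    using g z s unfolding pde_solution_def A_def by auto
  then have dt: "((\<lambda>t. g z t) has_vector_derivative - A * q z s) (at s)"
    using s by (metis at_within_interior interior_real_atLeast greaterThan_iff)
  obtain \<rho> where \<rho>: "0 < \<rho>" "cball z \<rho> \<subseteq> uhp"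
    using open_uhp z open_contains_cball by blast
  define r where "r = \<rho> / 2"
  have r: "0 < r" "cball z (2 * r) \<subseteq> uhp" using \<rho> by (auto simp: r_def)
  have unif: "uniformly_continuous_on (cball z (2 * r) \<times> {0..s + 1}) (\<lambda>x. g (fst x) (snd x))"
    using r(2) by (intro compact_uniformly_continuous continuous_on_subset[OF cont] compact_Times) auto
  show ?thesis
    unfolding has_derivative_at_alt A_def[symmetric]
  proof (intro conjI allI impI)
    show "bounded_linear (\<lambda>x::complex \<times> real. A * fst x + of_real (snd x) * - (A * q z s))"
      by (intro bounded_linear_add bounded_linear_compose[OF bounded_linear_mult_right bounded_linear_fst]
         bounded_linear_compose[OF bounded_linear_mult_left] bounded_linear_compose[OF bounded_linear_of_real bounded_linear_snd])
    fix e :: real assume e: "0 < e"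
    obtain d1 where d1: "0 < d1" "\<And>y. norm (y - z) < d1 \<Longrightarrow> norm (g y s - g z s - A * (y - z)) \<le> e / 3 * norm (y - z)"
      using dz e unfolding has_field_derivative_def has_derivative_at_alt by (metis divide_pos_pos zero_less_numeral)
    obtain d2 where d2: "0 < d2" "\<And>t. norm (t - s) < d2 \<Longrightarrow> norm (g z t - g z s - (t - s) *\<^sub>R (- A * q z s)) \<le> e / 3 * norm (t - s)"
      using dt e unfolding has_vector_derivative_def has_derivative_at_alt by (metis divide_pos_pos zero_less_numeral)
    have "0 < e * r / 3" using e r by simp
    then obtain d3 where d3: "0 < d3" "\<And>x x'. x \<in> cball z (2 * r) \<times> {0..s + 1} \<Longrightarrow> x' \<in> cball z (2 * r) \<times> {0..s + 1} \<Longrightarrow>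
         dist x' x < d3 \<Longrightarrow> dist (g (fst x') (snd x')) (g (fst x) (snd x)) < e * r / 3"
      using unif unfolding uniformly_continuous_on_def by metis
    define d where "d = Min {d1, d2, d3, r, s, 1}"
    have d: "0 < d" "d \<le> d1" "d \<le> d2" "d \<le> d3" "d \<le> r" "d \<le> s" "d \<le> 1"
      unfolding d_def using d1(1) d2(1) d3(1) r(1) s by auto
    have "norm (g (fst y) (snd y) - g (fst (z, s)) (snd (z, s)) - (A * fst (y - (z, s)) + of_real (snd (y - (z, s))) * - (A * q z s)))
        \<le> e * norm (y - (z, s))" if y: "norm (y - (z, s)) < d" for y
    proof -
      obtain y1 y2 where yy: "y = (y1, y2)" by (cases y)
      have n1: "norm (y1 - z) \<le> norm (y - (z, s))" and n2: "norm (y2 - s) \<le> norm (y - (z, s))"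
        unfolding yy using norm_fst_le[of "y1 - z" "y2 - s"] norm_snd_le[of "y2 - s" "y1 - z"] by auto
      define dd where "dd \<eta> = g \<eta> y2 - g \<eta> s" for \<eta>
      have y2: "\<bar>y2 - s\<bar> < d" using n2 y by simp
      have y2': "0 \<le> y2" "y2 \<in> {0..s + 1}" "s \<in> {0..s + 1}" using y2 d s by auto
      have ddb: "norm (dd \<eta>) < e * r / 3" if "\<eta> \<in> cball z (2 * r)" for \<eta>
      proof -
        have "dist (\<eta>, y2) (\<eta>, s) < d3" using y2 d by (simp add: dist_Pair_Pair dist_real_def)
        then show ?thesis using d3(2)[of "(\<eta>, s)" "(\<eta>, y2)"] that y2' by (simp add: dd_def dist_norm)
      qed
      have ddh: "dd holomorphic_on uhp"
        unfolding dd_def using holo[OF y2'(1)] holo[of s] s by (intro holomorphic_intros) auto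
      have "norm (deriv dd \<eta>) \<le> e / 3" if \<eta>: "\<eta> \<in> ball z r" for \<eta>
      proof -
        have sub: "cball \<eta> r \<subseteq> cball z (2 * r)"
        proof
          fix x assume "x \<in> cball \<eta> r"
          then show "x \<in> cball z (2 * r)" using \<eta> dist_triangle[of z x \<eta>] by simp
        qed
        have "norm ((deriv ^^ 1) dd \<eta>) \<le> fact 1 * (e * r / 3) / r ^ 1"
        proof (rule Cauchy_higher_deriv_bound[where y = 0])
          show "dd holomorphic_on ball \<eta> r" using sub r ddh by (meson ball_subset_cball holomorphic_on_subset order_trans)
          show "continuous_on (cball \<eta> r) dd" using sub r ddh
            by (meson holomorphic_on_imp_continuous_on continuous_on_subset order_trans)
          show "dd w \<in> ball 0 (e * r / 3)" if "w \<in> ball \<eta> r" for w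
            using ddb[of w] sub that by (auto simp: subset_iff)
        qed (use r in auto)
        then show ?thesis using r by simp
      qed
      moreover have "(dd has_field_derivative deriv dd \<eta>) (at \<eta> within ball z r)" if "\<eta> \<in> ball z r" for \<eta>
      proof (rule has_field_derivative_at_within[OF holomorphic_derivI[OF ddh open_uhp]])
        have "\<eta> \<in> cball z (2 * r)" using that r(1) by auto
        then show "\<eta> \<in> uhp" using r(2) by blast
      qed
      moreover have "y1 \<in> ball z r" using n1 y d by (simp add: dist_norm norm_minus_commute)
      ultimately have "norm (dd y1 - dd z) \<le> e / 3 * norm (y1 - z)"
        using field_differentiable_bound[of "ball z r" dd "deriv dd" "e / 3" y1 z] r(1) by simp
      moreover have "norm (g y1 s - g z s - A * (y1 - z)) \<le> e / 3 * norm (y1 - z)"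
        by (rule d1(2)) (use n1 y d in simp)
      moreover have "norm (g z y2 - g z s - (y2 - s) *\<^sub>R (- A * q z s)) \<le> e / 3 * norm (y2 - s)"
        by (rule d2(2)) (use n2 y d in simp)
      moreover have "g y1 y2 - g z s - (A * (y1 - z) + of_real (y2 - s) * - (A * q z s)) =
          (dd y1 - dd z) + (g y1 s - g z s - A * (y1 - z)) + (g z y2 - g z s - (y2 - s) *\<^sub>R (- A * q z s))"
        by (simp add: dd_def scaleR_conv_of_real)
      ultimately have "norm (g y1 y2 - g z s - (A * (y1 - z) + of_real (y2 - s) * - (A * q z s))) \<le>
          e / 3 * norm (y1 - z) + e / 3 * norm (y1 - z) + e / 3 * norm (y2 - s)"
        by (metis (no_types, opaque_lifting) add_mono norm_triangle_le)
      also have "\<dots> \<le> e / 3 * norm (y - (z, s)) + e / 3 * norm (y - (z, s)) + e / 3 * norm (y - (z, s))"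
        using n1 n2 e by (intro add_mono mult_left_mono) auto
      also have "\<dots> = e * norm (y - (z, s))" by simp
      finally show ?thesis by (simp add: yy)
    qed
    then show "\<exists>d>0. \<forall>y. norm (y - (z, s)) < d \<longrightarrow>
       norm (g (fst y) (snd y) - g (fst (z, s)) (snd (z, s)) - (A * fst (y - (z, s)) + of_real (snd (y - (z, s))) * - (A * q z s)))
        \<le> e * norm (y - (z, s))"
      using d(1) by blast
  qed
qed

text \<open>
  Let \<open>w = f z0 t0\<close>. As the images decrease, there is for every \<open>s \<le> t0\<close> a point \<open>Z s\<close> with
  \<open>f (Z s) s = w\<close>. It moves with velocity \<open>q\<close> and is thus a characteristic of the equation, so
  \<open>g (Z s) s\<close> is constant, equal to its value \<open>w\<close> at \<open>s = 0\<close>. Continuity of \<open>Z\<close> comes from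
  invariance of domain, applied to \<open>(z, s) \<mapsto> (f z s, s)\<close>.
\<close>

lemma pde_solution_unique:
  assumes f: "pde_solution q f" and g: "pde_solution q g"
    and inj: "\<And>t. 0 \<le> t \<Longrightarrow> inj_on (\<lambda>z. f z t) uhp"
    and decr: "\<And>s t. 0 \<le> s \<Longrightarrow> s \<le> t \<Longrightarrow> (\<lambda>z. f z t) ` uhp \<subseteq> (\<lambda>z. f z s) ` uhp"
    and z0: "z0 \<in> uhp" and t0: "0 \<le> t0"
  shows "g z0 t0 = f z0 t0"
proof -
  \<comment> \<open>time is frozen at \<open>0\<close> for negative arguments, so that the domain of \<open>\<Phi>\<close> is open\<close>
  define \<Phi> where "\<Phi> = (\<lambda>x::complex \<times> real. (f (fst x) (max (snd x) 0), snd x))"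
  define D where "D = uhp \<times> (UNIV :: real set)"
  have contf: "continuous_on (uhp \<times> {0..}) (\<lambda>x. f (fst x) (snd x))"
    and contg: "continuous_on (uhp \<times> {0..}) (\<lambda>x. g (fst x) (snd x))"
    using f g unfolding pde_solution_def by (simp_all add: case_prod_beta')
  have "open D" unfolding D_def by (intro open_Times open_uhp open_UNIV)
  have "continuous_on D (\<lambda>x. f (fst (fst x, max (snd x) 0)) (snd (fst x, max (snd x) 0)))"
    by (rule continuous_on_compose2[OF contf]) (auto simp: D_def intro!: continuous_intros)
  then have cont: "continuous_on D \<Phi>" unfolding \<Phi>_def by (intro continuous_intros) simp
  have injP: "inj_on \<Phi> D"
  proof (rule inj_onI)
    fix x y assume "x \<in> D" "y \<in> D" "\<Phi> x = \<Phi> y"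
    then show "x = y" using inj[of "max (snd y) 0"] by (cases x; cases y) (auto simp: \<Phi>_def D_def dest: inj_onD)
  qed
  define \<Psi> where "\<Psi> = inv_into D \<Phi>"
  have oT: "open (\<Phi> ` D)" by (rule invariance_of_domain[OF cont \<open>open D\<close> injP])
  have cPsi: "continuous_on (\<Phi> ` D) \<Psi>"
    unfolding \<Psi>_def by (rule continuous_on_inverse_open[OF \<open>open D\<close> cont]) (simp, rule inv_into_f_f[OF injP])
  have PP: "\<Psi> y \<in> D" "\<Phi> (\<Psi> y) = y" if "y \<in> \<Phi> ` D" for y
    unfolding \<Psi>_def using that by (auto intro: inv_into_into f_inv_into_f)
  define w where "w = f z0 t0"
  define Z where "Z s = fst (\<Psi> (w, s))" for s
  have inT: "(w, s) \<in> \<Phi> ` D" if s: "s \<in> {0..t0}" for s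
  proof -
    have "w \<in> (\<lambda>z. f z s) ` uhp" using decr[of s t0] s z0 unfolding w_def by auto
    then obtain z where "z \<in> uhp" "f z s = w" by auto
    then show ?thesis using s by (intro image_eqI[of _ _ "(z, s)"]) (auto simp: \<Phi>_def D_def max_def)
  qed
  have Psi: "\<Psi> (w, s) = (Z s, s)" "Z s \<in> uhp" "f (Z s) s = w" if s: "s \<in> {0..t0}" for s
    using PP[OF inT[OF s]] s by (cases "\<Psi> (w, s)"; auto simp: Z_def \<Phi>_def D_def max_def split: if_splits)+
  have contZ: "continuous_on {0..t0} Z"
    unfolding Z_def by (intro continuous_intros continuous_on_compose2[OF cPsi]) (use inT in auto)
  have holo: "(\<lambda>w. f w t) holomorphic_on uhp" if "0 \<le> t" for t
    using f that unfolding pde_solution_def by blast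
  define \<phi> where "\<phi> s = g (Z s) s" for s
  have dphi: "(\<phi> has_derivative (\<lambda>h. 0)) (at s within {0..t0})" if s: "s \<in> {0..t0} - {0, t0}" for s
  proof -
    have s': "0 < s" "s \<in> {0..t0}" "0 \<le> s" using s by auto
    define A where "A = deriv (\<lambda>w. f w s) (Z s)"
    have A0: "A \<noteq> 0"
      unfolding A_def by (rule holomorphic_injective_imp_regular[OF holo open_uhp inj Psi(2)]) (use s' in auto)
    define c where "c = - (A * q (Z s) s)"
    have "((\<lambda>x. (f (fst x) (snd x), snd x)) has_derivative (\<lambda>x. (A * fst x + of_real (snd x) * c, snd x))) (at (Z s, s))"
      unfolding c_def A_def
      by (intro has_derivative_Pair pde_solution_has_derivative[OF f Psi(2)[OF s'(2)] s'(1)] has_derivative_snd has_derivative_ident)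
    then have dPhi: "(\<Phi> has_derivative (\<lambda>x. (A * fst x + of_real (snd x) * c, snd x))) (at (Z s, s))"
      by (rule has_derivative_transform_within_open[of _ _ _ _ "UNIV \<times> {0<..}"])
         (use s' in \<open>auto simp: \<Phi>_def max_def intro!: open_Times\<close>)
    have "(\<Psi> has_derivative (\<lambda>y. ((fst y - of_real (snd y) * c) / A, snd y))) (at (w, s))"
    proof (rule has_derivative_inverse_basic[where f = \<Phi> and g = \<Psi> and y = "(w, s)", OF _ _ _ _ oT inT[OF s'(2)] PP(2)])
      show "(\<Phi> has_derivative (\<lambda>x. (A * fst x + of_real (snd x) * c, snd x))) (at (\<Psi> (w, s)))"
        using dPhi Psi(1)[OF s'(2)] by simp
      show "bounded_linear (\<lambda>y. ((fst y - of_real (snd y) * c) / A, snd y))"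
        by (intro bounded_linear_Pair bounded_linear_compose[OF bounded_linear_divide] bounded_linear_sub bounded_linear_fst bounded_linear_snd
             bounded_linear_compose[OF bounded_linear_mult_left] bounded_linear_compose[OF bounded_linear_of_real bounded_linear_snd])
      show "(\<lambda>y. ((fst y - of_real (snd y) * c) / A, snd y)) \<circ> (\<lambda>x. (A * fst x + of_real (snd x) * c, snd x)) = id"
        using A0 by (auto simp: fun_eq_iff)
      show "continuous (at (w, s)) \<Psi>"
        using cPsi inT[OF s'(2)] unfolding continuous_on_eq_continuous_at[OF oT] by blast
    qed
    moreover have "((\<lambda>s. (w, s)) has_derivative (\<lambda>h. (0, h))) (at s)"
      by (intro has_derivative_Pair has_derivative_const has_derivative_ident)
    ultimately have "((\<lambda>s. \<Psi> (w, s)) has_derivative (\<lambda>h. (\<lambda>y. ((fst y - of_real (snd y) * c) / A, snd y)) (0, h))) (at s)"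
      using has_derivative_compose[of "\<lambda>s. (w, s)" "\<lambda>h. (0, h)" s UNIV \<Psi>] by fastforce
    then have dPsi: "((\<lambda>s. \<Psi> (w, s)) has_derivative (\<lambda>h. (of_real h * q (Z s) s, h))) (at s)"
      using A0 by (simp add: c_def)
    define G where "G = deriv (\<lambda>w. g w s) (Z s)"
    have "((\<lambda>x. g (fst x) (snd x)) has_derivative
        (\<lambda>x. G * fst x + of_real (snd x) * - (G * q (Z s) s))) (at (\<Psi> (w, s)))"
      unfolding Psi(1)[OF s'(2)] G_def by (rule pde_solution_has_derivative[OF g Psi(2)[OF s'(2)] s'(1)])
    from has_derivative_compose[OF dPsi this]
    have "((\<lambda>s. g (fst (\<Psi> (w, s))) (snd (\<Psi> (w, s)))) has_derivative (\<lambda>h. 0)) (at s)"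
      by (simp add: mult_ac)
    then have "((\<lambda>s. g (fst (\<Psi> (w, s))) (snd (\<Psi> (w, s)))) has_derivative (\<lambda>h. 0)) (at s within {0..t0})"
      by (rule has_derivative_at_withinI)
    then show ?thesis
      by (rule has_derivative_transform[OF s'(2), rotated]) (simp add: \<phi>_def Psi(1))
  qed
  have contphi: "continuous_on {0..t0} \<phi>"
  proof -
    have "continuous_on {0..t0} (\<lambda>s. g (fst (Z s, s)) (snd (Z s, s)))"
      by (rule continuous_on_compose2[OF contg]) (use contZ Psi(2) in \<open>auto intro!: continuous_intros\<close>)
    then show ?thesis by (simp add: \<phi>_def)
  qed
  have "\<phi> t0 = \<phi> 0"
    by (rule has_derivative_zero_unique_strong_interval[OF _ contphi refl dphi, of "{0, t0}"]) (use t0 in auto)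
  moreover have "\<phi> 0 = w"
    using Psi(2,3)[of 0] t0 f g unfolding \<phi>_def pde_solution_def by simp
  moreover have "Z t0 = z0"
    using Psi(2,3)[of t0] t0 inj[OF t0] z0 unfolding w_def by (auto dest: inj_onD)
  ultimately show ?thesis by (simp add: \<phi>_def w_def)
qed

section \<open>Growth of the potential in a shrinking gap\<close>

text \<open>
  The contribution of one charge at \<open>k\<close> to the potential, while the point \<open>y\<close> moves towards \<open>0\<close> with
  exponent \<open>\<theta>\<close> and the charge with exponent \<open>\<eta>\<close>. The distance to a charge on the opposite side
  decays at least with the smaller of the two exponents. The distance to a charge on the same side
  decays at most with it, provided that the inner one of the two points has the larger exponent. The
  sign of \<open>q\<close> turns both statements into a lower bound.
\<close>

lemma flow_term:
  fixes y k q m \<eta> \<theta> \<tau> :: real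
  assumes y: "0 < y" and \<tau>: "0 \<le> \<tau>"
    and m: "m = (if k = 0 then \<theta> else min \<eta> \<theta>)"
    and side: "k < 0 \<and> q \<le> 0 \<or> k = 0 \<or> 0 < k \<and> 0 \<le> q \<and> (k < y \<and> \<theta> \<le> \<eta> \<or> y < k \<and> \<eta> \<le> \<theta>)"
  shows "q * ln \<bar>y - k\<bar> - q * m * \<tau> \<le> q * ln \<bar>y * exp (- \<theta> * \<tau>) - k * exp (- \<eta> * \<tau>)\<bar>"
proof -
  let ?r = "\<bar>y * exp (- \<theta> * \<tau>) - k * exp (- \<eta> * \<tau>)\<bar>"
  have e: "exp (- \<theta> * \<tau>) \<le> exp (- m * \<tau>)" if "m \<le> \<theta>" for \<theta>
    using that \<tau> by (simp add: mult_right_mono)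
  consider "k < 0" "q \<le> 0" | "k = 0" | "0 < k" "k < y" "\<theta> \<le> \<eta>" "0 \<le> q" | "y < k" "\<eta> \<le> \<theta>" "0 \<le> q"
    using side by auto
  then show ?thesis
  proof cases
    case 1
    then have "0 < y * exp (- \<theta> * \<tau>) + - k * exp (- \<eta> * \<tau>)" using y by (intro add_pos_pos mult_pos_pos) auto
    then have r: "?r = y * exp (- \<theta> * \<tau>) + - k * exp (- \<eta> * \<tau>)" "0 < ?r" by auto
    have "?r \<le> y * exp (- m * \<tau>) + - k * exp (- m * \<tau>)"
      unfolding r(1) using 1 y m by (intro add_mono mult_left_mono e) auto
    then have "?r \<le> \<bar>y - k\<bar> * exp (- m * \<tau>)" using 1 y by (simp add: algebra_simps)
    then have "ln ?r \<le> ln (\<bar>y - k\<bar> * exp (- m * \<tau>))" using r(2) by (subst ln_le_cancel_iff) auto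
    also have "\<dots> = ln \<bar>y - k\<bar> - m * \<tau>" using 1 y by (simp add: ln_mult)
    finally have "q * (ln \<bar>y - k\<bar> - m * \<tau>) \<le> q * ln ?r" using 1 by (intro mult_left_mono_neg) auto
    then show ?thesis by (simp add: right_diff_distrib)
  next
    case 2
    then have "?r = y * exp (- \<theta> * \<tau>)" "m = \<theta>" using y m by auto
    then show ?thesis using 2 y by (simp add: ln_mult right_diff_distrib)
  next
    case 3
    then have m': "m = \<theta>" using m by auto
    have "k * exp (- \<eta> * \<tau>) \<le> k * exp (- m * \<tau>)" using 3 m' by (intro mult_left_mono e) auto
    moreover have "\<bar>y - k\<bar> * exp (- m * \<tau>) = y * exp (- \<theta> * \<tau>) - k * exp (- m * \<tau>)"
      using 3 m' by (simp add: left_diff_distrib)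
    moreover note abs_ge_self[of "y * exp (- \<theta> * \<tau>) - k * exp (- \<eta> * \<tau>)"]
    ultimately have "\<bar>y - k\<bar> * exp (- m * \<tau>) \<le> ?r" by linarith
    moreover have "0 < \<bar>y - k\<bar> * exp (- m * \<tau>)" using 3 by simp
    ultimately have "ln (\<bar>y - k\<bar> * exp (- m * \<tau>)) \<le> ln ?r" by (subst ln_le_cancel_iff) auto
    moreover have "ln (\<bar>y - k\<bar> * exp (- m * \<tau>)) = ln \<bar>y - k\<bar> - m * \<tau>" using 3 by (simp add: ln_mult)
    ultimately have "q * (ln \<bar>y - k\<bar> - m * \<tau>) \<le> q * ln ?r" using 3 by (intro mult_left_mono) auto
    then show ?thesis by (simp add: right_diff_distrib)
  next
    case 4
    then have m': "m = \<eta>" using m y by auto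
    have "y * exp (- \<theta> * \<tau>) \<le> y * exp (- m * \<tau>)" using 4 m' y by (intro mult_left_mono e) auto
    moreover have "\<bar>y - k\<bar> * exp (- m * \<tau>) = k * exp (- \<eta> * \<tau>) - y * exp (- m * \<tau>)"
      using 4 m' by (simp add: left_diff_distrib)
    moreover note abs_ge_minus_self[of "y * exp (- \<theta> * \<tau>) - k * exp (- \<eta> * \<tau>)"]
    ultimately have "\<bar>y - k\<bar> * exp (- m * \<tau>) \<le> ?r" by linarith
    moreover have "0 < \<bar>y - k\<bar> * exp (- m * \<tau>)" using 4 by simp
    ultimately have "ln (\<bar>y - k\<bar> * exp (- m * \<tau>)) \<le> ln ?r" by (subst ln_le_cancel_iff) auto
    moreover have "ln (\<bar>y - k\<bar> * exp (- m * \<tau>)) = ln \<bar>y - k\<bar> - m * \<tau>" using 4 by (simp add: ln_mult)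
    ultimately have "q * (ln \<bar>y - k\<bar> - m * \<tau>) \<le> q * ln ?r" using 4 by (intro mult_left_mono) auto
    then show ?thesis by (simp add: right_diff_distrib)
  qed
qed

text \<open>
  The reverse estimate: the distance from \<open>y\<close> to the charge is comparable with the larger of
  \<open>e\<^sup>-\<^sup>\<theta>\<^sup>t\<close> and \<open>e\<^sup>-\<^sup>\<eta>\<^sup>t\<close>, up to constants that depend on \<open>k\<close> and the bounds of \<open>c\<close> only. On the
  same side only the upper estimate of the distance holds, and the sign of \<open>q\<close> makes it sufficient.
\<close>

lemma bound_term:
  fixes c cl cu k q m \<eta> \<theta> t :: real
  assumes c: "0 < cl" "cl \<le> c" "c \<le> cu" and t: "0 \<le> t"
    and m: "m = (if k = 0 then \<theta> else min \<eta> \<theta>)"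
    and side: "k < 0 \<and> q \<le> 0 \<or> k = 0 \<or> 0 < k \<and> 0 \<le> q"
    and ne: "c * exp (- \<theta> * t) \<noteq> k * exp (- \<eta> * t)"
  shows "q * ln \<bar>c * exp (- \<theta> * t) - k * exp (- \<eta> * t)\<bar> \<le>
    (\<bar>q\<bar> * (\<bar>ln cl\<bar> + \<bar>ln cu\<bar>) + \<bar>q * ln (min cl \<bar>k\<bar>)\<bar> + \<bar>q * ln (cu + \<bar>k\<bar>)\<bar>) - q * m * t"
proof -
  let ?r = "\<bar>c * exp (- \<theta> * t) - k * exp (- \<eta> * t)\<bar>"
  have r0: "0 < ?r" using ne by simp
  have e: "exp (- \<theta> * t) \<le> exp (- m * t)" if "m \<le> \<theta>" for \<theta>
    using that t by (simp add: mult_right_mono)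
  define c1 where "c1 = \<bar>q\<bar> * (\<bar>ln cl\<bar> + \<bar>ln cu\<bar>)"
  define c2 where "c2 = \<bar>q * ln (min cl \<bar>k\<bar>)\<bar>"
  define c3 where "c3 = \<bar>q * ln (cu + \<bar>k\<bar>)\<bar>"
  have pos: "0 \<le> c1" "0 \<le> c2" "0 \<le> c3" by (simp_all add: c1_def c2_def c3_def)
  consider "k < 0" "q \<le> 0" | "k = 0" | "0 < k" "0 \<le> q" using side by auto
  then have "q * ln ?r \<le> (c1 + c2 + c3) - q * m * t"
  proof cases
    case 1
    have "min cl \<bar>k\<bar> * exp (- m * t) \<le> c * exp (- \<theta> * t) + \<bar>k\<bar> * exp (- \<eta> * t)"
    proof (cases "\<theta> \<le> \<eta>")
      case True
      then have "m = \<theta>" using m by auto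
      then have "min cl \<bar>k\<bar> * exp (- m * t) \<le> c * exp (- \<theta> * t)" using c by (simp add: mult_right_mono min.coboundedI1)
      moreover have "0 \<le> \<bar>k\<bar> * exp (- \<eta> * t)" by simp
      ultimately show ?thesis by linarith
    next
      case False
      then have "m = \<eta>" using m 1 by auto
      then have "min cl \<bar>k\<bar> * exp (- m * t) \<le> \<bar>k\<bar> * exp (- \<eta> * t)" by (simp add: mult_right_mono)
      moreover have "0 \<le> c * exp (- \<theta> * t)" using c by simp
      ultimately show ?thesis by linarith
    qed
    also have "\<dots> = ?r" 
    proof -
      have "0 \<le> c * exp (- \<theta> * t)" "k * exp (- \<eta> * t) \<le> 0" using c 1 by (auto intro!: mult_nonneg_nonneg mult_nonpos_nonneg)
      then have "?r = c * exp (- \<theta> * t) - k * exp (- \<eta> * t)" by (intro abs_of_nonneg) linarith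
      then show ?thesis using 1 by simp
    qed
    finally have "min cl \<bar>k\<bar> * exp (- m * t) \<le> ?r" .
    moreover have p: "0 < min cl \<bar>k\<bar>" using c 1 by simp
    ultimately have le: "ln (min cl \<bar>k\<bar> * exp (- m * t)) \<le> ln ?r" using r0 by (subst ln_le_cancel_iff) auto
    have "ln (a * exp (- m * t)) = ln a - m * t" if "0 < a" for a using that by (simp add: ln_mult)
    from le[unfolded this[OF p]] have "q * ln ?r \<le> q * (ln (min cl \<bar>k\<bar>) - m * t)" using 1 by (intro mult_left_mono_neg) auto
    also have "\<dots> = q * ln (min cl \<bar>k\<bar>) - q * m * t" by (simp add: right_diff_distrib)
    also have "\<dots> \<le> c2 - q * m * t" unfolding c2_def by (intro diff_right_mono abs_ge_self)
    finally show ?thesis using pos by linarith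
  next
    case 2
    then have "?r = c * exp (- \<theta> * t)" "m = \<theta>" using c m by auto
    then have "q * ln ?r = q * ln c - q * m * t" using c by (simp add: ln_mult right_diff_distrib)
    moreover have "ln cl \<le> ln c" "ln c \<le> ln cu" using c by auto
    then have "\<bar>ln c\<bar> \<le> \<bar>ln cl\<bar> + \<bar>ln cu\<bar>" by linarith
    then have "\<bar>q * ln c\<bar> \<le> c1" unfolding abs_mult c1_def by (intro mult_left_mono) auto
    then have "q * ln c \<le> c1" by linarith
    ultimately show ?thesis using pos by linarith
  next
    case 3
    have "?r \<le> c * exp (- \<theta> * t) + k * exp (- \<eta> * t)" using c 3 by (intro order_trans[OF abs_triangle_ineq4]) (auto simp: abs_mult)
    also have "\<dots> \<le> cu * exp (- m * t) + k * exp (- m * t)"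
      using c 3 m by (intro add_mono mult_mono mult_left_mono e) auto
    finally have "?r \<le> (cu + \<bar>k\<bar>) * exp (- m * t)" using 3 by (simp add: algebra_simps)
    moreover have p: "0 < cu + \<bar>k\<bar>" using c by simp
    ultimately have "ln ?r \<le> ln ((cu + \<bar>k\<bar>) * exp (- m * t))" using r0 by (subst ln_le_cancel_iff) auto
    also have "\<dots> = ln (cu + \<bar>k\<bar>) - m * t" using p by (simp add: ln_mult)
    finally have "q * ln ?r \<le> q * (ln (cu + \<bar>k\<bar>) - m * t)" using 3 by (intro mult_left_mono) auto
    also have "\<dots> = q * ln (cu + \<bar>k\<bar>) - q * m * t" by (simp add: right_diff_distrib)
    also have "\<dots> \<le> c3 - q * m * t" unfolding c3_def by (intro diff_right_mono abs_ge_self)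
    finally show ?thesis using pos by linarith
  qed
  then show ?thesis by (simp only: c1_def c2_def c3_def)
qed

text \<open>
  A gap \<open>(l e\<^sup>-\<^sup>\<mu>\<^sup>t, u e\<^sup>-\<^sup>\<upsilon>\<^sup>t)\<close> on the positive half-axis, bounded by two of the charges
  \<open>\<kappa>\<^sub>j e\<^sup>-\<^sup>\<eta>\<^sup>t\<close>. The signs of the charges and the order of their exponents put each of them into one
  of the cases of \<open>flow_term\<close>. If \<open>l = 0\<close>, the inner end of the gap is a charge at rest.
\<close>

locale channel =
  fixes J :: "nat set" and q \<kappa> \<eta> :: "nat \<Rightarrow> real" and l u \<mu> \<upsilon> :: real
  assumes fin: "finite J" and l: "0 \<le> l" and lu: "l < u" and ul: "0 < l \<Longrightarrow> \<upsilon> \<le> \<mu>"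
    and side: "\<And>j. j \<in> J \<Longrightarrow> \<kappa> j < 0 \<and> q j \<le> 0 \<or> \<kappa> j = 0 \<or>
      0 < \<kappa> j \<and> 0 \<le> q j \<and> (\<kappa> j \<le> l \<and> \<mu> \<le> \<eta> j \<or> u \<le> \<kappa> j \<and> \<eta> j \<le> \<upsilon>)"
begin

definition G :: "real \<Rightarrow> real \<Rightarrow> real" where
  "G t x = (\<Sum>j\<in>J. q j * ln \<bar>x - \<kappa> j * exp (- \<eta> j * t)\<bar>)"

definition W :: "real \<Rightarrow> real set" where
  "W t = {l * exp (- \<mu> * t)<..<u * exp (- \<upsilon> * t)}"

text \<open>
  The exponents of those flows \<open>x \<mapsto> x e\<^sup>-\<^sup>\<theta>\<^sup>t\<close> under which the gap is forward invariant.
\<close>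

definition \<Theta> :: "real set" where
  "\<Theta> = {\<theta>. \<upsilon> \<le> \<theta> \<and> (0 < l \<longrightarrow> \<theta> \<le> \<mu>)}"

text \<open>
  The exponent at which the distance from a point \<open>c e\<^sup>-\<^sup>\<theta>\<^sup>t\<close> to the \<open>j\<close>-th charge decays. The
  charge at \<open>0\<close> does not move, so that the distance to it is the point itself.
\<close>

definition m :: "nat \<Rightarrow> real \<Rightarrow> real" where
  "m j \<theta> = (if \<kappa> j = 0 then \<theta> else min (\<eta> j) \<theta>)"

text \<open>
  A lower bound for the speed at which \<open>G\<close> grows along the flow with exponent \<open>\<theta>\<close>, see \<open>flow\<close>.
\<close>

definition r :: "real \<Rightarrow> real" where
  "r \<theta> = - (\<Sum>j\<in>J. q j * m j \<theta>)"

lemma W_pos: "x \<in> W t \<Longrightarrow> 0 < x"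
  using l by (auto simp: W_def intro: le_less_trans[rotated])

lemma W_side:
  assumes "x \<in> W t" "j \<in> J" "0 < \<kappa> j" "0 \<le> t"
  shows "\<kappa> j \<le> l \<and> \<mu> \<le> \<eta> j \<and> \<kappa> j * exp (- \<eta> j * t) < x \<or> u \<le> \<kappa> j \<and> \<eta> j \<le> \<upsilon> \<and> x < \<kappa> j * exp (- \<eta> j * t)"
proof -
  consider "\<kappa> j \<le> l" "\<mu> \<le> \<eta> j" | "u \<le> \<kappa> j" "\<eta> j \<le> \<upsilon>" using side[OF assms(2)] assms(3) by force
  then show ?thesis
  proof cases
    case 1
    then have "\<kappa> j * exp (- \<eta> j * t) \<le> l * exp (- \<mu> * t)"
      using assms l by (intro mult_mono) (auto intro: mult_right_mono)
    then show ?thesis using 1 assms by (auto simp: W_def)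
  next
    case 2
    then have "u * exp (- \<upsilon> * t) \<le> \<kappa> j * exp (- \<eta> j * t)"
      using assms l lu by (intro mult_mono) (auto intro: mult_right_mono)
    then show ?thesis using 2 assms by (auto simp: W_def)
  qed
qed

lemma flow:
  assumes s: "0 \<le> s" "s \<le> t" and x: "x \<in> W s" and \<theta>: "\<theta> \<in> \<Theta>"
  shows "x * exp (- \<theta> * (t - s)) \<in> W t"
    and "G s x + r \<theta> * (t - s) \<le> G t (x * exp (- \<theta> * (t - s)))"
proof -
  have e: "exp (- a * t) = exp (- a * s) * exp (- a * (t - s))" for a
    by (simp add: exp_add[symmetric] algebra_simps)
  have ts: "0 \<le> t - s" using s by simp
  have "l * exp (- \<mu> * t) \<le> l * exp (- \<mu> * s) * exp (- \<theta> * (t - s))"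
  proof (cases "l = 0")
    case False
    then have "exp (- \<mu> * (t - s)) \<le> exp (- \<theta> * (t - s))" using \<theta> l ts by (auto simp: \<Theta>_def intro: mult_right_mono)
    then show ?thesis unfolding e[of \<mu>] mult.assoc[symmetric] using l by (intro mult_left_mono) auto
  qed simp
  also have "\<dots> < x * exp (- \<theta> * (t - s))" using x by (simp add: W_def)
  finally have 1: "l * exp (- \<mu> * t) < x * exp (- \<theta> * (t - s))" .
  have "x * exp (- \<theta> * (t - s)) < u * exp (- \<upsilon> * s) * exp (- \<theta> * (t - s))" using x by (simp add: W_def)
  also have "\<dots> \<le> u * exp (- \<upsilon> * t)"
  proof -
    have "exp (- \<theta> * (t - s)) \<le> exp (- \<upsilon> * (t - s))" using \<theta> ts by (auto simp: \<Theta>_def intro: mult_right_mono)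
    then show ?thesis unfolding e[of \<upsilon>] mult.assoc[symmetric] using l lu by (intro mult_left_mono) auto
  qed
  finally show "x * exp (- \<theta> * (t - s)) \<in> W t" using 1 by (simp add: W_def)
  have "q j * ln \<bar>x - \<kappa> j * exp (- \<eta> j * s)\<bar> - q j * m j \<theta> * (t - s) \<le>
      q j * ln \<bar>x * exp (- \<theta> * (t - s)) - \<kappa> j * exp (- \<eta> j * t)\<bar>" if j: "j \<in> J" for j
  proof -
    have "m j \<theta> = (if \<kappa> j * exp (- \<eta> j * s) = 0 then \<theta> else min (\<eta> j) \<theta>)" by (simp add: m_def)
    moreover have "\<kappa> j * exp (- \<eta> j * s) < 0 \<and> q j \<le> 0 \<or> \<kappa> j * exp (- \<eta> j * s) = 0 \<or>
      0 < \<kappa> j * exp (- \<eta> j * s) \<and> 0 \<le> q j \<and> (\<kappa> j * exp (- \<eta> j * s) < x \<and> \<theta> \<le> \<eta> j \<or> x < \<kappa> j * exp (- \<eta> j * s) \<and> \<eta> j \<le> \<theta>)"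
    proof -
      consider "\<kappa> j < 0" "q j \<le> 0" | "\<kappa> j = 0" | "0 < \<kappa> j" "0 \<le> q j" using side[OF j] by auto
      then show ?thesis
      proof cases
        case 1 then show ?thesis by (auto intro: mult_neg_pos)
      next
        case 2 then show ?thesis by simp
      next
        case 3
        then show ?thesis using W_side[OF x j 3(1) s(1)] \<theta> by (auto simp: \<Theta>_def)
      qed
    qed
    ultimately show ?thesis
      using flow_term[OF W_pos[OF x] ts, of "m j \<theta>" "\<kappa> j * exp (- \<eta> j * s)" \<theta> "\<eta> j" "q j"]
      unfolding e[of "\<eta> j"] by (simp add: mult.assoc)
  qed
  then have "(\<Sum>j\<in>J. q j * ln \<bar>x - \<kappa> j * exp (- \<eta> j * s)\<bar> - q j * m j \<theta> * (t - s)) \<le> G t (x * exp (- \<theta> * (t - s)))"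
    unfolding G_def by (intro sum_mono)
  then show "G s x + r \<theta> * (t - s) \<le> G t (x * exp (- \<theta> * (t - s)))"
    by (simp add: G_def r_def sum_subtractf sum_distrib_right)
qed

text \<open>
  On a logarithmic scale the gap is the interval between \<open>ln l - \<mu> t\<close> and \<open>ln u - \<upsilon> t\<close>. A point
  dividing it in some ratio is \<open>c e\<^sup>-\<^sup>\<theta>\<^sup>t\<close> with \<open>ln c\<close> and \<open>\<theta>\<close> dividing \<open>[ln l, ln u]\<close> and the
  exponents in the same ratio.
\<close>

lemma upper_bound: "\<exists>C. \<forall>t>0. \<forall>x\<in>W t. \<exists>\<theta>\<in>\<Theta>. G t x \<le> C + r \<theta> * t"
proof -
  \<comment> \<open>if the gap reaches down to \<open>0\<close>, then \<open>c = u\<close> will do and only \<open>\<theta>\<close> varies\<close>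
  define cl where "cl = (if l = 0 then u else l)"
  have cl: "0 < cl" "cl \<le> u" using l lu by (auto simp: cl_def)
  define C where "C = (\<Sum>j\<in>J. \<bar>q j\<bar> * (\<bar>ln cl\<bar> + \<bar>ln u\<bar>) + \<bar>q j * ln (min cl \<bar>\<kappa> j\<bar>)\<bar> + \<bar>q j * ln (u + \<bar>\<kappa> j\<bar>)\<bar>)"
  have "\<exists>\<theta>\<in>\<Theta>. G t x \<le> C + r \<theta> * t" if t: "0 < t" and x: "x \<in> W t" for t x
  proof -
    have x0: "0 < x" by (rule W_pos[OF x])
    have up: "ln x < ln u - \<upsilon> * t"
    proof -
      have "ln x < ln (u * exp (- \<upsilon> * t))" using x x0 by (subst ln_less_cancel_iff) (auto simp: W_def)
      then show ?thesis using l lu by (simp add: ln_mult)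
    qed
    have "\<exists>\<theta> c. \<theta> \<in> \<Theta> \<and> cl \<le> c \<and> c \<le> u \<and> x = c * exp (- \<theta> * t)"
    proof (cases "l = 0")
      case True
      define \<theta> where "\<theta> = (ln u - ln x) / t"
      have "\<upsilon> \<le> \<theta>" using up t by (simp add: \<theta>_def field_simps)
      moreover have "x = u * exp (- \<theta> * t)" using t x0 l lu by (simp add: \<theta>_def exp_diff)
      moreover have "cl = u" using True by (simp add: cl_def)
      moreover have "\<theta> \<in> \<Theta>" unfolding \<Theta>_def using True \<open>\<upsilon> \<le> \<theta>\<close> by simp
      ultimately show ?thesis by blast
    next
      case False
      then have l0: "0 < l" using l by simp
      have lo: "ln l - \<mu> * t < ln x"
      proof -
        have "ln (l * exp (- \<mu> * t)) < ln x" using x x0 l0 by (subst ln_less_cancel_iff) (auto simp: W_def)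
        then show ?thesis using l0 by (simp add: ln_mult)
      qed
      define A where "A = ln l - \<mu> * t"
      define B where "B = ln u - \<upsilon> * t"
      have AB: "A < ln x" "ln x < B" using lo up by (auto simp: A_def B_def)
      define v where "v = (ln x - A) / (B - A)"
      have "v * (B - A) = ln x - A" using AB by (simp add: v_def)
      then have "ln x = (1 - v) * A + v * B" by (simp add: algebra_simps)
      moreover have "0 \<le> v" "v \<le> 1" using AB by (auto simp: v_def field_simps)
      ultimately have v: "0 \<le> v" "v \<le> 1" "ln x = (1 - v) * A + v * B" by blast+
      define \<theta> where "\<theta> = (1 - v) * \<mu> + v * \<upsilon>"
      define c where "c = exp ((1 - v) * ln l + v * ln u)"
      have lnul: "ln l \<le> ln u" using l0 lu by simp
      have "ln l \<le> (1 - v) * ln l + v * ln u" "(1 - v) * ln l + v * ln u \<le> ln u"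
        using convex_bound_le[of "ln l" "ln u" "ln u" "1 - v" v] convex_bound_le[of "- ln l" "- ln l" "- ln u" "1 - v" v] v lnul by auto
      then have "l \<le> c" "c \<le> u" unfolding c_def using l0 lu by (metis exp_le_cancel_iff exp_ln less_trans)+
      moreover have "\<upsilon> \<le> \<theta>" "\<theta> \<le> \<mu>"
        using convex_bound_le[of \<mu> \<mu> \<upsilon> "1 - v" v] convex_bound_le[of "- \<mu>" "- \<upsilon>" "- \<upsilon>" "1 - v" v] v ul[OF l0] by (auto simp: \<theta>_def)
      moreover have "x = c * exp (- \<theta> * t)"
      proof -
        have "ln x = (1 - v) * ln l + v * ln u + - \<theta> * t" unfolding v(3) A_def B_def \<theta>_def by (simp add: algebra_simps)
        then have "exp (ln x) = c * exp (- \<theta> * t)" unfolding c_def by (simp only: exp_add)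
        then show ?thesis using x0 by simp
      qed
      moreover have "cl = l" using False by (simp add: cl_def)
      ultimately show ?thesis unfolding \<Theta>_def by blast
    qed
    then obtain \<theta> c where \<theta>: "\<theta> \<in> \<Theta>" and c: "cl \<le> c" "c \<le> u" and xc: "x = c * exp (- \<theta> * t)" by blast
    have "q j * ln \<bar>x - \<kappa> j * exp (- \<eta> j * t)\<bar> \<le>
        (\<bar>q j\<bar> * (\<bar>ln cl\<bar> + \<bar>ln u\<bar>) + \<bar>q j * ln (min cl \<bar>\<kappa> j\<bar>)\<bar> + \<bar>q j * ln (u + \<bar>\<kappa> j\<bar>)\<bar>) - q j * m j \<theta> * t"
      if j: "j \<in> J" for j
      unfolding xc
    proof (rule bound_term[OF cl(1) c less_imp_le[OF t] m_def])
      show "\<kappa> j < 0 \<and> q j \<le> 0 \<or> \<kappa> j = 0 \<or> 0 < \<kappa> j \<and> 0 \<le> q j" using side[OF j] by auto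
      have "x \<noteq> \<kappa> j * exp (- \<eta> j * t)"
      proof (cases "0 < \<kappa> j")
        case True then show ?thesis using W_side[OF x j] t by force
      next
        case False
        then have "\<kappa> j * exp (- \<eta> j * t) \<le> 0" by (simp add: mult_nonpos_nonneg)
        then show ?thesis using x0 by linarith
      qed
      then show "c * exp (- \<theta> * t) \<noteq> \<kappa> j * exp (- \<eta> j * t)" using xc by simp
    qed
    then have "G t x \<le> (\<Sum>j\<in>J. (\<bar>q j\<bar> * (\<bar>ln cl\<bar> + \<bar>ln u\<bar>) + \<bar>q j * ln (min cl \<bar>\<kappa> j\<bar>)\<bar> + \<bar>q j * ln (u + \<bar>\<kappa> j\<bar>)\<bar>) - q j * m j \<theta> * t)"
      unfolding G_def by (rule sum_mono)
    also have "\<dots> = C + r \<theta> * t"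
      unfolding C_def r_def by (simp only: sum_subtractf sum_distrib_right mult_minus_left add_uminus_conv_diff)
    finally show ?thesis using \<theta> by blast
  qed
  then show ?thesis by blast
qed

text \<open>
  Let \<open>R\<close> be the supremum of \<open>r\<close>. Flowing the maximum point from time \<open>s\<close> to time \<open>t\<close> shows that \<open>F\<close>
  grows at least at speed \<open>r \<theta>\<close> for all \<open>\<theta>\<close>, hence at speed \<open>R\<close>; the upper bound gives
  \<open>F t \<le> C + R t\<close>. In particular the limit \<open>R\<close> of \<open>F t / t\<close> bounds the speed at all times, not only
  asymptotically.
\<close>

lemma rate:
  assumes attained: "\<And>t. 0 \<le> t \<Longrightarrow> \<exists>x\<in>W t. F t = G t x"
    and max: "\<And>t x. 0 \<le> t \<Longrightarrow> x \<in> W t \<Longrightarrow> G t x \<le> F t"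
  obtains R where "((\<lambda>t. F t / t) \<longlongrightarrow> R) at_top"
    "\<And>s t. 0 \<le> s \<Longrightarrow> s \<le> t \<Longrightarrow> R * (t - s) \<le> F t - F s"
proof -
  have step: "r \<theta> * (t - s) \<le> F t - F s" if st: "0 \<le> s" "s \<le> t" and \<theta>: "\<theta> \<in> \<Theta>" for s t \<theta>
  proof -
    obtain x where x: "x \<in> W s" "F s = G s x" using attained[OF st(1)] by blast
    have "G t (x * exp (- \<theta> * (t - s))) \<le> F t" using flow(1)[OF st x(1) \<theta>] st by (intro max) auto
    then show ?thesis using flow(2)[OF st x(1) \<theta>] x(2) by linarith
  qed
  have ne: "\<Theta> \<noteq> {}" using ul by (auto simp: \<Theta>_def)
  have "r \<theta> \<le> F 1 - F 0" if "\<theta> \<in> \<Theta>" for \<theta> using step[of 0 1 \<theta>] that by simp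
  then have bdd: "bdd_above (r ` \<Theta>)" by (auto intro!: bdd_aboveI)
  define R where "R = (SUP \<theta>\<in>\<Theta>. r \<theta>)"
  have rR: "r \<theta> \<le> R" if "\<theta> \<in> \<Theta>" for \<theta> unfolding R_def using that bdd by (rule cSUP_upper)
  have inc: "R * (t - s) \<le> F t - F s" if st: "0 \<le> s" "s \<le> t" for s t
  proof (cases "s = t")
    case False
    then have "0 < t - s" using st by simp
    then have "r \<theta> \<le> (F t - F s) / (t - s)" if "\<theta> \<in> \<Theta>" for \<theta>
      using step[OF st that] by (simp add: field_simps)
    then have "R \<le> (F t - F s) / (t - s)" unfolding R_def using ne by (intro cSUP_least)
    then show ?thesis using \<open>0 < t - s\<close> by (simp add: field_simps)
  qed simp
  obtain C where C: "\<And>t x. 0 < t \<Longrightarrow> x \<in> W t \<Longrightarrow> \<exists>\<theta>\<in>\<Theta>. G t x \<le> C + r \<theta> * t"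
    using upper_bound by blast
  have up: "F t \<le> C + R * t" if t: "0 < t" for t
  proof -
    obtain x where x: "x \<in> W t" "F t = G t x" using attained[of t] t by auto
    obtain \<theta> where \<theta>: "\<theta> \<in> \<Theta>" "G t x \<le> C + r \<theta> * t" using C[OF t x(1)] by blast
    have "r \<theta> * t \<le> R * t" using rR[OF \<theta>(1)] t by (intro mult_right_mono) auto
    then show ?thesis using \<theta> x by linarith
  qed
  have inv: "((\<lambda>t::real. c / t) \<longlongrightarrow> 0) at_top" for c
    by (rule tendsto_divide_0[OF tendsto_const filterlim_at_top_imp_at_infinity[OF filterlim_ident]])
  have "((\<lambda>t. F t / t) \<longlongrightarrow> R) at_top"
  proof (rule tendsto_sandwich)
    show "((\<lambda>t. R + F 0 / t) \<longlongrightarrow> R) at_top" using tendsto_add[OF tendsto_const inv, of R] by simp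
    show "((\<lambda>t. R + C / t) \<longlongrightarrow> R) at_top" using tendsto_add[OF tendsto_const inv, of R] by simp
    show "\<forall>\<^sub>F t in at_top. R + F 0 / t \<le> F t / t"
      using eventually_gt_at_top[of 0]
    proof eventually_elim
      case (elim t)
      then have "(F 0 + R * t) / t \<le> F t / t" using inc[of 0 t] by (intro divide_right_mono) auto
      then show ?case using elim by (simp add: add_divide_distrib add.commute)
    qed
    show "\<forall>\<^sub>F t in at_top. F t / t \<le> R + C / t"
      using eventually_gt_at_top[of 0] by eventually_elim (use up in \<open>auto simp: field_simps\<close>)
  qed
  then show ?thesis using inc that by blast
qed

end

section \<open>Partial fractions with poles at the critical points\<close>

lemma prod_linear_dvd:
  fixes p :: "complex poly"
  assumes "finite I" "inj_on \<rho> I" "\<And>i. i \<in> I \<Longrightarrow> poly p (\<rho> i) = 0"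
  shows "(\<Prod>i\<in>I. [:- \<rho> i, 1:]) dvd p"
  using assms
proof (induction I rule: finite_induct)
  case (insert i I)
  then obtain e where e: "p = (\<Prod>i\<in>I. [:- \<rho> i, 1:]) * e" by (auto elim: dvdE)
  have "poly (\<Prod>i\<in>I. [:- \<rho> i, 1:]) (\<rho> i) \<noteq> 0"
    using insert by (auto simp: poly_prod)
  moreover have "poly p (\<rho> i) = 0" using insert by simp
  ultimately have "poly e (\<rho> i) = 0" unfolding e by simp
  then have "[:- \<rho> i, 1:] dvd e" by (simp add: poly_eq_0_iff_dvd)
  then have "(\<Prod>i\<in>I. [:- \<rho> i, 1:]) * [:- \<rho> i, 1:] dvd p" unfolding e by (rule mult_dvd_mono[OF dvd_refl])
  then show ?case unfolding prod.insert[OF insert(1,2)] by (simp only: mult.commute)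
qed simp

context charges
begin

definition ddH :: "complex \<Rightarrow> complex" where
  "ddH z = - (\<Sum>j=1..n. of_real (q j) / (z - of_real (k j))^2)"

lemma has_field_derivative_dH:
  assumes "z \<notin> S"
  shows "(dH has_field_derivative ddH z) (at z)"
proof -
  have "((\<lambda>z. \<Sum>j=1..n. of_real (q j) / (z - of_real (k j))) has_field_derivative
       (\<Sum>j=1..n. - (of_real (q j) / (z - of_real (k j))^2))) (at z)"
  proof (rule DERIV_sum)
    fix j assume "j \<in> {1..n}"
    then have "z - of_real (k j) \<noteq> 0" using assms by (auto simp: S_def)
    then show "((\<lambda>z. of_real (q j) / (z - of_real (k j))) has_field_derivative - (of_real (q j) / (z - of_real (k j))^2)) (at z)"
      by (auto intro!: derivative_eq_intros simp: power2_eq_square)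
  qed
  then show ?thesis by (simp add: dH_def[abs_def] ddH_def sum_negf)
qed

text \<open>
  At a critical point \<open>(x - k\<^sub>N) H''(x)\<close> is the derivative of \<open>(x - k\<^sub>N) H'(x)\<close>, which is positive.
\<close>

lemma ddH_crit_nonzero:
  assumes i: "i \<in> {1..n} - {N}"
  shows "ddH (of_real (crit i)) \<noteq> 0"
proof -
  let ?x = "crit i"
  have ne: "?x - k j \<noteq> 0" if "j \<in> {1..n}" for j
    using gap_less_iff(2)[OF crit(1)[OF i] _ that] i by auto
  define s where "s = (\<Sum>j=1..n. q j / (?x - k j)^2)"
  have "(?x - k N) * s = g ?x + (\<Sum>j=1..n. q j * (k j - k N) / (?x - k j)^2)"
    unfolding s_def g_def sum_distrib_left sum.distrib[symmetric]
  proof (rule sum.cong)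
    fix j assume "j \<in> {1..n}"
    from ne[OF this] show "(?x - k N) * (q j / (?x - k j)^2) = q j / (?x - k j) + q j * (k j - k N) / (?x - k j)^2"
      by (simp add: power2_eq_square divide_simps) (simp add: algebra_simps)
  qed simp
  also have "\<dots> < 0"
  proof -
    have "0 < (\<Sum>j=1..n. - (q j * (k j - k N) / (?x - k j)^2))"
    proof (rule sum_pos2[of _ n])
      have "q n * (k n - k N) / (?x - k n)^2 < 0" using moment_neg(2)[of n] ne[of n] N_less by (intro divide_neg_pos) auto
      then show "0 < - (q n * (k n - k N) / (?x - k n)^2)" by simp
      show "0 \<le> - (q j * (k j - k N) / (?x - k j)^2)" if "j \<in> {1..n}" for j
        using moment_neg(1)[OF that] by (auto intro!: divide_nonpos_nonneg)
    qed (use N_less in auto)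
    then show ?thesis using crit(2)[OF i] by (simp add: sum_negf)
  qed
  finally have "s \<noteq> 0" by auto
  moreover have "ddH (of_real ?x) = - of_real s" by (simp add: ddH_def s_def)
  ultimately show ?thesis by simp
qed

lemma inj_crit: "inj_on crit ({1..n} - {N})"
proof (rule inj_onI)
  fix i j assume ij: "i \<in> {1..n} - {N}" "j \<in> {1..n} - {N}" "crit i = crit j"
  have gi: "crit i \<in> gap i" using crit(1)[of i] ij by blast
  have gj: "crit i \<in> gap j" using crit(1)[of j] ij(2) unfolding ij(3) .
  have "i < l \<longleftrightarrow> j < l" if l: "l \<in> {1..n}" for l
    using gap_less_iff(1)[OF gi _ l] gap_less_iff(1)[OF gj _ l] ij by auto
  from this[of i] this[of j] ij show "i = j" by auto
qed

text \<open>
  \<open>Num\<close> is \<open>\<partial>\<^sub>t H - \<gamma>\<close> for charges moving with velocities \<open>c\<close>. Multiplied by \<open>\<Prod> (z - k\<^sub>j)\<close> and by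
  \<open>H'\<close>, the difference \<open>D\<close> of the two sides is a polynomial. It vanishes at all critical points, so
  it is divisible by \<open>\<Prod> (z - \<rho>\<^sub>i)\<close>, and the quotient \<open>E\<close> is a polynomial that tends to \<open>0\<close> at
  infinity, by the choice of the linear part. So \<open>E = 0\<close>.
\<close>

lemma partial_fractions:
  fixes c :: "nat \<Rightarrow> real" and \<gamma> :: real
  defines "Num \<equiv> \<lambda>z. - (\<Sum>j=1..n. of_real (q j * c j) / (z - of_real (k j))) - of_real \<gamma>"
    and "B \<equiv> \<Sum>j=1..n. q j"
  assumes z: "z \<in> uhp"
  shows "Num z / dH z = of_real (- (\<gamma> / B)) * z + of_real ((\<gamma> / B * (\<Sum>j=1..n. q j * k j) - (\<Sum>j=1..n. q j * c j)) / B)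
     + (\<Sum>i\<in>{1..n}-{N}. Num (of_real (crit i)) / ddH (of_real (crit i)) / (z - of_real (crit i)))"
proof -
  let ?I = "{1..n} - {N}"
  let ?S = "\<Sum>j=1..n. q j * k j" and ?C = "\<Sum>j=1..n. q j * c j"
  let ?L = "\<lambda>j. [:- of_real (k j), 1:] :: complex poly"
  define \<rho> :: "nat \<Rightarrow> complex" where "\<rho> i = of_real (crit i)" for i
  define \<alpha> where "\<alpha> = - (\<gamma> / B)"
  define \<beta> where "\<beta> = (\<gamma> / B * ?S - ?C) / B"
  define r where "r i = Num (\<rho> i) / ddH (\<rho> i)" for i
  have B: "B \<noteq> 0" "\<alpha> * B = - \<gamma>" "\<beta> * B = \<gamma> / B * ?S - ?C" using total_pos by (auto simp: B_def \<alpha>_def \<beta>_def)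
  define P where "P = (\<Prod>j=1..n. ?L j)"
  define A where "A j = (\<Prod>l\<in>{1..n}-{j}. ?L l)" for j
  define p where "p = (\<Sum>j=1..n. smult (of_real (q j)) (A j))"
  define a where "a = (\<Sum>j=1..n. smult (of_real (- (q j * c j))) (A j)) - smult (of_real \<gamma>) P"
  have P0: "poly P x \<noteq> 0" if "x \<notin> S" for x
    using that by (auto simp: P_def poly_prod S_def)
  have A: "poly (A j) x = poly P x / (x - of_real (k j))" if x: "x \<notin> S" and j: "j \<in> {1..n}" for x j
  proof -
    have "x - of_real (k j) \<noteq> 0" using x j by (auto simp: S_def)
    have "P = ?L j * A j" unfolding P_def A_def using j by (subst prod.remove[of _ j]) auto
    then have "poly P x = poly (?L j) x * poly (A j) x" by (simp only: poly_mult)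
    then show ?thesis using \<open>x - of_real (k j) \<noteq> 0\<close> by simp
  qed
  have p: "poly p x = poly P x * dH x" if x: "x \<notin> S" for x
    unfolding p_def dH_def poly_sum sum_distrib_left using A[OF x] by (intro sum.cong) auto
  have a: "poly a x = poly P x * Num x" if x: "x \<notin> S" for x
  proof -
    have "(\<Sum>j=1..n. poly (smult (of_real (- (q j * c j))) (A j)) x) = - (poly P x * (\<Sum>j=1..n. of_real (q j * c j) / (x - of_real (k j))))"
      unfolding sum_distrib_left sum_negf[symmetric] using A[OF x] by (intro sum.cong) auto
    then show ?thesis by (simp add: a_def Num_def poly_sum algebra_simps)
  qed
  have \<rho>S: "\<rho> i \<notin> S" if "i \<in> ?I" for i
    using gap_cuhp[OF crit(1)[OF that]] that by (auto simp: \<rho>_def cuhp_def)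
  have p\<rho>: "poly p (\<rho> i) = 0" if "i \<in> ?I" for i
    using p[OF \<rho>S[OF that]] crit(2)[OF that] by (simp add: \<rho>_def dH_real)
  define pq where "pq i = synthetic_div p (\<rho> i)" for i
  have pq: "p = [:- \<rho> i, 1:] * pq i" if "i \<in> ?I" for i
    using synthetic_div_correct'[of "\<rho> i" p] p\<rho>[OF that] by (simp add: pq_def)
  have pqz: "poly (pq i) x = poly p x / (x - \<rho> i)" if "i \<in> ?I" "x \<noteq> \<rho> i" for i x
  proof -
    have "poly p x = poly ([:- \<rho> i, 1:] * pq i) x" by (rule arg_cong[OF pq[OF that(1)], of "\<lambda>p. poly p x"])
    also have "\<dots> = (x - \<rho> i) * poly (pq i) x" by (simp add: algebra_simps)
    finally have "poly p x = (x - \<rho> i) * poly (pq i) x" .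
    then show ?thesis using that by simp
  qed
  have inj: "inj_on \<rho> ?I" unfolding inj_on_def \<rho>_def of_real_eq_iff using inj_crit[unfolded inj_on_def] .
  have pq_other: "poly (pq j) (\<rho> i) = 0" if "i \<in> ?I" "j \<in> ?I" "i \<noteq> j" for i j
  proof -
    have "\<rho> i \<noteq> \<rho> j" using inj_onD[OF inj, of i j] that by blast
    then show ?thesis using pqz[OF that(2), of "\<rho> i"] p\<rho>[OF that(1)] by simp
  qed
  have pq_self: "poly (pq i) (\<rho> i) = ddH (\<rho> i) * poly P (\<rho> i)" if i: "i \<in> ?I" for i
  proof (rule DERIV_unique)
    have "((\<lambda>x. (x - \<rho> i) * poly (pq i) x) has_field_derivative poly (pq i) (\<rho> i)) (at (\<rho> i))"
      by (auto intro!: derivative_eq_intros poly_DERIV)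
    moreover have "(\<lambda>x. (x - \<rho> i) * poly (pq i) x) = poly p"
    proof
      fix x
      have "(x - \<rho> i) * poly (pq i) x = poly ([:- \<rho> i, 1:] * pq i) x" by (simp add: algebra_simps)
      also have "\<dots> = poly p x" by (rule arg_cong[OF pq[OF i, symmetric], of "\<lambda>p. poly p x"])
      finally show "(x - \<rho> i) * poly (pq i) x = poly p x" .
    qed
    ultimately show "(poly p has_field_derivative poly (pq i) (\<rho> i)) (at (\<rho> i))" by simp
    have "((\<lambda>x. poly P x * dH x) has_field_derivative poly P (\<rho> i) * ddH (\<rho> i) + poly (pderiv P) (\<rho> i) * dH (\<rho> i)) (at (\<rho> i))"
      using DERIV_mult[OF poly_DERIV has_field_derivative_dH[OF \<rho>S[OF i]]] by (simp add: add.commute mult.commute)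
    then have "((\<lambda>x. poly P x * dH x) has_field_derivative ddH (\<rho> i) * poly P (\<rho> i)) (at (\<rho> i))"
      using crit(2)[OF i] by (simp add: \<rho>_def dH_real mult.commute)
    then show "(poly p has_field_derivative ddH (\<rho> i) * poly P (\<rho> i)) (at (\<rho> i))"
    proof (rule has_field_derivative_transform_within_open)
      show "open (- S)" by (simp add: finite_S finite_imp_closed open_Compl)
    qed (use p \<rho>S[OF i] in auto)
  qed
  define D where "D = a - [:of_real \<beta>, of_real \<alpha>:] * p - (\<Sum>i\<in>?I. smult (r i) (pq i))"
  have D\<rho>: "poly D (\<rho> i) = 0" if i: "i \<in> ?I" for i
  proof -
    have "(\<Sum>j\<in>?I. r j * poly (pq j) (\<rho> i)) = r i * poly (pq i) (\<rho> i)"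
    proof -
      have "(\<Sum>j\<in>?I. r j * poly (pq j) (\<rho> i)) = (\<Sum>j\<in>?I. if j = i then r i * poly (pq i) (\<rho> i) else 0)"
        using pq_other[OF i] by (intro sum.cong) auto
      then show ?thesis using i by simp
    qed
    also have "\<dots> = poly a (\<rho> i)"
      unfolding pq_self[OF i] a[OF \<rho>S[OF i]] r_def using ddH_crit_nonzero[OF i] by (simp add: \<rho>_def)
    finally show ?thesis by (simp add: D_def poly_sum p\<rho>[OF i])
  qed
  define R where "R = (\<Prod>i\<in>?I. [:- \<rho> i, 1:])"
  have "R dvd D" unfolding R_def by (rule prod_linear_dvd[OF _ inj D\<rho>]) auto
  then obtain E where E: "D = R * E" by blast
  \<comment> \<open>\<open>x \<Psi> x\<close> tends to \<open>0\<close>: the contributions of order \<open>x\<close> and \<open>1\<close> cancel by the choice of \<open>\<alpha>\<close> and \<open>\<beta>\<close>\<close>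
  define \<Psi> where "\<Psi> x = Num x - (of_real \<beta> + of_real \<alpha> * x) * dH x - (\<Sum>i\<in>?I. r i * (dH x / (x - \<rho> i)))" for x
  have D\<Psi>: "poly D x = poly P x * \<Psi> x" if x: "x \<notin> S" "x \<notin> \<rho> ` ?I" for x
  proof -
    have "(\<Sum>i\<in>?I. r i * poly (pq i) x) = poly P x * (\<Sum>i\<in>?I. r i * (dH x / (x - \<rho> i)))"
      unfolding sum_distrib_left
    proof (rule sum.cong[OF refl])
      fix i assume i: "i \<in> ?I"
      then have "x \<noteq> \<rho> i" using x(2) by blast
      from pqz[OF i this] show "r i * poly (pq i) x = poly P x * (r i * (dH x / (x - \<rho> i)))"
        by (simp add: p[OF x(1)])
    qed
    then show ?thesis by (simp add: D_def poly_sum \<Psi>_def a[OF x(1)] p[OF x(1)] algebra_simps)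
  qed
  have u0: "((\<lambda>x::complex. of_real b / (x - c)) \<longlongrightarrow> 0) at_infinity" for b c
  proof (rule tendsto_divide_0[OF tendsto_const])
    show "filterlim (\<lambda>x. x - c) at_infinity at_infinity"
      using tendsto_add_filterlim_at_infinity'[OF filterlim_ident tendsto_const, of "- c"] by simp
  qed
  have ev: "\<forall>\<^sub>F x::complex in at_infinity. x \<noteq> 0 \<and> x \<notin> S \<and> x \<notin> \<rho> ` ?I"
  proof -
    have "\<forall>\<^sub>F x::complex in at_infinity. \<forall>y\<in>{0} \<union> S \<union> \<rho> ` ?I. x \<noteq> y"
      by (intro eventually_ball_finite ballI eventually_not_equal_at_infinity) (auto simp: finite_S)
    then show ?thesis by eventually_elim auto
  qed
  have u1: "((\<lambda>x::complex. x / (x - c)) \<longlongrightarrow> 1) at_infinity" for c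
  proof -
    have "((\<lambda>x::complex. 1 + c / (x - c)) \<longlongrightarrow> 1 + 0) at_infinity"
    proof (intro tendsto_intros)
      have "((\<lambda>x. c * (of_real 1 / (x - c))) \<longlongrightarrow> c * 0) at_infinity" by (intro tendsto_mult tendsto_const u0)
      then show "((\<lambda>x::complex. c / (x - c)) \<longlongrightarrow> 0) at_infinity" by simp
    qed
    moreover have "\<forall>\<^sub>F x::complex in at_infinity. 1 + c / (x - c) = x / (x - c)"
      using eventually_not_equal_at_infinity[of c] by eventually_elim (simp add: field_simps)
    ultimately show ?thesis using Lim_transform_eventually by fastforce
  qed
  have xdH: "((\<lambda>x. x * dH x) \<longlongrightarrow> of_real B) at_infinity"
  proof -
    have "((\<lambda>x::complex. \<Sum>j=1..n. of_real (q j) * (x / (x - of_real (k j)))) \<longlongrightarrow> (\<Sum>j=1..n. of_real (q j) * 1)) at_infinity"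
      by (intro tendsto_sum tendsto_mult tendsto_const u1)
    moreover have "(\<lambda>x. \<Sum>j=1..n. of_real (q j) * (x / (x - of_real (k j)))) = (\<lambda>x. x * dH x)"
      unfolding dH_def sum_distrib_left by (intro ext sum.cong) auto
    moreover have "(\<Sum>j=1..n. of_real (q j) * 1) = (of_real B :: complex)" by (simp add: B_def)
    ultimately show ?thesis by (simp only:)
  qed
  have x\<Psi>: "((\<lambda>x. x * \<Psi> x) \<longlongrightarrow> 0) at_infinity"
  proof -
    define Y where "Y x = (\<Sum>j=1..n. of_real (- (q j * c j)) * (x / (x - of_real (k j))))
        - of_real \<alpha> * (\<Sum>j=1..n. of_real (q j * k j) * (x / (x - of_real (k j)))) - of_real \<beta> * (x * dH x)
        - (\<Sum>i\<in>?I. r i * ((x * dH x) * (of_real 1 / (x - \<rho> i))))" for x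
    have lim: "(Y \<longlongrightarrow> (\<Sum>j=1..n. of_real (- (q j * c j)) * 1)
        - of_real \<alpha> * (\<Sum>j=1..n. of_real (q j * k j) * 1) - of_real \<beta> * of_real B
        - (\<Sum>i\<in>?I. r i * (of_real B * 0))) at_infinity"
      unfolding Y_def by (intro tendsto_diff tendsto_sum tendsto_mult tendsto_const u1 xdH u0)
    have lim_eq: "(\<Sum>j=1..n. of_real (- (q j * c j)) * 1) - of_real \<alpha> * (\<Sum>j=1..n. of_real (q j * k j) * 1) - of_real \<beta> * of_real B
        - (\<Sum>i\<in>?I. r i * (of_real B * 0)) = (of_real (- ?C - \<alpha> * ?S - \<beta> * B) :: complex)"
      by (simp add: sum_negf)
    have zero: "- ?C - \<alpha> * ?S - \<beta> * B = 0" unfolding B(3) \<alpha>_def by simp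
    have "(Y \<longlongrightarrow> 0) at_infinity" using lim unfolding lim_eq zero of_real_0 .
    moreover have "\<forall>\<^sub>F x in at_infinity. Y x = x * \<Psi> x"
      using ev
    proof eventually_elim
      case (elim x)
      have xk: "x - of_real (k j) \<noteq> 0" if "j \<in> {1..n}" for j using elim that by (auto simp: S_def)
      have "x * x * dH x = of_real B * x + (\<Sum>j=1..n. of_real (q j * k j) * (x / (x - of_real (k j))))"
      proof -
        have "x * x * dH x = (\<Sum>j=1..n. of_real (q j) * x + of_real (q j * k j) * (x / (x - of_real (k j))))"
          unfolding dH_def sum_distrib_left
        proof (rule sum.cong)
          fix j assume "j \<in> {1..n}"
          from xk[OF this] show "x * x * (of_real (q j) / (x - of_real (k j))) = of_real (q j) * x + of_real (q j * k j) * (x / (x - of_real (k j)))"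
            by (simp add: field_simps)
        qed simp
        then show ?thesis by (simp add: sum.distrib sum_distrib_right B_def)
      qed
      then have 1: "(\<Sum>j=1..n. of_real (q j * k j) * (x / (x - of_real (k j)))) = x * x * dH x - of_real B * x" by simp
      have 2: "(\<Sum>j=1..n. of_real (- (q j * c j)) * (x / (x - of_real (k j)))) = x * Num x + of_real \<gamma> * x"
      proof -
        have "(\<Sum>j=1..n. of_real (- (q j * c j)) * (x / (x - of_real (k j)))) = - (x * (\<Sum>j=1..n. of_real (q j * c j) / (x - of_real (k j))))"
          unfolding sum_distrib_left sum_negf[symmetric] by (intro sum.cong) auto
        then show ?thesis by (simp add: Num_def algebra_simps)
      qed
      have 3: "(\<Sum>i\<in>?I. r i * ((x * dH x) * (of_real 1 / (x - \<rho> i)))) = x * (\<Sum>i\<in>?I. r i * (dH x / (x - \<rho> i)))"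
        unfolding sum_distrib_left by (intro sum.cong) auto
      have "of_real \<gamma> + of_real \<alpha> * of_real B = (0::complex)"
        by (metis B(2) add.right_inverse of_real_0 of_real_add of_real_mult)
      then have "of_real \<gamma> * x + of_real \<alpha> * (of_real B * x) = 0" by algebra
      then show ?case unfolding Y_def \<Psi>_def 1 2 3 by algebra
    qed
    ultimately show ?thesis by (rule Lim_transform_eventually)
  qed
  \<comment> \<open>there is one critical point for each charge except the \<open>N\<close>-th, so the degrees differ by \<open>1\<close>\<close>
  have PR: "((\<lambda>x. poly P x / (x * poly R x)) \<longlongrightarrow> 1) at_infinity"
  proof -
    let ?T = "\<lambda>x. (\<Prod>i\<in>?I. (x - of_real (k i)) / (x - \<rho> i)) * ((x - of_real (k N)) / (x - 0))"
    have l: "((\<lambda>x::complex. (x - b) / (x - c)) \<longlongrightarrow> 1) at_infinity" for b c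
    proof -
      have "((\<lambda>x. x / (x - c) - b * (of_real 1 / (x - c))) \<longlongrightarrow> 1 - b * 0) at_infinity"
        by (intro tendsto_diff tendsto_mult tendsto_const u0 u1)
      then show ?thesis by (simp add: diff_divide_distrib)
    qed
    have "(?T \<longlongrightarrow> (\<Prod>i\<in>?I. 1) * 1) at_infinity" by (intro tendsto_mult tendsto_prod l)
    moreover have "?T x = poly P x / (x * poly R x)" for x
    proof -
      have "N \<in> {1..n}" using N_ge N_less by simp
      then have "poly P x = (x - of_real (k N)) * (\<Prod>i\<in>?I. x - of_real (k i))"
        unfolding P_def poly_prod by (subst prod.remove[of _ N]) auto
      moreover have "poly R x = (\<Prod>i\<in>?I. x - \<rho> i)" by (simp add: R_def poly_prod)
      ultimately show ?thesis by (simp add: prod_dividef mult.commute)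
    qed
    ultimately show ?thesis by simp
  qed
  have "((\<lambda>x. (poly P x / (x * poly R x)) * (x * \<Psi> x)) \<longlongrightarrow> 1 * 0) at_infinity"
    by (intro tendsto_mult PR x\<Psi>)
  moreover have "\<forall>\<^sub>F x in at_infinity. (poly P x / (x * poly R x)) * (x * \<Psi> x) = poly E x"
    using ev
  proof eventually_elim
    case (elim x)
    have "poly R x \<noteq> 0" using elim by (auto simp: R_def poly_prod)
    moreover have "poly R x * poly E x = poly P x * \<Psi> x" using D\<Psi>[of x] elim by (simp add: E)
    ultimately show ?case using elim by (simp add: field_simps)
  qed
  ultimately have "(poly E \<longlongrightarrow> 0) at_infinity" using Lim_transform_eventually by fastforce
  moreover have "poly E holomorphic_on UNIV" by (intro holomorphic_intros)
  ultimately have "poly E x = 0" for x using Liouville_weak_0 by blast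
  then have "poly D z = 0" by (simp add: E)
  moreover have zS: "z \<notin> S" "z \<notin> \<rho> ` ?I" using z by (auto simp: S_def uhp_def \<rho>_def)
  ultimately have "\<Psi> z = 0" using D\<Psi>[OF zS] P0[OF zS(1)] by simp
  moreover have "(\<Sum>i\<in>?I. r i * (dH z / (z - \<rho> i))) = dH z * (\<Sum>i\<in>?I. r i / (z - \<rho> i))"
    unfolding sum_distrib_left by (intro sum.cong) auto
  ultimately have "Num z = dH z * (of_real \<beta> + of_real \<alpha> * z + (\<Sum>i\<in>?I. r i / (z - \<rho> i)))"
    by (simp add: \<Psi>_def algebra_simps)
  then have "Num z / dH z = of_real \<alpha> * z + of_real \<beta> + (\<Sum>i\<in>?I. r i / (z - \<rho> i))"
    using dH_nonzero[OF z] by simp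
  then show ?thesis unfolding \<alpha>_def \<beta>_def r_def \<rho>_def .
qed

end

section \<open>The moving charges of the slit data\<close>

locale slits =
  fixes d :: slit_data
  assumes standing: "standing_assumptions d" and adm: "admissible d"
begin

abbreviation "N \<equiv> nP d"
abbreviation "n \<equiv> nP d + nM d"
abbreviation "K \<equiv> kP d (nP d)"

definition q :: "nat \<Rightarrow> real" where
  "q j = (if j \<le> N then bP d j else - bM d (j - N))"

text \<open>
  The exponents in the common numbering. The first charge stays where it is, which is exponent \<open>0\<close>;
  so does the \<open>N\<close>-th, the common limit of the others, since its distance from the limit is \<open>0\<close>.
\<close>

definition theta :: "nat \<Rightarrow> real" where
  "theta j = (if j = 1 then 0 else if j \<le> N then thP d j else thM d (j - N))"

definition k0 :: "nat \<Rightarrow> real" where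
  "k0 j = (if j \<le> N then kP d j else kM d (j - N))"

text \<open>
  Positions at time \<open>t\<close>, frozen for \<open>t < 0\<close>. So the charges are in order for all real \<open>t\<close>, and
  two-sided limits in \<open>t\<close> make sense at \<open>0\<close>, too.
\<close>

definition kk :: "real \<Rightarrow> nat \<Rightarrow> real" where
  "kk t j = K + (k0 j - K) * exp (- theta j * max t 0)"

lemma N2: "2 \<le> N" and M1: "1 \<le> nM d"
  using standing by (auto simp: standing_assumptions_def)

lemma q_plus: "j \<in> {1..N} \<Longrightarrow> 0 < q j"
  using standing by (auto simp: standing_assumptions_def q_def)

lemma q_minus: "j \<in> {N<..n} \<Longrightarrow> q j < 0"
proof -
  assume j: "j \<in> {N<..n}"
  then have "j - N \<in> {1..nM d}" by auto
  then have "0 < bM d (j - N)" using standing unfolding standing_assumptions_def by blast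
  then show ?thesis using j by (simp add: q_def)
qed

lemma k0_plus: "i \<in> {1..N} \<Longrightarrow> j \<in> {1..N} \<Longrightarrow> i < j \<Longrightarrow> k0 i < k0 j"
  using standing by (auto simp: standing_assumptions_def k0_def strict_mono_on_def)

lemma k0_N: "k0 N = K" by (simp add: k0_def)

lemma k0_minus: "i \<in> {N<..n} \<Longrightarrow> j \<in> {N<..n} \<Longrightarrow> i < j \<Longrightarrow> k0 i < k0 j"
proof -
  assume ij: "i \<in> {N<..n}" "j \<in> {N<..n}" "i < j"
  have "strict_mono_on {1..nM d} (kM d)" using standing by (simp add: standing_assumptions_def)
  moreover have "i - N \<in> {1..nM d}" "j - N \<in> {1..nM d}" "i - N < j - N" using ij by auto
  ultimately have "kM d (i - N) < kM d (j - N)" by (auto simp: strict_mono_on_def)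
  then show ?thesis using ij by (simp add: k0_def)
qed

lemma k0_gt: "j \<in> {N<..n} \<Longrightarrow> K < k0 j"
proof -
  assume j: "j \<in> {N<..n}"
  have "K < k0 (N + 1)" using standing by (simp add: standing_assumptions_def k0_def)
  then show ?thesis using k0_minus[of "N + 1" j] j by (cases "j = N + 1") auto
qed

lemma theta_plus: "1 \<le> i \<Longrightarrow> i \<le> j \<Longrightarrow> j < N \<Longrightarrow> theta i \<le> theta j"
proof -
  assume ij: "1 \<le> i" "i \<le> j" "j < N"
  have "mono_on {2..N - 1} (thP d)" using adm by (simp add: admissible_def)
  moreover have "0 < thP d j" if "j \<in> {2..N - 1}" using standing that by (simp add: standing_assumptions_def)
  moreover have "j \<in> {2..N - 1}" if "j \<noteq> 1" using that ij by auto
  moreover have "i \<in> {2..N - 1}" if "i \<noteq> 1" using that ij by auto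
  ultimately show ?thesis using ij unfolding theta_def
    by (cases "i = 1"; cases "j = 1") (force simp: mono_on_def less_imp_le)+
qed

lemma theta_minus: "N < i \<Longrightarrow> i \<le> j \<Longrightarrow> j \<le> n \<Longrightarrow> theta j \<le> theta i"
proof -
  assume ij: "N < i" "i \<le> j" "j \<le> n"
  have "antimono_on {1..nM d} (thM d)" using adm by (simp add: admissible_def)
  moreover have "i - N \<in> {1..nM d}" "j - N \<in> {1..nM d}" "i - N \<le> j - N" using ij by auto
  ultimately have "thM d (j - N) \<le> thM d (i - N)" by (auto simp: monotone_on_def)
  then show ?thesis using ij N2 by (auto simp: theta_def)
qed

lemma kk_0: "kk 0 j = k0 j" by (simp add: kk_def)

lemma kk_plus: "j \<in> {1..N} \<Longrightarrow> 0 \<le> t \<Longrightarrow> kk t j = kPt d j t"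
  using N2 by (auto simp: kk_def kPt_def k0_def theta_def)

lemma kk_minus: "j \<in> {1..nM d} \<Longrightarrow> 0 \<le> t \<Longrightarrow> kk t (N + j) = kMt d j t"
  using N2 by (auto simp: kk_def kMt_def k0_def theta_def)

lemma sum_upper_minus:
  assumes "\<mu> \<le> nM d"
  shows "(\<Sum>l=N+\<mu>+1..n. q l) = - (\<Sum>j=\<mu>+1..nM d. bM d j)"
proof -
  have "(\<Sum>l=N+\<mu>+1..n. q l) = (\<Sum>j=\<mu>+1..nM d. - bM d j)"
    by (rule sum.reindex_bij_witness[of _ "\<lambda>j. N + j" "\<lambda>l. l - N"]) (auto simp: q_def)
  then show ?thesis by (simp add: sum_negf)
qed

lemma sum_upper_plus:
  assumes "\<nu> \<le> N"
  shows "(\<Sum>l=\<nu>+1..n. q l) = (\<Sum>j=\<nu>+1..N. bP d j) - sumM d"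
proof -
  have "{\<nu>+1..n} = {\<nu>+1..N} \<union> {N+0+1..n}" using assms by auto
  then have "(\<Sum>l=\<nu>+1..n. q l) = (\<Sum>l=\<nu>+1..N. q l) + (\<Sum>l=N+0+1..n. q l)"
    by (simp add: sum.union_disjoint)
  also have "(\<Sum>l=\<nu>+1..N. q l) = (\<Sum>j=\<nu>+1..N. bP d j)" by (intro sum.cong) (auto simp: q_def)
  finally show ?thesis using sum_upper_minus[of 0] by (simp add: sumM_def)
qed

lemma total: "(\<Sum>j=1..n. q j) = sumP d - sumM d"
  using sum_upper_plus[of 0] by (simp add: sumP_def)

lemma sumM_split: "\<mu> \<le> nM d \<Longrightarrow> sumM d = (\<Sum>j=1..\<mu>. bM d j) + (\<Sum>j=\<mu>+1..nM d. bM d j)"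
proof -
  assume "\<mu> \<le> nM d"
  then have "{1..nM d} = {1..\<mu>} \<union> {\<mu>+1..nM d}" by auto
  then show ?thesis unfolding sumM_def by (simp add: sum.union_disjoint)
qed

lemma kk_strict_mono: "strict_mono_on {1..n} (kk t)"
proof (rule strict_mono_onI)
  fix i j assume i: "i \<in> {1..n}" and j: "j \<in> {1..n}" and ij: "i < j"
  define T where "T = max t 0"
  have T: "0 \<le> T" by (simp add: T_def)
  have e: "exp (- a * T) \<le> exp (- b * T)" if "b \<le> a" for a b using that T by (simp add: mult_right_mono)
  have "(k0 i - K) * exp (- theta i * T) < (k0 j - K) * exp (- theta j * T)"
  proof -
    consider "j < N" | "j = N" | "i \<le> N" "N < j" | "N < i" using ij by linarith
    then show ?thesis
    proof cases
      case 1
      have "k0 i < k0 j" "k0 i < K" using k0_plus[of i j] k0_plus[of i N] k0_N i j ij 1 by auto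
      then have "(k0 i - K) * exp (- theta i * T) \<le> (k0 i - K) * exp (- theta j * T)"
        using theta_plus[of i j] i ij 1 by (intro mult_left_mono_neg e) auto
      also have "\<dots> < (k0 j - K) * exp (- theta j * T)" using \<open>k0 i < k0 j\<close> by simp
      finally show ?thesis .
    next
      case 2
      then have "k0 i < K" using k0_plus[of i N] k0_N i ij by auto
      then show ?thesis using 2 k0_N by (simp add: mult_neg_pos)
    next
      case 3
      then have "k0 i \<le> K" "K < k0 j" using k0_plus[of i N] k0_N i j k0_gt[of j] by (cases "i = N"; auto)+
      then have "(k0 i - K) * exp (- theta i * T) \<le> 0" "0 < (k0 j - K) * exp (- theta j * T)" by (auto intro: mult_nonpos_nonneg)
      then show ?thesis by linarith
    next
      case 4
      have "k0 i < k0 j" "K < k0 i" using k0_minus[of i j] k0_gt[of i] i j ij 4 by auto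
      then have "(k0 i - K) * exp (- theta i * T) \<le> (k0 i - K) * exp (- theta j * T)"
        using theta_minus[of i j] j ij 4 by (intro mult_left_mono e) auto
      also have "\<dots> < (k0 j - K) * exp (- theta j * T)" using \<open>k0 i < k0 j\<close> by simp
      finally show ?thesis .
    qed
  qed
  then show "kk t i < kk t j" by (simp add: kk_def T_def)
qed

lemma charges: "charges n N q (kk t)"
proof
  show "1 \<le> N" "N < n" using N2 M1 by auto
  show "strict_mono_on {1..n} (kk t)" by (rule kk_strict_mono)
  show "0 < (\<Sum>j=1..n. q j)" unfolding total using standing by (simp add: standing_assumptions_def)
  show "(\<Sum>l=i+1..n. q l) \<noteq> (\<Sum>l=j+1..n. q l)" if i: "i \<in> {1..<N}" and j: "j \<in> {N<..n}" for i j
  proof -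
    have "\<forall>\<nu>\<in>{1..N - 1}. \<forall>\<mu>\<in>{1..nM d}. (\<Sum>j=\<nu>+1..N. bP d j) \<noteq> (\<Sum>j=1..\<mu>. bM d j)"
      using standing by (simp add: standing_assumptions_def)
    moreover have "i \<in> {1..N - 1}" "j - N \<in> {1..nM d}" using i j by auto
    ultimately have "(\<Sum>j=i+1..N. bP d j) \<noteq> (\<Sum>l=1..j-N. bM d l)" by blast
    then show ?thesis
      using sum_upper_plus[of i] sum_upper_minus[of "j - N"] sumM_split[of "j - N"] i j by auto
  qed
qed (use q_plus q_minus in auto)

abbreviation "Ht t \<equiv> charges.H n q (kk t)"
abbreviation "dHt t \<equiv> charges.dH n q (kk t)"
abbreviation "ddHt t \<equiv> charges.ddH n q (kk t)"
abbreviation "St t \<equiv> charges.S n (kk t)"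
abbreviation "ct t \<equiv> charges.crit n q (kk t)"
abbreviation "tp t \<equiv> charges.tip n q (kk t)"
abbreviation "Hi t \<equiv> charges.Hinv n q (kk t)"
abbreviation "ht \<equiv> charges.height n q"
abbreviation "gp t \<equiv> charges.gap n (kk t)"
abbreviation "cu t \<equiv> charges.cuhp n (kk t)"
abbreviation "sgn' \<equiv> charges.sg N"
abbreviation "I \<equiv> {1..n} - {N}"

lemma sum_split: "(\<Sum>j=1..n. F j) = (\<Sum>j=1..N. F j) + (\<Sum>j=1..nM d. F (N + j))"
proof -
  have "{1..n} = {1..N} \<union> {N+1..n}" by auto
  then have "(\<Sum>j=1..n. F j) = (\<Sum>j=1..N. F j) + (\<Sum>j=N+1..n. F j)" by (simp add: sum.union_disjoint)
  also have "(\<Sum>j=N+1..n. F j) = (\<Sum>j=1..nM d. F (N + j))"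
    by (rule sum.reindex_bij_witness[of _ "\<lambda>j. N + j" "\<lambda>l. l - N"]) auto
  finally show ?thesis .
qed

lemma I_split: "I = {1..N - 1} \<union> (\<lambda>\<mu>. N + \<mu>) ` {1..nM d}"
proof (intro equalityI subsetI)
  fix i assume "i \<in> I"
  then show "i \<in> {1..N - 1} \<union> (\<lambda>\<mu>. N + \<mu>) ` {1..nM d}"
    by (cases "i < N") (auto intro!: image_eqI[of _ _ "i - N"])
qed (use N2 in auto)

lemma sum_I: "(\<Sum>i\<in>I. F i) = (\<Sum>\<nu>=1..N - 1. F \<nu>) + (\<Sum>\<mu>=1..nM d. F (N + \<mu>))"
proof -
  have "(\<Sum>i\<in>I. F i) = (\<Sum>\<nu>=1..N - 1. F \<nu>) + (\<Sum>i\<in>(\<lambda>\<mu>. N + \<mu>) ` {1..nM d}. F i)"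
    unfolding I_split by (rule sum.union_disjoint) auto
  also have "(\<Sum>i\<in>(\<lambda>\<mu>. N + \<mu>) ` {1..nM d}. F i) = (\<Sum>\<mu>=1..nM d. F (N + \<mu>))"
    by (subst sum.reindex) auto
  finally show ?thesis .
qed

lemma Ht_eq:
  assumes "0 \<le> t" shows "Ht t = h d t"
proof
  fix z
  interpret charges n N q "kk t" by (rule charges)
  show "Ht t z = h d t z"
    unfolding H_def h_def sum_split using assms kk_plus kk_minus
    by (simp add: q_def sum_negf)
qed

lemma St_eq:
  assumes "0 \<le> t" shows "St t = sing d t"
proof -
  interpret charges n N q "kk t" by (rule charges)
  have split: "{1..n} = {1..N} \<union> (\<lambda>j. N + j) ` {1..nM d}"
  proof (intro equalityI subsetI)
    fix i assume "i \<in> {1..n}"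
    then show "i \<in> {1..N} \<union> (\<lambda>j. N + j) ` {1..nM d}"
      by (cases "i \<le> N") (auto intro!: image_eqI[of _ _ "i - N"])
  qed auto
  have "St t = (\<lambda>j. of_real (kk t j)) ` {1..N} \<union> (\<lambda>j. of_real (kk t (N + j))) ` {1..nM d}"
    unfolding S_def split image_Un image_image ..
  also have "\<dots> = sing d t"
    unfolding sing_def using assms kk_plus kk_minus by (intro arg_cong2[where f = "(\<union>)"] image_cong) auto
  finally show ?thesis .
qed

lemma dz_eq:
  assumes "0 \<le> t" "z \<in> cu t" shows "dz (h d t) z = dHt t z"
proof -
  interpret charges n N q "kk t" by (rule charges)
  have "0 \<le> Im z" "z \<notin> sing d t" using assms St_eq by (auto simp: cuhp_def)
  from dz_h[OF this] show ?thesis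
    unfolding dH_def sum_split using assms kk_plus kk_minus by (simp add: q_def sum_negf)
qed

lemma dz_dz_eq:
  assumes "0 \<le> t" "z \<in> cu t" shows "dz (dz (h d t)) z = ddHt t z"
proof -
  interpret charges n N q "kk t" by (rule charges)
  have "0 \<le> Im z" "z \<notin> sing d t" using assms St_eq by (auto simp: cuhp_def)
  from dz_dz_h[OF this] show ?thesis
    unfolding ddH_def sum_split using assms kk_plus kk_minus by (simp add: q_def sum_negf)
qed

text \<open>
  The zeros of \<open>dz (h d t)\<close> that define \<open>rhoP\<close> and \<open>rhoM\<close> are those of \<open>g\<close>.
\<close>

lemma crit_charac:
  assumes t: "0 \<le> t" and i: "i \<in> I"
  shows "(THE x. x \<in> gp t i \<and> dz (h d t) (of_real x) = 0) = ct t i"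
proof -
  interpret charges n N q "kk t" by (rule charges)
  have "i \<le> n" using i by simp
  have dz: "dz (h d t) (of_real x) = of_real (g x)" if "x \<in> gap i" for x
    using dz_eq[OF t gap_cuhp[OF that \<open>i \<le> n\<close>]] by (simp add: dH_real)
  show ?thesis
  proof (rule the_equality)
    show "crit i \<in> gap i \<and> dz (h d t) (of_real (crit i)) = 0"
      using crit(1)[OF i] dz[OF crit(1)[OF i]] crit(2)[OF i] by simp
    fix x assume x: "x \<in> gap i \<and> dz (h d t) (of_real x) = 0"
    then have "g x = 0" using dz[of x] by simp
    then show "x = crit i" using crit(3)[OF i, of x] x by blast
  qed
qed

lemma rhoP_eq:
  assumes "0 \<le> t" "\<nu> \<in> {1..N - 1}" shows "rhoP d \<nu> t = ct t \<nu>"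
proof -
  interpret charges n N q "kk t" by (rule charges)
  have iff: "x \<in> gp t \<nu> \<longleftrightarrow> kPt d \<nu> t < x \<and> x < kPt d (\<nu> + 1) t" for x
  proof -
    have "1 \<le> \<nu>" "\<nu> < n" "kk t \<nu> = kPt d \<nu> t" "kk t (\<nu> + 1) = kPt d (\<nu> + 1) t"
      using assms kk_plus[of \<nu> t] kk_plus[of "\<nu> + 1" t] M1 by auto
    then show ?thesis by (simp only: gap_def mem_Collect_eq simp_thms)
  qed
  have "rhoP d \<nu> t = (THE x. x \<in> gp t \<nu> \<and> dz (h d t) (of_real x) = 0)"
    unfolding rhoP_def iff conj_assoc ..
  also have "\<dots> = ct t \<nu>" by (rule crit_charac[OF assms(1)]) (use assms(2) M1 in auto)
  finally show ?thesis .
qed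

lemma rhoM_eq:
  assumes "0 \<le> t" "\<mu> \<in> {1..nM d}" shows "rhoM d \<mu> t = ct t (N + \<mu>)"
proof -
  interpret charges n N q "kk t" by (rule charges)
  have iff: "x \<in> gp t (N + \<mu>) \<longleftrightarrow> kMt d \<mu> t < x \<and> (\<mu> < nM d \<longrightarrow> x < kMt d (\<mu> + 1) t)" for x
    using assms kk_minus[of \<mu> t] kk_minus[of "\<mu> + 1" t] by (auto simp: gap_def)
  have "rhoM d \<mu> t = (THE x. x \<in> gp t (N + \<mu>) \<and> dz (h d t) (of_real x) = 0)"
    unfolding rhoM_def iff conj_assoc ..
  also have "\<dots> = ct t (N + \<mu>)" by (rule crit_charac[OF assms(1)]) (use assms(2) in auto)
  finally show ?thesis .
qed

lemma height_plus: "\<nu> \<le> N \<Longrightarrow> ht \<nu> = yP d \<nu>"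
  using charges.height_def[OF charges] sum_upper_plus[of \<nu>] by (simp add: yP_def)

lemma height_minus: "\<mu> \<le> nM d \<Longrightarrow> ht (N + \<mu>) = yM d \<mu>"
  using charges.height_def[OF charges] sum_upper_minus[of \<mu>] by (simp add: yM_def)

end

context slits
begin

lemma kk_eq: "0 \<le> t \<Longrightarrow> kk t j = K + (k0 j - K) * exp (- theta j * t)"
  by (simp add: kk_def)

lemma theta_nonneg: "j \<in> {1..n} - {N} \<Longrightarrow> 0 \<le> theta j"
proof -
  assume j: "j \<in> {1..n} - {N}"
  show ?thesis
  proof (cases "j < N")
    case True
    have "theta 1 \<le> theta j" using True j by (intro theta_plus) auto
    then show ?thesis by (simp add: theta_def)
  next
    case False
    have "\<forall>j\<in>{1..nM d}. 0 < thM d j" using standing by (simp add: standing_assumptions_def)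
    moreover have "j - N \<in> {1..nM d}" "\<not> j \<le> N" using False j by auto
    ultimately show ?thesis using N2 by (auto simp: theta_def less_imp_le)
  qed
qed

lemma k0_le_K: "j \<in> {1..N} \<Longrightarrow> k0 j \<le> K"
  using k0_plus[of j N] k0_N by (cases "j = N") auto

section \<open>Motion of the critical values\<close>

text \<open>
  Reflection at \<open>k\<^sub>N\<close> makes the gap between the positive charges \<open>i\<close> and \<open>i + 1\<close> a channel in which
  the negative charges are on the other side; the gap next to \<open>k\<^sub>N\<close> has \<open>l = 0\<close>.
\<close>

lemma rate_plus:
  assumes i: "i \<in> {1..<N}"
  obtains R where "((\<lambda>t. tp t i / t) \<longlongrightarrow> R) at_top"
    "\<And>s t. 0 \<le> s \<Longrightarrow> s \<le> t \<Longrightarrow> R * (t - s) \<le> tp t i - tp s i"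
proof -
  have lt: "k0 i < k0 (i + 1)" "k0 (i + 1) \<le> K" using k0_plus[of i "i + 1"] k0_le_K[of "i + 1"] i by auto
  interpret ch: channel "{1..n}" q "\<lambda>j. K - k0 j" theta "K - k0 (i + 1)" "K - k0 i" "theta (i + 1)" "theta i"
  proof
    show "theta i \<le> theta (i + 1)" if "0 < K - k0 (i + 1)"
    proof -
      have "i + 1 \<noteq> N" using that k0_N by auto
      then show ?thesis using i by (intro theta_plus) auto
    qed
    show "K - k0 j < 0 \<and> q j \<le> 0 \<or> K - k0 j = 0 \<or> 0 < K - k0 j \<and> 0 \<le> q j \<and>
        (K - k0 j \<le> K - k0 (i + 1) \<and> theta (i + 1) \<le> theta j \<or> K - k0 i \<le> K - k0 j \<and> theta j \<le> theta i)" if j: "j \<in> {1..n}" for j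
    proof -
      consider "j \<le> i" | "i < j" "j < N" | "j = N" | "N < j" by linarith
      then show ?thesis
      proof cases
        case 1
        then have "k0 j \<le> k0 i" using k0_plus[of j i] i j by (cases "j = i") auto
        moreover have "theta j \<le> theta i" using 1 i j by (intro theta_plus) auto
        moreover have "0 < q j" using 1 i j by (intro q_plus) auto
        ultimately show ?thesis using lt by auto
      next
        case 2
        then have "k0 (i + 1) \<le> k0 j" using k0_plus[of "i + 1" j] i j by (cases "j = i + 1") auto
        moreover have "theta (i + 1) \<le> theta j" using 2 i j by (intro theta_plus) auto
        moreover have "0 < q j" using 2 i j by (intro q_plus) auto
        moreover have "k0 j < K" using k0_plus[of j N] k0_N 2 i by auto
        ultimately show ?thesis by auto
      next
        case 3 then show ?thesis by (simp add: k0_N)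
      next
        case 4 then show ?thesis using q_minus[of j] k0_gt[of j] j by auto
      qed
    qed
  qed (use lt in auto)
  have W: "x \<in> gp t i \<longleftrightarrow> K - x \<in> ch.W t" if t: "0 \<le> t" for t x
  proof -
    have "1 \<le> i" "i < n" using i by auto
    then have "x \<in> gp t i \<longleftrightarrow> kk t i < x \<and> x < kk t (i + 1)" by (simp add: charges.gap_def[OF charges])
    then show ?thesis using t unfolding ch.W_def by (auto simp: kk_eq left_diff_distrib)
  qed
  have G: "charges.RV n q (kk t) x = ch.G t (K - x)" if t: "0 \<le> t" for t x
  proof -
    have "\<bar>x - kk t j\<bar> = \<bar>K - x - (K - k0 j) * exp (- theta j * t)\<bar>" for j
    proof -
      have "K - x - (K - k0 j) * exp (- theta j * t) = - (x - kk t j)" using t by (simp add: kk_eq left_diff_distrib)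
      then show ?thesis by (simp only: abs_minus_cancel)
    qed
    then show ?thesis unfolding charges.RV_def[OF charges] ch.G_def by (simp only:)
  qed
  have iI: "i \<in> I" using i by auto
  show ?thesis
  proof (rule ch.rate[of "\<lambda>t. tp t i"])
    fix t :: real assume t: "0 \<le> t"
    interpret charges n N q "kk t" by (rule charges)
    show "\<exists>x\<in>ch.W t. tip i = ch.G t x"
      using crit(1)[OF iI] W[OF t, of "crit i"] G[OF t, of "crit i"] unfolding tip_def by blast
    show "ch.G t x \<le> tip i" if x: "x \<in> ch.W t" for x
    proof -
      have "K - x \<in> gap i" using W[OF t, of "K - x"] x by simp
      then have "RV (K - x) \<le> tip i" using RV_less_tip[OF iI, of "K - x"] i
        by (cases "K - x = crit i") (auto simp: tip_def sg_def)
      then show ?thesis using G[OF t, of "K - x"] by simp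
    qed
  qed (rule that)
qed

text \<open>
  Between negative charges no reflection is needed, but all charges change sign.
\<close>

lemma rate_minus:
  assumes i: "i \<in> {N<..<n}"
  obtains R where "((\<lambda>t. tp t i / t) \<longlongrightarrow> R) at_top"
    "\<And>s t. 0 \<le> s \<Longrightarrow> s \<le> t \<Longrightarrow> tp t i - tp s i \<le> R * (t - s)"
proof -
  have lt: "k0 i < k0 (i + 1)" "K < k0 i" using k0_minus[of i "i + 1"] k0_gt[of i] i by auto
  interpret ch: channel "{1..n}" "\<lambda>j. - q j" "\<lambda>j. k0 j - K" theta "k0 i - K" "k0 (i + 1) - K" "theta i" "theta (i + 1)"
  proof
    show "theta (i + 1) \<le> theta i" using i by (intro theta_minus) auto
    show "k0 j - K < 0 \<and> - q j \<le> 0 \<or> k0 j - K = 0 \<or> 0 < k0 j - K \<and> 0 \<le> - q j \<and>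
        (k0 j - K \<le> k0 i - K \<and> theta i \<le> theta j \<or> k0 (i + 1) - K \<le> k0 j - K \<and> theta j \<le> theta (i + 1))" if j: "j \<in> {1..n}" for j
    proof -
      consider "j < N" | "j = N" | "N < j" "j \<le> i" | "i < j" using i by force
      then show ?thesis
      proof cases
        case 1
        then have "k0 j < K" "0 < q j" using k0_plus[of j N] k0_N q_plus[of j] j by auto
        then show ?thesis by simp
      next
        case 2 then show ?thesis by (simp add: k0_N)
      next
        case 3
        then have "k0 j \<le> k0 i" using k0_minus[of j i] i j by (cases "j = i") auto
        moreover have "theta i \<le> theta j" using 3 i by (intro theta_minus) auto
        moreover have "K < k0 j" "q j < 0" using k0_gt[of j] q_minus[of j] 3 j by auto
        ultimately show ?thesis by auto
      next
        case 4
        then have "k0 (i + 1) \<le> k0 j" using k0_minus[of "i + 1" j] i j by (cases "j = i + 1") auto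
        moreover have "theta j \<le> theta (i + 1)" using 4 i j by (intro theta_minus) auto
        moreover have "K < k0 j" "q j < 0" using k0_gt[of j] q_minus[of j] 4 i j by auto
        ultimately show ?thesis by auto
      qed
    qed
  qed (use lt in auto)
  have W: "x \<in> gp t i \<longleftrightarrow> x - K \<in> ch.W t" if t: "0 \<le> t" for t x
  proof -
    have "1 \<le> i" "i < n" using i by auto
    then have "x \<in> gp t i \<longleftrightarrow> kk t i < x \<and> x < kk t (i + 1)" by (simp add: charges.gap_def[OF charges])
    then show ?thesis using t unfolding ch.W_def by (auto simp: kk_eq)
  qed
  have G: "- charges.RV n q (kk t) x = ch.G t (x - K)" if t: "0 \<le> t" for t x
  proof -
    have eq: "x - kk t j = x - K - (k0 j - K) * exp (- theta j * t)" for j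
      using t by (simp add: kk_eq)
    show ?thesis unfolding charges.RV_def[OF charges] ch.G_def eq by (simp add: sum_negf)
  qed
  have iI: "i \<in> I" using i by auto
  show ?thesis
  proof (rule ch.rate[of "\<lambda>t. - tp t i"])
    fix t :: real assume t: "0 \<le> t"
    interpret charges n N q "kk t" by (rule charges)
    show "\<exists>x\<in>ch.W t. - tip i = ch.G t x"
      using crit(1)[OF iI] W[OF t, of "crit i"] G[OF t, of "crit i"] unfolding tip_def by blast
    show "ch.G t x \<le> - tip i" if x: "x \<in> ch.W t" for x
    proof -
      have "K + x \<in> gap i" using W[OF t, of "K + x"] x by simp
      then have "tip i \<le> RV (K + x)" using RV_less_tip[OF iI, of "K + x"] i
        by (cases "K + x = crit i") (auto simp: tip_def sg_def)
      then show ?thesis using G[OF t, of "K + x"] by simp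
    qed
  next
    fix R assume R: "((\<lambda>t. - tp t i / t) \<longlongrightarrow> R) at_top"
      "\<And>s t. 0 \<le> s \<Longrightarrow> s \<le> t \<Longrightarrow> R * (t - s) \<le> - tp t i - - tp s i"
    show thesis
    proof (rule that[of "- R"])
      show "((\<lambda>t. tp t i / t) \<longlongrightarrow> - R) at_top" using tendsto_minus[OF R(1)] by simp
      show "tp t i - tp s i \<le> - R * (t - s)" if "0 \<le> s" "s \<le> t" for s t using R(2)[OF that] by simp
    qed
  qed
qed

text \<open>
  At a fixed point to the right of all charges no term of the potential increases in time: the
  positive charges come closer or rest, the negative ones recede. The tip is a minimum over such
  points.
\<close>

lemma tip_last_decreasing:
  assumes st: "0 \<le> s" "s \<le> t"
  shows "tp t n \<le> tp s n"
proof -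
  have nI: "n \<in> I" using N2 M1 by auto
  interpret s: charges n N q "kk s" by (rule charges)
  interpret t: charges n N q "kk t" by (rule charges)
  define x where "x = ct s n"
  have e: "exp (- theta j * t) \<le> exp (- theta j * s)" if "j \<in> I" for j
    using theta_nonneg[OF that] st by (simp add: mult_left_mono)
  have minus: "kk t j \<le> kk s j" if j: "j \<in> {N<..n}" for j
    using k0_gt[OF j] e[of j] j st by (simp add: kk_eq mult_left_mono)
  have plus: "kk s j \<le> kk t j" "kk t j \<le> K" if j: "j \<in> {1..N}" for j
  proof -
    show "kk s j \<le> kk t j"
    proof (cases "j = N")
      case False
      then show ?thesis using k0_le_K[OF j] e[of j] j st by (simp add: kk_eq mult_left_mono_neg)
    qed (use st k0_N in \<open>simp add: kk_eq\<close>)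
    show "kk t j \<le> K" using k0_le_K[OF j] st by (simp add: kk_eq mult_nonpos_nonneg)
  qed
  have x: "kk s n < x" using s.crit(1)[OF nI] N2 unfolding x_def s.gap_def by auto
  have Kn: "K < kk s n" using k0_gt[of n] N2 M1 st by (simp add: kk_eq)
  have xs: "kk s j < x" if "j \<in> {1..n}" for j using s.k_le[of j n] that x by force
  have xt: "kk t j < x" if j: "j \<in> {1..n}" for j
    using plus(2)[of j] minus[of j] xs[OF j] Kn x j by (cases "j \<le> N") force+
  have "t.RV x \<le> s.RV x"
    unfolding t.RV_def s.RV_def
  proof (rule sum_mono)
    fix j assume j: "j \<in> {1..n}"
    show "q j * ln \<bar>x - kk t j\<bar> \<le> q j * ln \<bar>x - kk s j\<bar>"
    proof (cases "j \<le> N")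
      case True
      then show ?thesis using plus(1)[of j] xs[OF j] xt[OF j] q_plus[of j] j by (intro mult_left_mono) auto
    next
      case False
      then show ?thesis using minus[of j] xs[OF j] xt[OF j] q_minus[of j] j by (intro mult_left_mono_neg) auto
    qed
  qed
  also have "\<dots> = tp s n" by (simp add: s.tip_def x_def)
  finally have 1: "t.RV x \<le> tp s n" .
  have "x \<in> gp t n" using xt[of n] N2 by (auto simp: t.gap_def)
  then have "tp t n \<le> t.RV x"
    using t.RV_less_tip[OF nI, of x] N2 M1 by (cases "x = ct t n") (auto simp: t.tip_def t.sg_def)
  then show ?thesis using 1 by simp
qed

lemma isCont_kk: "isCont (\<lambda>t. kk t j) t0"
  unfolding kk_def by (intro continuous_intros)

text \<open>
  The sign of \<open>g\<close> at two points close to the critical point and on either side of it does not change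
  for nearby times.
\<close>

lemma isCont_crit:
  assumes i: "i \<in> I"
  shows "isCont (\<lambda>t. ct t i) t0"
  unfolding isCont_def
proof (rule tendstoI)
  fix \<epsilon> :: real assume \<epsilon>: "0 < \<epsilon>"
  interpret c0: charges n N q "kk t0" by (rule charges)
  define c where "c = ct t0 i"
  have c: "c \<in> gp t0 i" unfolding c_def by (rule c0.crit(1)[OF i])
  have c': "kk t0 i < c" "i < n \<longrightarrow> c < kk t0 (i + 1)" using c i unfolding c0.gap_def by auto
  define m where "m = min \<epsilon> (min (c - kk t0 i) (if i < n then kk t0 (i + 1) - c else 1))"
  have m: "0 < m" "m \<le> \<epsilon>" "m \<le> c - kk t0 i" "i < n \<Longrightarrow> m \<le> kk t0 (i + 1) - c"
    using c' \<epsilon> by (auto simp: m_def)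
  define \<delta> where "\<delta> = m / 2"
  have "0 < \<delta>" "\<delta> < m" using m(1) by (auto simp: \<delta>_def)
  then have \<delta>: "0 < \<delta>" "\<delta> < \<epsilon>" "kk t0 i < c - \<delta>" "i < n \<Longrightarrow> c + \<delta> < kk t0 (i + 1)"
    using m by auto
  have ab: "c - \<delta> \<in> gp t0 i" "c + \<delta> \<in> gp t0 i" using \<delta> by (auto simp: c0.gap_def)
  have gcont: "((\<lambda>t. charges.sg N i * charges.g n q (kk t) x) \<longlongrightarrow> charges.sg N i * charges.g n q (kk t0) x) (at t0)" if x: "x \<in> gp t0 i" for x
  proof -
    have "((\<lambda>t. q j / (x - kk t j)) \<longlongrightarrow> q j / (x - kk t0 j)) (at t0)" if "j \<in> {1..n}" for j
      using c0.gap_less_iff(2)[OF x _ that] i isCont_kk[where j = j and ?t0.0 = t0]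
      by (intro tendsto_intros) (auto simp: isCont_def)
    then have "((\<lambda>t. \<Sum>j=1..n. q j / (x - kk t j)) \<longlongrightarrow> (\<Sum>j=1..n. q j / (x - kk t0 j))) (at t0)"
      by (intro tendsto_sum)
    then show ?thesis by (auto simp: charges.g_def[OF charges] intro: tendsto_mult_left)
  qed
  have s1: "0 < charges.sg N i * charges.g n q (kk t0) (c - \<delta>)" using c0.g_sign(1)[OF i ab(1)] \<delta>(1) by (simp add: c_def)
  have s2: "charges.sg N i * charges.g n q (kk t0) (c + \<delta>) < 0" using c0.g_sign(2)[OF i ab(2)] \<delta>(1) by (simp add: c_def)
  have e1: "\<forall>\<^sub>F t in at t0. 0 < charges.sg N i * charges.g n q (kk t) (c - \<delta>)" by (rule order_tendstoD(1)[OF gcont[OF ab(1)] s1])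
  have e2: "\<forall>\<^sub>F t in at t0. charges.sg N i * charges.g n q (kk t) (c + \<delta>) < 0" by (rule order_tendstoD(2)[OF gcont[OF ab(2)] s2])
  have e3: "\<forall>\<^sub>F t in at t0. kk t i < c - \<delta>"
    by (rule order_tendstoD(2)[OF isCont_kk[unfolded isCont_def] \<delta>(3)])
  have e4: "\<forall>\<^sub>F t in at t0. i < n \<longrightarrow> c + \<delta> < kk t (i + 1)"
  proof (cases "i < n")
    case True
    have "\<forall>\<^sub>F t in at t0. c + \<delta> < kk t (i + 1)"
      by (rule order_tendstoD(1)[OF isCont_kk[unfolded isCont_def] \<delta>(4)[OF True]])
    then show ?thesis by eventually_elim simp
  qed simp
  show "\<forall>\<^sub>F t in at t0. dist (ct t i) (ct t0 i) < \<epsilon>"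
    using e1 e2 e3 e4
  proof eventually_elim
    case (elim t)
    interpret charges n N q "kk t" by (rule charges)
    have ab: "c - \<delta> \<in> gap i" "c + \<delta> \<in> gap i" using elim \<delta>(1) by (auto simp: gap_def)
    have "\<not> crit i < c - \<delta>" "crit i \<noteq> c - \<delta>" using g_sign(2)[OF i ab(1)] crit(2)[OF i] elim by auto
    moreover have "\<not> c + \<delta> < crit i" "crit i \<noteq> c + \<delta>" using g_sign(1)[OF i ab(2)] crit(2)[OF i] elim by auto
    ultimately have "\<bar>crit i - c\<bar> < \<epsilon>" using \<delta> by (auto simp: abs_if)
    then show ?case by (simp add: dist_real_def c_def)
  qed
qed

lemma isCont_tip:
  assumes i: "i \<in> I"
  shows "isCont (\<lambda>t. tp t i) t0"
proof -
  have "isCont (\<lambda>t. q j * ln \<bar>ct t i - kk t j\<bar>) t0" if j: "j \<in> {1..n}" for j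
  proof -
    interpret c0: charges n N q "kk t0" by (rule charges)
    have "ct t0 i - kk t0 j \<noteq> 0" using c0.gap_less_iff(2)[OF c0.crit(1)[OF i] _ j] i by auto
    then show ?thesis by (intro continuous_intros isCont_crit[OF i] isCont_kk) auto
  qed
  then have "isCont (\<lambda>t. \<Sum>j=1..n. q j * ln \<bar>ct t i - kk t j\<bar>) t0" by (intro continuous_sum)
  then show ?thesis by (simp add: charges.tip_def[OF charges] charges.RV_def[OF charges])
qed

lemma h_crit:
  assumes "0 \<le> t" "i \<in> I"
  shows "h d t (of_real (ct t i)) = Complex (tp t i) (ht i)"
proof -
  interpret charges n N q "kk t" by (rule charges)
  show ?thesis using H_of_real[OF crit(1)[OF assms(2)]] assms by (simp add: Ht_eq tip_def)
qed

end

section \<open>Growth of the slits\<close>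

locale slit_flow = slits +
  fixes \<gamma> :: real
  assumes \<gamma>_pos: "0 < \<gamma>"
    and rate_M: "\<And>\<mu>. \<mu> \<in> {1..nM d - 1} \<Longrightarrow> rateM d \<mu> < \<gamma>"
    and rate_P: "\<And>\<nu>. \<nu> \<in> {1..nP d - 1} \<Longrightarrow> \<gamma> < rateP d \<nu>"
begin

text \<open>
  The real part of the \<open>i\<close>-th tip of \<open>h\<^sub>t(\<bbbH>) - \<gamma>t\<close>, oriented so that it increases when the slit
  grows.
\<close>

definition tip_pos :: "nat \<Rightarrow> real \<Rightarrow> real" where
  "tip_pos i t = sgn' i * (tp t i - \<gamma> * t)"

lemma tip_progress:
  assumes i: "i \<in> I"
  obtains c where "0 < c" "\<And>s t. 0 \<le> s \<Longrightarrow> s \<le> t \<Longrightarrow> c * (t - s) \<le> tip_pos i t - tip_pos i s"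
proof -
  have sg: "sgn' i = (if i < N then 1 else - 1)" by (rule charges.sg_def[OF charges])
  consider "i \<in> {1..<N}" | "i \<in> {N<..<n}" | "i = n" "N < n" using i N2 M1 by force
  then show ?thesis
  proof cases
    case 1
    obtain R where R: "((\<lambda>t. tp t i / t) \<longlongrightarrow> R) at_top"
      "\<And>s t. 0 \<le> s \<Longrightarrow> s \<le> t \<Longrightarrow> R * (t - s) \<le> tp t i - tp s i" using rate_plus[OF 1] by blast
    have i': "i \<in> {1..N - 1}" using 1 by auto
    have "\<forall>\<^sub>F t in at_top. tp t i / t = 1 / t * Re (h d t (of_real (rhoP d i t)))"
      using eventually_ge_at_top[of 0] by eventually_elim (simp add: rhoP_eq[OF _ i'] h_crit[OF _ i])
    then have "((\<lambda>t. 1 / t * Re (h d t (of_real (rhoP d i t)))) \<longlongrightarrow> R) at_top"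
      by (rule Lim_transform_eventually[OF R(1)])
    then have "rateP d i = R" unfolding rateP_def by (intro tendsto_Lim) auto
    then have "\<gamma> < R" using rate_P[OF i'] by simp
    then show ?thesis using R(2) 1 by (intro that[of "R - \<gamma>"]) (auto simp: tip_pos_def sg algebra_simps)
  next
    case 2
    obtain R where R: "((\<lambda>t. tp t i / t) \<longlongrightarrow> R) at_top"
      "\<And>s t. 0 \<le> s \<Longrightarrow> s \<le> t \<Longrightarrow> tp t i - tp s i \<le> R * (t - s)" using rate_minus[OF 2] by blast
    have i': "i - N \<in> {1..nM d - 1}" "i - N \<in> {1..nM d}" "N + (i - N) = i" using 2 by auto
    have "\<forall>\<^sub>F t in at_top. tp t i / t = 1 / t * Re (h d t (of_real (rhoM d (i - N) t)))"
      using eventually_ge_at_top[of 0] by eventually_elim (simp add: rhoM_eq[OF _ i'(2)] i'(3) h_crit[OF _ i])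
    then have "((\<lambda>t. 1 / t * Re (h d t (of_real (rhoM d (i - N) t)))) \<longlongrightarrow> R) at_top"
      by (rule Lim_transform_eventually[OF R(1)])
    then have "rateM d (i - N) = R" unfolding rateM_def by (intro tendsto_Lim) auto
    then have "R < \<gamma>" using rate_M[OF i'(1)] by simp
    then show ?thesis using R(2) 2 by (intro that[of "\<gamma> - R"]) (auto simp: tip_pos_def sg algebra_simps)
  next
    case 3
    have dec: "tp t i \<le> tp s i" if "0 \<le> s" "s \<le> t" for s t using tip_last_decreasing[OF that] 3(1) by simp
    have sgi: "sgn' i = - 1" using sg 3 by simp
    show ?thesis
      by (rule that[of \<gamma>]) (use dec \<gamma>_pos in \<open>auto simp: tip_pos_def sgi algebra_simps\<close>)
  qed
qed

lemma tip_pos_strict: "i \<in> I \<Longrightarrow> 0 \<le> s \<Longrightarrow> s < t \<Longrightarrow> tip_pos i s < tip_pos i t"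
proof -
  assume i: "i \<in> I" and st: "0 \<le> s" "s < t"
  obtain c where c: "0 < c" "c * (t - s) \<le> tip_pos i t - tip_pos i s" using tip_progress[OF i] st by (metis less_imp_le)
  then have "0 < c * (t - s)" using st by simp
  then show ?thesis using c by linarith
qed

lemma tip_pos_mono: "i \<in> I \<Longrightarrow> 0 \<le> s \<Longrightarrow> s \<le> t \<Longrightarrow> tip_pos i s \<le> tip_pos i t"
  using tip_pos_strict[of i s t] by (cases "s = t") auto

lemma tip_pos_at_top: "i \<in> I \<Longrightarrow> filterlim (tip_pos i) at_top at_top"
proof -
  assume i: "i \<in> I"
  obtain c where c: "0 < c" "\<And>s t. 0 \<le> s \<Longrightarrow> s \<le> t \<Longrightarrow> c * (t - s) \<le> tip_pos i t - tip_pos i s" using tip_progress[OF i] by blast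
  have "filterlim (\<lambda>t. tip_pos i 0 + c * t) at_top at_top"
    by (intro filterlim_tendsto_add_at_top[OF tendsto_const] filterlim_tendsto_pos_mult_at_top[OF tendsto_const c(1)] filterlim_ident)
  moreover have "\<forall>\<^sub>F t in at_top. tip_pos i 0 + c * t \<le> tip_pos i t"
    using eventually_ge_at_top[of 0] by eventually_elim (use c(2)[of 0] in force)
  ultimately show ?thesis by (rule filterlim_at_top_mono)
qed

lemma isCont_tip_pos: "i \<in> I \<Longrightarrow> isCont (tip_pos i) t"
  unfolding tip_pos_def by (intro continuous_intros isCont_tip)

text \<open>
  The \<open>i\<close>-th tip of \<open>h\<^sub>t(\<bbbH>) - \<gamma>t\<close>.
\<close>

definition tip_h :: "nat \<Rightarrow> real \<Rightarrow> complex" where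
  "tip_h i t = Complex (sgn' i * tip_pos i t) (ht i)"

lemma sg_sq: "sgn' i * (sgn' i * x) = x"
  by (simp add: charges.sg_def[OF charges])

lemma tip_h_eq: "0 \<le> t \<Longrightarrow> i \<in> I \<Longrightarrow> h d t (of_real (ct t i)) - of_real (\<gamma> * t) = tip_h i t"
  by (simp add: h_crit tip_h_def tip_pos_def sg_sq complex_eq_iff)

definition shifted_image :: "real \<Rightarrow> complex set" where
  "shifted_image t = {v. v + of_real (\<gamma> * t) \<in> Ht t ` uhp}"

lemma shifted_image_iff:
  assumes "0 \<le> t"
  shows "v' \<in> shifted_image t \<longleftrightarrow> ht N < Im v' \<and> Im v' < ht 0 \<and> (\<forall>i\<in>I. Im v' = ht i \<longrightarrow> tip_pos i t < sgn' i * Re v')"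
proof -
  interpret charges n N q "kk t" by (rule charges)
  have "sg i * tip i < sg i * (Re v' + \<gamma> * t) \<longleftrightarrow> tip_pos i t < sg i * Re v'" for i
    by (auto simp: tip_pos_def algebra_simps)
  then show ?thesis unfolding shifted_image_def image_H free_def by simp
qed

lemma shifted_image_0: "shifted_image 0 = Ht 0 ` uhp"
  by (simp add: shifted_image_def)

lemma shifted_image_mono: "0 \<le> s \<Longrightarrow> s \<le> t \<Longrightarrow> shifted_image t \<subseteq> shifted_image s"
proof
  fix v' assume st: "0 \<le> s" "s \<le> t" and v': "v' \<in> shifted_image t"
  have "0 \<le> t" using st by simp
  from v'[unfolded shifted_image_iff[OF this]] show "v' \<in> shifted_image s"
    unfolding shifted_image_iff[OF st(1)] using tip_pos_mono[OF _ st] by (meson le_less_trans)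
qed

lemma tip_h_in_shifted_image_0: "i \<in> I \<Longrightarrow> 0 < t \<Longrightarrow> tip_h i t \<in> shifted_image 0"
proof -
  assume i: "i \<in> I" and t: "0 < t"
  interpret charges n N q "kk 0" by (rule charges)
  have "tip_pos j 0 < sgn' j * Re (tip_h i t)" if j: "j \<in> I" "Im (tip_h i t) = ht j" for j
  proof -
    have "j = i" using inj_height i j by (auto simp: tip_h_def dest!: inj_onD)
    then show ?thesis using tip_pos_strict[OF i order_refl t] by (simp add: tip_h_def sg_sq)
  qed
  then show ?thesis using height_bounds[OF i] by (simp add: shifted_image_iff tip_h_def)
qed

text \<open>
  Between the times \<open>0\<close> and \<open>t\<close> each slit of the image grows by a horizontal segment, swept out by
  its tip.
\<close>

lemma shifted_image_diff:
  assumes t: "0 \<le> t"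
  shows "shifted_image 0 - shifted_image t = (\<Union>i\<in>I. tip_h i ` {0<..t})"
proof (intro equalityI subsetI)
  fix v assume v: "v \<in> shifted_image 0 - shifted_image t"
  then obtain i where i: "i \<in> I" "Im v = ht i" "sgn' i * Re v \<le> tip_pos i t" by (force simp: shifted_image_iff t)
  have "tip_pos i 0 < sgn' i * Re v" using v i by (auto simp: shifted_image_iff)
  then have lo: "tip_pos i 0 \<le> sgn' i * Re v" by simp
  obtain s where s: "0 \<le> s" "s \<le> t" "tip_pos i s = sgn' i * Re v"
    using IVT'[of "tip_pos i" 0 "sgn' i * Re v" t] lo i(3) t isCont_tip_pos[OF i(1)]
    by (meson continuous_at_imp_continuous_on)
  have "s \<noteq> 0" using s \<open>tip_pos i 0 < sgn' i * Re v\<close> by auto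
  moreover have "tip_h i s = v" using s(3) i(2) by (simp add: tip_h_def sg_sq complex_eq_iff)
  ultimately show "v \<in> (\<Union>i\<in>I. tip_h i ` {0<..t})" using i(1) s by force
next
  fix v assume "v \<in> (\<Union>i\<in>I. tip_h i ` {0<..t})"
  then obtain i s where i: "i \<in> I" and "s \<in> {0<..t}" "v = tip_h i s" by blast
  then have s: "0 < s" "s \<le> t" "v = tip_h i s" by auto
  have "\<not> tip_pos i t < sgn' i * Re v" using tip_pos_mono[OF i _ s(2)] s by (simp add: tip_h_def sg_sq)
  then have "v \<notin> shifted_image t" using i s by (auto simp: shifted_image_iff t tip_h_def)
  then show "v \<in> shifted_image 0 - shifted_image t" using tip_h_in_shifted_image_0[OF i s(1)] s by simp
qed

text \<open>
  \<open>GammaP\<close> and \<open>GammaM\<close> in the common numbering of the critical points.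
\<close>

definition Gam :: "nat \<Rightarrow> real \<Rightarrow> complex" where
  "Gam i t = (if t = 0 then of_real (ct 0 i) else Hi 0 (tip_h i t))"

lemma Hi_0: "Hi 0 = h_inv d"
proof -
  interpret charges n N q "kk 0" by (rule charges)
  show ?thesis by (simp add: Hinv_def h_inv_def Ht_eq)
qed

lemma GammaP_eq:
  assumes "\<nu> \<in> {1..N - 1}" "0 \<le> t"
  shows "GammaP d \<gamma> \<nu> t = Gam \<nu> t"
proof -
  have "\<nu> \<in> I" using assms by auto
  from tip_h_eq[OF assms(2) this] show ?thesis
    unfolding GammaP_def Gam_def rhoP_eq[OF assms(2,1)] Hi_0 using rhoP_eq[OF order_refl assms(1)] by simp
qed

lemma GammaM_eq: "\<mu> \<in> {1..nM d} \<Longrightarrow> 0 \<le> t \<Longrightarrow> GammaM d \<gamma> \<mu> t = Gam (N + \<mu>) t"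
  using tip_h_eq[of t "N + \<mu>"] by (auto simp: GammaM_def Gam_def rhoM_eq Hi_0 simp del: of_real_mult)

lemma Gam_uhp: "i \<in> I \<Longrightarrow> 0 < t \<Longrightarrow> Gam i t \<in> uhp"
  using charges.Hinv_in_uhp[OF charges] tip_h_in_shifted_image_0 by (simp add: Gam_def shifted_image_0)

lemma H_Gam: "i \<in> I \<Longrightarrow> 0 < t \<Longrightarrow> Ht 0 (Gam i t) = tip_h i t"
  using charges.H_Hinv[OF charges] tip_h_in_shifted_image_0 by (simp add: Gam_def shifted_image_0)

lemma isCont_tip_h: "i \<in> I \<Longrightarrow> isCont (tip_h i) t"
proof -
  assume i: "i \<in> I"
  have "tip_h i = (\<lambda>t. of_real (sgn' i * tip_pos i t) + \<i> * of_real (ht i))"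
    by (simp add: tip_h_def complex_eq_iff fun_eq_iff)
  then show ?thesis by (simp only:) (intro continuous_intros isCont_tip_pos[OF i])
qed

lemma continuous_Gam:
  assumes i: "i \<in> I"
  shows "continuous_on {0..} (Gam i)"
  unfolding continuous_on_eq_continuous_within
proof
  fix t0 :: real assume t0: "t0 \<in> {0..}"
  interpret charges n N q "kk 0" by (rule charges)
  show "continuous (at t0 within {0..}) (Gam i)"
  proof (cases "t0 = 0")
    case True
    have "((\<lambda>t. Hi 0 (tip_h i t)) \<longlongrightarrow> of_real (crit i)) (at 0 within {0..})"
    proof (rule Hinv_tendsto_crit[OF _ i])
      show "\<forall>\<^sub>F t in at 0 within {0..}. tip_h i t \<in> H ` uhp"
        unfolding eventually_at_filter using tip_h_in_shifted_image_0[OF i] shifted_image_0 by (intro always_eventually) auto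
      have "(tip_h i \<longlongrightarrow> tip_h i 0) (at 0 within {0..})"
        using continuous_at_imp_continuous_at_within[OF isCont_tip_h[OF i]] by (simp add: continuous_within)
      moreover have "tip_h i 0 = H (of_real (crit i))" using tip_h_eq[of 0 i] i Ht_eq by simp
      ultimately show "(tip_h i \<longlongrightarrow> H (of_real (crit i))) (at 0 within {0..})" by simp
    qed
    then have "(Gam i \<longlongrightarrow> of_real (crit i)) (at 0 within {0..})"
      by (rule Lim_transform_eventually) (auto simp: eventually_at_filter Gam_def)
    then show ?thesis using True by (simp add: continuous_within Gam_def)
  next
    case False
    then have t: "0 < t0" using t0 by simp
    have "isCont (\<lambda>t. Hi 0 (tip_h i t)) t0"
      by (rule isCont_o2[OF isCont_tip_h[OF i]]) (use has_field_derivative_Hinv tip_h_in_shifted_image_0[OF i t] shifted_image_0 DERIV_isCont in blast)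
    moreover have "\<forall>\<^sub>F t in nhds t0. t \<in> {0<..}" by (rule eventually_nhds_in_open) (use t in auto)
    then have "\<forall>\<^sub>F t in nhds t0. Hi 0 (tip_h i t) = Gam i t" by eventually_elim (simp add: Gam_def)
    ultimately have "isCont (Gam i) t0" by (simp add: isCont_cong)
    then show ?thesis by (rule continuous_at_imp_continuous_at_within)
  qed
qed

lemma Gam_inj:
  assumes i: "i \<in> I" and j: "j \<in> I" and st: "0 \<le> s" "0 \<le> t" and eq: "Gam i s = Gam j t"
  shows "i = j \<and> s = t"
proof -
  interpret charges n N q "kk 0" by (rule charges)
  have real: "Im (Gam l 0) = 0" for l by (simp add: Gam_def)
  show ?thesis
  proof (cases "s = 0 \<or> t = 0")
    case True
    have im: "Im (Gam l r) = 0 \<longleftrightarrow> r = 0" if "l \<in> I" "0 \<le> r" for l r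
      using Gam_uhp[OF that(1), of r] real that(2) by (cases "r = 0") (auto simp: uhp_def)
    have "s = 0 \<and> t = 0" using True im[OF i st(1)] im[OF j st(2)] eq by auto
    moreover from this have "i = j" using eq inj_crit i j by (auto simp: Gam_def dest: inj_onD)
    ultimately show ?thesis by simp
  next
    case False
    then have "tip_h i s = tip_h j t" using H_Gam[OF i, of s] H_Gam[OF j, of t] eq st by simp
    then have e: "sgn' i * tip_pos i s = sgn' j * tip_pos j t" "ht i = ht j" by (auto simp: tip_h_def)
    have ij: "i = j" by (rule inj_onD[OF inj_height e(2)]) (use i j in auto)
    then have "tip_pos i s = tip_pos i t" using e(1) by (simp add: sg_def split: if_splits)
    then have "s = t" using tip_pos_strict[OF i, of s t] tip_pos_strict[OF i, of t s] st by (cases s t rule: linorder_cases) auto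
    then show ?thesis using ij by simp
  qed
qed

lemma slit_Gam:
  assumes i: "i \<in> I" and t: "0 < t"
  shows "slit (\<lambda>s. Gam i (s * t))"
  unfolding slit_def arc_def path_def pathstart_def
proof (intro conjI)
  show "continuous_on {0..1} (\<lambda>s. Gam i (s * t))"
    by (rule continuous_on_compose2[OF continuous_Gam[OF i]]) (use t in \<open>auto intro!: continuous_intros\<close>)
  show "inj_on (\<lambda>s. Gam i (s * t)) {0..1}"
  proof (rule inj_onI)
    fix s s' assume "s \<in> {0..1}" "s' \<in> {0..1}" "Gam i (s * t) = Gam i (s' * t)"
    then have "s * t = s' * t" using Gam_inj[OF i i, of "s * t" "s' * t"] t by simp
    then show "s = s'" using t by simp
  qed
  show "Im (Gam i (0 * t)) = 0" by (simp add: Gam_def)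
  show "(\<lambda>s. Gam i (s * t)) ` {0<..1} \<subseteq> uhp" using Gam_uhp[OF i] t by auto
qed

lemma Gam_tendsto_plus:
  assumes i: "i \<in> {1..<N}" and j: "j \<in> {N<..n}" and y: "ht (j - 1) < ht i" "ht i < ht j"
  shows "(Gam i \<longlongrightarrow> of_real (k0 j)) at_top"
proof -
  interpret charges n N q "kk 0" by (rule charges)
  have iI: "i \<in> I" using i by auto
  have "((\<lambda>t. Hi 0 (tip_h i t)) \<longlongrightarrow> of_real (kk 0 j)) at_top"
  proof (rule Hinv_tendsto_right[OF _ _ _ j y])
    show "\<forall>\<^sub>F t in at_top. tip_h i t \<in> H ` uhp"
      using eventually_gt_at_top[of 0] by eventually_elim (use tip_h_in_shifted_image_0[OF iI] shifted_image_0 in auto)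
    show "filterlim (\<lambda>t. Re (tip_h i t)) at_top at_top" using tip_pos_at_top[OF iI] i by (simp add: tip_h_def sg_def)
  qed (simp add: tip_h_def)
  moreover have "\<forall>\<^sub>F t in at_top. Hi 0 (tip_h i t) = Gam i t"
    using eventually_gt_at_top[of 0] by eventually_elim (simp add: Gam_def)
  ultimately have "(Gam i \<longlongrightarrow> of_real (kk 0 j)) at_top" by (rule Lim_transform_eventually)
  then show ?thesis by (simp add: kk_0)
qed

lemma Gam_tendsto_minus:
  assumes i: "i \<in> {N<..n}" and j: "j \<in> {1..N}" and y: "ht j < ht i" "ht i < ht (j - 1)"
  shows "(Gam i \<longlongrightarrow> of_real (k0 j)) at_top"
proof -
  interpret charges n N q "kk 0" by (rule charges)
  have iI: "i \<in> I" using i by auto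
  have "((\<lambda>t. Hi 0 (tip_h i t)) \<longlongrightarrow> of_real (kk 0 j)) at_top"
  proof (rule Hinv_tendsto_left[OF _ _ _ j y])
    show "\<forall>\<^sub>F t in at_top. tip_h i t \<in> H ` uhp"
      using eventually_gt_at_top[of 0] by eventually_elim (use tip_h_in_shifted_image_0[OF iI] shifted_image_0 in auto)
    show "filterlim (\<lambda>t. Re (tip_h i t)) at_bot at_top"
      using tip_pos_at_top[OF iI] i by (simp add: tip_h_def sg_def filterlim_uminus_at_top)
  qed (simp add: tip_h_def)
  moreover have "\<forall>\<^sub>F t in at_top. Hi 0 (tip_h i t) = Gam i t"
    using eventually_gt_at_top[of 0] by eventually_elim (simp add: Gam_def)
  ultimately have "(Gam i \<longlongrightarrow> of_real (kk 0 j)) at_top" by (rule Lim_transform_eventually)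
  then show ?thesis by (simp add: kk_0)
qed

end

section \<open>Normalization at infinity\<close>

abbreviation at_inf_uhp :: "complex filter" where
  "at_inf_uhp \<equiv> inf at_infinity (principal uhp)"

lemma at_inf_uhp_uhp: "\<forall>\<^sub>F z in at_inf_uhp. z \<in> uhp"
  by (simp add: eventually_inf_principal)

lemma at_inf_uhp_le: "at_inf_uhp \<le> at_infinity" by simp

lemma ident_at_inf_uhp: "filterlim (\<lambda>z. z) at_infinity at_inf_uhp"
  by (simp add: filterlim_def filtermap_ident)

lemma filterlim_affine_at_inf_uhp:
  fixes a b :: real assumes "0 < a"
  shows "filterlim (\<lambda>z. (z - of_real b) / of_real a) at_inf_uhp at_inf_uhp"
  unfolding filterlim_inf filterlim_principal
proof
  have 1: "filterlim (\<lambda>z::complex. z - of_real b) at_infinity at_inf_uhp"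
    using tendsto_add_filterlim_at_infinity'[OF ident_at_inf_uhp tendsto_const, of "- of_real b"] by simp
  have "filterlim (\<lambda>z::complex. of_real (1 / a) * (z - of_real b)) at_infinity at_inf_uhp"
    by (rule tendsto_mult_filterlim_at_infinity[OF tendsto_const _ 1]) (use assms in auto)
  then show "filterlim (\<lambda>z::complex. (z - of_real b) / of_real a) at_infinity at_inf_uhp"
    by (simp add: field_simps)
  show "\<forall>\<^sub>F z in at_inf_uhp. (z - of_real b) / of_real a \<in> uhp"
    using at_inf_uhp_uhp by eventually_elim (use assms in \<open>auto simp: uhp_def\<close>)
qed

lemma imag_axis_at_inf_uhp: "filterlim (\<lambda>y. \<i> * of_real y) at_inf_uhp at_top"
  unfolding filterlim_inf filterlim_principal
proof
  have "filterlim (\<lambda>y::real. norm (\<i> * of_real y)) at_top at_top"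
    by (simp add: norm_mult filterlim_abs_real)
  then show "filterlim (\<lambda>y. \<i> * of_real y) at_infinity at_top"
    by (rule filterlim_norm_at_top_imp_at_infinity)
  show "\<forall>\<^sub>F y in at_top. \<i> * of_real y \<in> uhp"
    using eventually_gt_at_top[of 0] by eventually_elim (simp add: uhp_def)
qed

lemma bigo_inverse_tendsto_0:
  fixes f :: "complex \<Rightarrow> complex"
  assumes "f \<in> O[at_inf_uhp](\<lambda>z. 1 / z)"
  shows "(f \<longlongrightarrow> 0) at_inf_uhp"
proof -
  obtain C where C: "\<forall>\<^sub>F z in at_inf_uhp. cmod (f z) \<le> C * cmod (1 / z)" by (rule landau_o.bigE[OF assms]) (rule that)
  have "((\<lambda>z::complex. 1 / z) \<longlongrightarrow> 0) at_inf_uhp" by (rule tendsto_divide_0[OF tendsto_const ident_at_inf_uhp])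
  then have "((\<lambda>z. C * cmod (1 / z)) \<longlongrightarrow> 0) at_inf_uhp" using tendsto_mult_right_zero[OF tendsto_norm_zero] by blast
  then show ?thesis by (rule Lim_null_comparison[OF C])
qed

text \<open>
  The difference of two such expansions is an affine function that tends to \<open>0\<close> along the imaginary
  axis.
\<close>

lemma expansion_unique:
  assumes "expansion d \<gamma> t a b" "expansion d \<gamma> t a' b'"
  shows "a = a' \<and> b = b'"
proof -
  have "(\<lambda>z. (h_inv d (h d t z - of_real (\<gamma> * t)) - (of_real a * z + of_real b)) -
      (h_inv d (h d t z - of_real (\<gamma> * t)) - (of_real a' * z + of_real b'))) \<in> O[at_inf_uhp](\<lambda>z. 1 / z)"
    by (rule sum_in_bigo(2)) (use assms in \<open>unfold expansion_def, blast+\<close>)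
  then have "(\<lambda>z. of_real (a' - a) * z + of_real (b' - b)) \<in> O[at_inf_uhp](\<lambda>z. 1 / z)"
    by (simp add: algebra_simps)
  from filterlim_compose[OF bigo_inverse_tendsto_0[OF this] imag_axis_at_inf_uhp]
  have lim: "((\<lambda>y. of_real (a' - a) * (\<i> * of_real y) + of_real (b' - b)) \<longlongrightarrow> 0) at_top" .
  have "((\<lambda>y::real. b' - b) \<longlongrightarrow> 0) at_top" using tendsto_Re[OF lim] by simp
  then have "b' - b = 0" using tendsto_const_iff[of "at_top :: real filter" "b' - b" 0] by simp
  have im: "((\<lambda>y::real. (a' - a) * y) \<longlongrightarrow> 0) at_top" using tendsto_Im[OF lim] by simp
  have "((\<lambda>y::real. 1 / y) \<longlongrightarrow> 0) at_top"
    by (rule tendsto_divide_0[OF tendsto_const filterlim_at_top_imp_at_infinity[OF filterlim_ident]])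
  from tendsto_mult[OF im this] have "((\<lambda>y::real. (a' - a) * y * (1 / y)) \<longlongrightarrow> 0) at_top" by simp
  moreover have "\<forall>\<^sub>F y::real in at_top. (a' - a) * y * (1 / y) = a' - a"
    using eventually_gt_at_top[of 0] by eventually_elim simp
  ultimately have "((\<lambda>y::real. a' - a) \<longlongrightarrow> 0) at_top" by (rule Lim_transform_eventually)
  then have "a' - a = 0" using tendsto_const_iff[of "at_top :: real filter" "a' - a" 0] by simp
  then show ?thesis using \<open>b' - b = 0\<close> by simp
qed

section \<open>The Loewner chain\<close>

lemma tip_trajectories_reindex:
  assumes G: "tip_trajectories f I G" and e: "bij_betw e J I"
    and eq: "\<And>j t. j \<in> J \<Longrightarrow> 0 \<le> t \<Longrightarrow> G' j t = G (e j) t"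
  shows "tip_trajectories f J G'"
proof -
  have eI: "e j \<in> I" if "j \<in> J" for j using that e by (auto simp: bij_betw_def)
  have img: "G' j ` {0..t} = G (e j) ` {0..t}" if "j \<in> J" for j t
    by (rule image_cong) (use eq[OF that] in auto)
  have img': "G' j ` {0<..t} = G (e j) ` {0<..t}" if "j \<in> J" for j t
    by (rule image_cong) (use eq[OF that] in auto)
  show ?thesis
    unfolding tip_trajectories_def
  proof (intro conjI allI impI ballI)
    fix j assume j: "j \<in> J"
    have "continuous_on {0..} (G (e j))" using G eI[OF j] by (auto simp: tip_trajectories_def)
    then show "continuous_on {0..} (G' j)" by (rule continuous_on_eq) (simp add: eq[OF j])
  next
    fix t :: real and j assume t: "0 < t" and j: "j \<in> J"
    have s: "slit (\<lambda>s. G (e j) (s * t))" using G eI[OF j] t by (auto simp: tip_trajectories_def)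
    have agree: "G' j (s * t) = G (e j) (s * t)" if "0 \<le> s" for s using eq[OF j, of "s * t"] that t by simp
    show "slit (\<lambda>s. G' j (s * t))"
      unfolding slit_def arc_def path_def pathstart_def
    proof (intro conjI)
      show "continuous_on {0..1} (\<lambda>s. G' j (s * t))"
        by (rule continuous_on_eq[of _ "\<lambda>s. G (e j) (s * t)"]) (use s agree in \<open>auto simp: slit_def arc_def path_def\<close>)
      show "inj_on (\<lambda>s. G' j (s * t)) {0..1}"
        using s by (simp add: slit_def arc_def inj_on_def agree)
      show "Im (G' j (0 * t)) = 0" using s agree[of 0] by (simp add: slit_def pathstart_def)
      show "(\<lambda>s. G' j (s * t)) ` {0<..1} \<subseteq> uhp" using s agree by (auto simp: slit_def image_subset_iff)
    qed
  next
    fix t :: real assume t: "0 \<le> t"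
    have d: "disjoint_family_on (\<lambda>i. G i ` {0..t}) I" using G t by (auto simp: tip_trajectories_def)
    show "disjoint_family_on (\<lambda>i. G' i ` {0..t}) J"
      unfolding disjoint_family_on_def
    proof (intro ballI impI)
      fix j l assume jl: "j \<in> J" "l \<in> J" "j \<noteq> l"
      then have "e j \<noteq> e l" using e by (auto simp: bij_betw_def dest: inj_onD)
      then show "G' j ` {0..t} \<inter> G' l ` {0..t} = {}"
        using d eI jl unfolding img[OF jl(1)] img[OF jl(2)] disjoint_family_on_def by blast
    qed
    have "uhp - (\<lambda>z. f z t) ` uhp = (\<Union>i\<in>I. G i ` {0<..t})" using G t by (auto simp: tip_trajectories_def)
    also have "\<dots> = (\<Union>j\<in>J. G (e j) ` {0<..t})" 
    proof -
      have "I = e ` J" using e by (simp add: bij_betw_def)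
      then show ?thesis by simp
    qed
    also have "\<dots> = (\<Union>j\<in>J. G' j ` {0<..t})" by (intro SUP_cong refl) (simp add: img')
    finally show "uhp - (\<lambda>z. f z t) ` uhp = (\<Union>j\<in>J. G' j ` {0<..t})" .
  qed
qed

text \<open>
  The branch point moves, and the argument may lie on the cut. Adding \<open>\<kappa> t\<close> turns the moving branch
  point into a moving argument that stays in the closed half-plane, relative to which the logarithm
  is differentiable.
\<close>

lemma has_vector_derivative_Ln_moving:
  assumes \<zeta>: "(\<zeta> has_vector_derivative \<zeta>') (at t within T)"
    and \<kappa>: "(\<kappa> has_real_derivative \<kappa>') (at t within T)"
    and im: "\<And>s. s \<in> T \<Longrightarrow> 0 \<le> Im (\<zeta> s)" and t: "t \<in> T" and ne: "\<zeta> t \<noteq> of_real (\<kappa> t)"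
  shows "((\<lambda>s. Ln (\<zeta> s - of_real (\<kappa> s))) has_vector_derivative (\<zeta>' - of_real \<kappa>') / (\<zeta> t - of_real (\<kappa> t))) (at t within T)"
proof -
  let ?c = "\<lambda>s. \<zeta> s - of_real (\<kappa> s) + of_real (\<kappa> t)"
  have "((\<lambda>s. of_real (\<kappa> s) :: complex) has_vector_derivative of_real \<kappa>') (at t within T)"
    using \<kappa> by (intro has_vector_derivative_of_real) (simp add: has_real_derivative_iff_has_vector_derivative)
  from has_vector_derivative_add[OF has_vector_derivative_diff[OF \<zeta> this] has_vector_derivative_const[of "of_real (\<kappa> t)"]]
  have c: "(?c has_vector_derivative \<zeta>' - of_real \<kappa>') (at t within T)" by simp
  have "((\<lambda>z. Ln (z - of_real (\<kappa> t))) has_field_derivative 1 / (?c t - of_real (\<kappa> t))) (at (?c t) within {w. 0 \<le> Im w})"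
    using has_field_derivative_Ln_closed_uhp[of "?c t" "\<kappa> t"] im[OF t] ne by simp
  then have "((\<lambda>z. Ln (z - of_real (\<kappa> t))) has_field_derivative 1 / (?c t - of_real (\<kappa> t))) (at (?c t) within ?c ` T)"
    by (rule DERIV_subset) (use im in auto)
  from field_vector_diff_chain_within[OF c this] show ?thesis by (simp add: o_def)
qed

context slit_flow
begin

definition B :: real where "B = (\<Sum>j=1..n. q j)"
text \<open>
  The first moment \<open>m\<^sub>t\<close> of the charges: \<open>h\<^sub>t(z) = B log z - m\<^sub>t / z + O(1/z\<^sup>2)\<close>.
\<close>

definition moment :: "real \<Rightarrow> real" where "moment t = (\<Sum>j=1..n. q j * kk t j)"
definition a_coef :: "real \<Rightarrow> real" where "a_coef t = exp (- (\<gamma> * t) / B)"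
definition b_coef :: "real \<Rightarrow> real" where "b_coef t = (moment 0 - a_coef t * moment t) / B"

text \<open>
  The map that carries \<open>h\<^sub>t - \<gamma>t\<close> over to \<open>h\<close>; \<open>loewner\<close> is its normalization at infinity.
\<close>

definition transition :: "real \<Rightarrow> complex \<Rightarrow> complex" where
  "transition t z = Hi 0 (Ht t z - of_real (\<gamma> * t))"

definition loewner :: "complex \<Rightarrow> real \<Rightarrow> complex" where
  "loewner z t = transition t ((z - of_real (b_coef t)) / of_real (a_coef t))"

lemma B_pos: "0 < B" using charges.total_pos[OF charges] by (simp add: B_def)

lemma a_coef_pos: "0 < a_coef t" by (simp add: a_coef_def)

lemma Ht_in_shifted_image: "z \<in> uhp \<Longrightarrow> Ht t z - of_real (\<gamma> * t) \<in> shifted_image t"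
  by (simp add: shifted_image_def)

lemma shifted_image_sub: "0 \<le> t \<Longrightarrow> shifted_image t \<subseteq> Ht 0 ` uhp"
  using shifted_image_mono[of 0 t] shifted_image_0 by simp

lemma Ht_in_range: "0 \<le> t \<Longrightarrow> z \<in> uhp \<Longrightarrow> Ht t z - of_real (\<gamma> * t) \<in> Ht 0 ` uhp"
  using Ht_in_shifted_image shifted_image_sub by blast

lemma transition_uhp: "0 \<le> t \<Longrightarrow> z \<in> uhp \<Longrightarrow> transition t z \<in> uhp"
  unfolding transition_def using charges.Hinv_in_uhp[OF charges] Ht_in_range by blast

lemma H_transition: "0 \<le> t \<Longrightarrow> z \<in> uhp \<Longrightarrow> Ht 0 (transition t z) = Ht t z - of_real (\<gamma> * t)"
  unfolding transition_def using charges.H_Hinv[OF charges] Ht_in_range by blast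

text \<open>
  Near infinity \<open>h\<^sub>t\<close> has large real part and positive imaginary part, and \<open>h\<close> takes such values
  only near infinity.
\<close>

lemma transition_at_infinity:
  assumes t: "0 \<le> t"
  shows "filterlim (transition t) at_infinity at_inf_uhp"
proof -
  interpret c0: charges n N q "kk 0" by (rule charges)
  interpret ct: charges n N q "kk t" by (rule charges)
  show ?thesis
    unfolding transition_def
  proof (rule c0.Hinv_at_infinity)
    show "\<forall>\<^sub>F z in at_inf_uhp. Ht t z - of_real (\<gamma> * t) \<in> c0.H ` uhp"
      using at_inf_uhp_uhp by eventually_elim (rule Ht_in_range[OF t])
    obtain R where R: "\<And>z. z \<in> uhp \<Longrightarrow> R < cmod z \<Longrightarrow> 0 < Im (Ht t z)" using ct.Im_H_pos_at_infinity by blast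
    have "\<forall>\<^sub>F z in at_inf_uhp. R < cmod z"
      using filterlim_at_infinity_imp_norm_at_top[OF ident_at_inf_uhp] by (auto simp: filterlim_at_top_dense)
    then show "\<forall>\<^sub>F z in at_inf_uhp. 0 < Im (Ht t z - of_real (\<gamma> * t))"
      using at_inf_uhp_uhp by eventually_elim (simp add: R)
    have "filterlim ct.V at_top at_inf_uhp" using filterlim_mono[OF ct.V_at_infinity order_refl at_inf_uhp_le] .
    then have "filterlim (\<lambda>z. - (\<gamma> * t) + ct.V z) at_top at_inf_uhp"
      by (rule filterlim_tendsto_add_at_top[OF tendsto_const])
    moreover have ev: "\<forall>\<^sub>F z in at_inf_uhp. - (\<gamma> * t) + ct.V z = Re (Ht t z - of_real (\<gamma> * t))"
      using at_inf_uhp_uhp by eventually_elim (use ct.Re_H_eq_V ct.uhp_subset_cuhp in auto)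
    ultimately show "filterlim (\<lambda>z. Re (Ht t z - of_real (\<gamma> * t))) at_top at_inf_uhp"
      by (simp only: filterlim_cong[OF refl refl ev])
  qed
qed

lemma expansion_a_coef_b_coef:
  assumes t: "0 \<le> t"
  shows "expansion d \<gamma> t (a_coef t) (b_coef t)"
proof -
  interpret c0: charges n N q "kk 0" by (rule charges)
  interpret ct: charges n N q "kk t" by (rule charges)
  have large: "\<forall>\<^sub>F z in at_inf_uhp. \<forall>j\<in>{1..n}. \<bar>kk s j\<bar> < cmod (f z)" if "filterlim f at_infinity at_inf_uhp" for s and f :: "complex \<Rightarrow> complex"
    using filterlim_at_infinity_imp_norm_at_top[OF that]
    by (intro eventually_ball_finite ballI) (auto simp: filterlim_at_top_dense)
  have "(\<lambda>z. transition t z - (of_real (a_coef t) * z + of_real (b_coef t))) \<in> O[at_inf_uhp](\<lambda>z. 1 / z)"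
  proof (rule asymptotically_linear[OF ident_at_inf_uhp transition_at_infinity[OF t] _ _ c0.Eps_asymp ct.Eps_asymp])
    show "B \<noteq> 0" using B_pos by simp
    show "\<forall>\<^sub>F z in at_inf_uhp. of_real B * Ln (transition t z) + c0.Eps (transition t z) = of_real B * Ln z - of_real (\<gamma> * t) + ct.Eps z"
      using at_inf_uhp_uhp large[OF ident_at_inf_uhp, of t] large[OF transition_at_infinity[OF t], of 0]
    proof eventually_elim
      case (elim z)
      have "of_real B * Ln (transition t z) + c0.Eps (transition t z) = c0.H (transition t z)"
        unfolding B_def by (rule c0.H_eq_Eps[symmetric, OF transition_uhp[OF t elim(1)]]) (use elim in auto)
      also have "\<dots> = ct.H z - of_real (\<gamma> * t)" by (rule H_transition[OF t elim(1)])
      also have "ct.H z = of_real B * Ln z + ct.Eps z"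
        unfolding B_def by (rule ct.H_eq_Eps[OF elim(1)]) (use elim in auto)
      finally show ?case by simp
    qed
    show "a_coef t = exp (- (\<gamma> * t) / B)" by (simp add: a_coef_def)
    show "b_coef t = ((\<Sum>j=1..n. q j * kk 0 j) - a_coef t * (\<Sum>j=1..n. q j * kk t j)) / B" by (simp add: b_coef_def moment_def)
  qed
  then show ?thesis using a_coef_pos t by (simp add: expansion_def transition_def Hi_0 Ht_eq)
qed

lemma coeff_a_eq: "0 \<le> t \<Longrightarrow> coeff_a d \<gamma> t = a_coef t"
  unfolding coeff_a_def using expansion_a_coef_b_coef expansion_unique by (intro the_equality) blast+

lemma coeff_b_eq: "0 \<le> t \<Longrightarrow> coeff_b d \<gamma> t = b_coef t"
  unfolding coeff_b_def using expansion_a_coef_b_coef expansion_unique by (intro the_equality) blast+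

definition k_dot :: "real \<Rightarrow> nat \<Rightarrow> real" where "k_dot t j = - theta j * (kk t j - K)"

lemma DERIV_kk:
  assumes t: "0 \<le> t"
  shows "((\<lambda>s. kk s j) has_real_derivative k_dot t j) (at t within {0..})"
proof -
  have "((\<lambda>s. K + (k0 j - K) * exp (- theta j * s)) has_real_derivative k_dot t j) (at t within {0..})"
    using t by (auto intro!: derivative_eq_intros simp: k_dot_def kk_eq)
  then show ?thesis
    by (rule has_field_derivative_transform_within[OF _ zero_less_one]) (use t in \<open>auto simp: kk_eq\<close>)
qed

definition moment_dot :: "real \<Rightarrow> real" where "moment_dot t = (\<Sum>j=1..n. q j * k_dot t j)"

lemma DERIV_moment: "0 \<le> t \<Longrightarrow> (moment has_real_derivative moment_dot t) (at t within {0..})"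
  unfolding moment_def moment_dot_def by (intro DERIV_sum DERIV_cmult DERIV_kk)

lemma DERIV_a_coef: "(a_coef has_real_derivative - (\<gamma> / B) * a_coef t) (at t within {0..})"
  unfolding a_coef_def using B_pos by (auto intro!: derivative_eq_intros)

definition b_dot :: "real \<Rightarrow> real" where "b_dot t = a_coef t * ((\<gamma> / B * moment t - moment_dot t) / B)"

lemma DERIV_b_coef: "0 \<le> t \<Longrightarrow> (b_coef has_real_derivative b_dot t) (at t within {0..})"
proof -
  assume t: "0 \<le> t"
  have "((\<lambda>t. (moment 0 - a_coef t * moment t) / B) has_real_derivative (0 - (- (\<gamma> / B) * a_coef t * moment t + moment_dot t * a_coef t)) / B) (at t within {0..})"
    by (intro DERIV_cdivide DERIV_diff DERIV_const DERIV_mult DERIV_a_coef DERIV_moment t)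
  then show ?thesis unfolding b_coef_def by (rule DERIV_cong) (simp add: b_dot_def algebra_simps)
qed

definition zeta :: "complex \<Rightarrow> real \<Rightarrow> complex" where
  "zeta z t = (z - of_real (b_coef t)) / of_real (a_coef t)"

lemma zeta_uhp: "z \<in> uhp \<Longrightarrow> zeta z t \<in> uhp"
  using a_coef_pos[of t] by (simp add: zeta_def uhp_def)

lemma zeta_bij: "z \<in> uhp \<Longrightarrow> zeta (of_real (a_coef t) * z + of_real (b_coef t)) t = z"
  using a_coef_pos[of t] by (simp add: zeta_def)

lemma affine_uhp: "z \<in> uhp \<Longrightarrow> of_real (a_coef t) * z + of_real (b_coef t) \<in> uhp"
  using a_coef_pos[of t] by (simp add: uhp_def)

lemma loewner_zeta: "loewner z t = transition t (zeta z t)"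
  by (simp add: loewner_def zeta_def)

text \<open>
  The velocity of \<open>\<zeta> = (z - b\<^sub>t) / a\<^sub>t\<close> is minus the polynomial part of \<open>(\<partial>\<^sub>t h\<^sub>t - \<gamma>) / h\<^sub>t'\<close> at
  \<open>\<zeta>\<close>.
\<close>

lemma has_vector_derivative_zeta:
  assumes t: "0 \<le> t"
  shows "(zeta z has_vector_derivative of_real (\<gamma> / B) * zeta z t - of_real ((\<gamma> / B * moment t - moment_dot t) / B)) (at t within {0..})"
proof -
  have vd: "((\<lambda>s. of_real (F s) :: complex) has_vector_derivative of_real F') (at t within {0..})"
    if "(F has_real_derivative F') (at t within {0..})" for F F'
    using that by (intro has_vector_derivative_of_real) (simp add: has_real_derivative_iff_has_vector_derivative)
  have "((\<lambda>s. 1 / a_coef s) has_real_derivative (\<gamma> / B) * (1 / a_coef t)) (at t within {0..})"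
    using a_coef_pos[of t] by (auto intro!: derivative_eq_intros DERIV_a_coef simp: field_simps)
  note ia = vd[OF this]
  have "((\<lambda>s. z - of_real (b_coef s)) has_vector_derivative - of_real (b_dot t)) (at t within {0..})"
    using has_vector_derivative_diff[OF has_vector_derivative_const[of z] vd[OF DERIV_b_coef[OF t]]] by simp
  from has_vector_derivative_mult[OF this ia]
  have "((\<lambda>s. (z - of_real (b_coef s)) * of_real (1 / a_coef s)) has_vector_derivative
     (z - of_real (b_coef t)) * of_real (\<gamma> / B * (1 / a_coef t)) + - of_real (b_dot t) * of_real (1 / a_coef t)) (at t within {0..})" .
  moreover have "(\<lambda>s. (z - of_real (b_coef s)) * of_real (1 / a_coef s)) = zeta z" by (simp add: zeta_def fun_eq_iff)
  moreover have "(z - of_real (b_coef t)) * of_real (\<gamma> / B * (1 / a_coef t)) + - of_real (b_dot t) * of_real (1 / a_coef t) =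
      of_real (\<gamma> / B) * zeta z t - of_real ((\<gamma> / B * moment t - moment_dot t) / B)"
    using a_coef_pos[of t] by (simp add: zeta_def b_dot_def)
  ultimately show ?thesis by simp
qed

definition Num :: "real \<Rightarrow> complex \<Rightarrow> complex" where
  "Num t z = - (\<Sum>j=1..n. of_real (q j * k_dot t j) / (z - of_real (kk t j))) - of_real \<gamma>"

lemma has_vector_derivative_Ht_moving:
  assumes t: "0 \<le> t" and \<zeta>: "(\<zeta> has_vector_derivative \<zeta>') (at t within {0..})"
    and im: "\<And>s. 0 \<le> s \<Longrightarrow> 0 \<le> Im (\<zeta> s)" and ne: "\<zeta> t \<in> cu t"
  shows "((\<lambda>s. Ht s (\<zeta> s)) has_vector_derivative \<zeta>' * dHt t (\<zeta> t) + (Num t (\<zeta> t) + of_real \<gamma>)) (at t within {0..})"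
proof -
  interpret charges n N q "kk t" by (rule charges)
  have nz: "\<zeta> t \<noteq> of_real (kk t j)" if "j \<in> {1..n}" for j using ne that by (auto simp: cuhp_def S_def)
  have "((\<lambda>s. \<Sum>j=1..n. of_real (q j) * Ln (\<zeta> s - of_real (kk s j))) has_vector_derivative
      (\<Sum>j=1..n. of_real (q j) * ((\<zeta>' - of_real (k_dot t j)) / (\<zeta> t - of_real (kk t j))))) (at t within {0..})"
  proof (rule has_vector_derivative_sum)
    fix j assume j: "j \<in> {1..n}"
    show "((\<lambda>s. of_real (q j) * Ln (\<zeta> s - of_real (kk s j))) has_vector_derivative
      of_real (q j) * ((\<zeta>' - of_real (k_dot t j)) / (\<zeta> t - of_real (kk t j)))) (at t within {0..})"
      by (intro has_vector_derivative_mult_right has_vector_derivative_Ln_moving[OF \<zeta> DERIV_kk[OF t]]) (use im t nz[OF j] in auto)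
  qed
  moreover have "(\<Sum>j=1..n. of_real (q j) * ((\<zeta>' - of_real (k_dot t j)) / (\<zeta> t - of_real (kk t j)))) =
      \<zeta>' * dHt t (\<zeta> t) + (Num t (\<zeta> t) + of_real \<gamma>)"
  proof -
    have "(\<Sum>j=1..n. of_real (q j) * ((\<zeta>' - of_real (k_dot t j)) / (\<zeta> t - of_real (kk t j)))) =
       (\<Sum>j=1..n. \<zeta>' * (of_real (q j) / (\<zeta> t - of_real (kk t j))) - of_real (q j * k_dot t j) / (\<zeta> t - of_real (kk t j)))"
      by (intro sum.cong refl) (simp add: diff_divide_distrib algebra_simps)
    then show ?thesis by (simp add: dH_def Num_def sum_subtractf sum_distrib_left)
  qed
  ultimately show ?thesis by (simp add: charges.H_def[OF charges])
qed

lemma dt_h_eq: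
  assumes t: "0 \<le> t" and z: "z \<in> cu t"
  shows "dt_h d t z = Num t z + of_real \<gamma>"
proof -
  interpret charges n N q "kk t" by (rule charges)
  have "((\<lambda>s. Ht s z) has_vector_derivative 0 * dHt t z + (Num t z + of_real \<gamma>)) (at t within {0..})"
    by (rule has_vector_derivative_Ht_moving[OF t has_vector_derivative_const]) (use z in \<open>auto simp: cuhp_def\<close>)
  then have "((\<lambda>s. Ht s z) has_vector_derivative Num t z + of_real \<gamma>) (at t within {0..})" by simp
  then have "((\<lambda>s. h d s z) has_vector_derivative Num t z + of_real \<gamma>) (at t within {0..})"
    by (rule has_vector_derivative_transform[rotated 2]) (use t in \<open>auto simp: Ht_eq\<close>)
  moreover have "at t within {0..} \<noteq> bot"
  proof
    assume "at t within {0..} = bot"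
    moreover have "at_right t \<le> at t within {0..}" by (rule at_le) (use t in auto)
    ultimately show False using trivial_limit_at_right_real[of t] by (simp add: bot.extremum_unique)
  qed
  ultimately show ?thesis unfolding dt_h_def by (rule vector_derivative_within[rotated])
qed

lemma Q_eq:
  assumes t: "0 \<le> t" and z: "z \<in> uhp"
  shows "Q d \<gamma> z t = - of_real (a_coef t) *
     (\<Sum>i\<in>I. Num t (of_real (ct t i)) / ddHt t (of_real (ct t i)) / (zeta z t - of_real (ct t i)))"
proof -
  interpret charges n N q "kk t" by (rule charges)
  have a: "of_real (a_coef t) \<noteq> (0::complex)" using a_coef_pos[of t] by simp
  have "beta d \<gamma> t (ct t i) / (z - of_real (rho_tilde d \<gamma> t (ct t i))) =
     of_real (a_coef t) * (Num t (of_real (ct t i)) / ddHt t (of_real (ct t i)) / (zeta z t - of_real (ct t i)))" if i: "i \<in> I" for i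
  proof -
    have c: "of_real (ct t i) \<in> cu t" using gap_cuhp[OF crit(1)[OF i]] i by simp
    have "of_real (a_coef t) * zeta z t = z - of_real (b_coef t)" using a by (simp add: zeta_def)
    then have "z - of_real (rho_tilde d \<gamma> t (ct t i)) = of_real (a_coef t) * (zeta z t - of_real (ct t i))"
      by (simp add: rho_tilde_def coeff_a_eq[OF t] coeff_b_eq[OF t] right_diff_distrib)
    moreover have "beta d \<gamma> t (ct t i) = of_real (a_coef t)^2 * (Num t (of_real (ct t i)) / ddHt t (of_real (ct t i)))"
      by (simp add: beta_def coeff_a_eq[OF t] dt_h_eq[OF t c] dz_dz_eq[OF t c])
    ultimately show ?thesis using a by (simp add: power2_eq_square)
  qed
  then have eq: "(\<Sum>i\<in>I. beta d \<gamma> t (ct t i) / (z - of_real (rho_tilde d \<gamma> t (ct t i)))) = of_real (a_coef t) *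
     (\<Sum>i\<in>I. Num t (of_real (ct t i)) / ddHt t (of_real (ct t i)) / (zeta z t - of_real (ct t i)))"
    unfolding sum_distrib_left by (intro sum.cong) auto
  have "Q d \<gamma> z t = - (\<Sum>i\<in>I. beta d \<gamma> t (ct t i) / (z - of_real (rho_tilde d \<gamma> t (ct t i))))"
    unfolding Q_def sum_I using rhoP_eq[OF t] rhoM_eq[OF t] by simp
  then show ?thesis unfolding eq by simp
qed

lemma has_field_derivative_transition:
  assumes t: "0 \<le> t" and z: "z \<in> uhp"
  shows "(transition t has_field_derivative dHt t z / dHt 0 (transition t z)) (at z)"
proof -
  interpret c0: charges n N q "kk 0" by (rule charges)
  interpret ct: charges n N q "kk t" by (rule charges)
  have i: "((\<lambda>z. Ht t z - of_real (\<gamma> * t)) has_field_derivative dHt t z) (at z)"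
    using DERIV_diff[OF ct.has_field_derivative_H[OF z] DERIV_const] by simp
  from DERIV_chain2[where f = "Hi 0" and g = "\<lambda>z. Ht t z - of_real (\<gamma> * t)", OF c0.has_field_derivative_Hinv[OF Ht_in_range[OF t z]] i]
  show ?thesis unfolding transition_def by simp
qed

lemma has_field_derivative_loewner:
  assumes t: "0 \<le> t" and z: "z \<in> uhp"
  shows "((\<lambda>z. loewner z t) has_field_derivative dHt t (zeta z t) / dHt 0 (loewner z t) / of_real (a_coef t)) (at z)"
proof -
  have "((\<lambda>z. zeta z t) has_field_derivative 1 / of_real (a_coef t)) (at z)"
    unfolding zeta_def using a_coef_pos[of t] by (auto intro!: derivative_eq_intros)
  from DERIV_chain2[where f = "transition t" and g = "\<lambda>z. zeta z t", OF has_field_derivative_transition[OF t zeta_uhp[OF z]] this]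
  show ?thesis by (simp add: loewner_zeta)
qed

text \<open>
  By the chain rule \<open>h'(f) \<partial>\<^sub>t f = h\<^sub>t'(\<zeta>) \<zeta>' + \<partial>\<^sub>t h\<^sub>t(\<zeta>) - \<gamma>\<close> and \<open>h'(f) f' = h\<^sub>t'(\<zeta>) / a\<^sub>t\<close>. In
  the expansion of \<open>(\<partial>\<^sub>t h\<^sub>t - \<gamma>) / h\<^sub>t'\<close> the term \<open>\<zeta>'\<close> cancels the polynomial part, and the polar
  part is \<open>- Q / a\<^sub>t\<close>.
\<close>

lemma loewner_pde:
  assumes t: "0 \<le> t" and z: "z \<in> uhp"
  shows "((\<lambda>s. loewner z s) has_vector_derivative - deriv (\<lambda>x. loewner x t) z * Q d \<gamma> z t) (at t within {0..})"
proof -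
  interpret c0: charges n N q "kk 0" by (rule charges)
  interpret ct: charges n N q "kk t" by (rule charges)
  let ?\<zeta> = "zeta z t"
  define \<zeta>' where "\<zeta>' = of_real (\<gamma> / B) * ?\<zeta> - of_real ((\<gamma> / B * moment t - moment_dot t) / B)"
  have \<zeta>: "?\<zeta> \<in> uhp" by (rule zeta_uhp[OF z])
  have dH: "dHt t ?\<zeta> \<noteq> 0" by (rule ct.dH_nonzero[OF \<zeta>])
  have "((\<lambda>s. Ht s (zeta z s)) has_vector_derivative \<zeta>' * dHt t ?\<zeta> + (Num t ?\<zeta> + of_real \<gamma>)) (at t within {0..})"
    unfolding \<zeta>'_def
    by (rule has_vector_derivative_Ht_moving[OF t has_vector_derivative_zeta[OF t]])
       (use zeta_uhp[OF z] ct.uhp_subset_cuhp in \<open>auto simp: uhp_def less_imp_le\<close>)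
  moreover have "((\<lambda>s. of_real (\<gamma> * s) :: complex) has_vector_derivative of_real \<gamma>) (at t within {0..})"
    by (auto intro!: derivative_eq_intros has_vector_derivative_of_real)
  ultimately have "((\<lambda>s. Ht s (zeta z s) - of_real (\<gamma> * s)) has_vector_derivative \<zeta>' * dHt t ?\<zeta> + Num t ?\<zeta>) (at t within {0..})"
    using has_vector_derivative_diff by fastforce
  from field_vector_diff_chain_within[OF this has_field_derivative_at_within[OF c0.has_field_derivative_Hinv[OF Ht_in_range[OF t \<zeta>]]]]
  have *: "((\<lambda>s. loewner z s) has_vector_derivative (\<zeta>' * dHt t ?\<zeta> + Num t ?\<zeta>) * (1 / dHt 0 (loewner z t))) (at t within {0..})"
    by (simp add: o_def loewner_zeta transition_def)
  have pf: "Num t ?\<zeta> / dHt t ?\<zeta> = of_real (- (\<gamma> / B)) * ?\<zeta> + of_real ((\<gamma> / B * moment t - moment_dot t) / B)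
     + (\<Sum>i\<in>I. Num t (of_real (ct t i)) / ddHt t (of_real (ct t i)) / (?\<zeta> - of_real (ct t i)))"
    using ct.partial_fractions[OF \<zeta>, of "k_dot t" \<gamma>] unfolding B_def[symmetric] moment_def[symmetric] moment_dot_def[symmetric] Num_def[symmetric] .
  have "Num t ?\<zeta> = dHt t ?\<zeta> * (Num t ?\<zeta> / dHt t ?\<zeta>)" using dH by simp
  also have "Num t ?\<zeta> / dHt t ?\<zeta> = - \<zeta>' - Q d \<gamma> z t / of_real (a_coef t)"
    unfolding pf Q_eq[OF t z] \<zeta>'_def using a_coef_pos[of t] by simp
  finally have N: "Num t ?\<zeta> = dHt t ?\<zeta> * (- \<zeta>' - Q d \<gamma> z t / of_real (a_coef t))" .
  have "\<zeta>' * dHt t ?\<zeta> + Num t ?\<zeta> = - (dHt t ?\<zeta> / of_real (a_coef t) * Q d \<gamma> z t)"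
    unfolding N by (simp add: algebra_simps)
  then have "(\<zeta>' * dHt t ?\<zeta> + Num t ?\<zeta>) * (1 / dHt 0 (loewner z t)) = - deriv (\<lambda>x. loewner x t) z * Q d \<gamma> z t"
    unfolding DERIV_imp_deriv[OF has_field_derivative_loewner[OF t z]] by simp
  then show ?thesis using * by simp
qed

lemma loewner_0: "z \<in> uhp \<Longrightarrow> loewner z 0 = z"
  using charges.Hinv_H[OF charges] by (simp add: loewner_def transition_def a_coef_def b_coef_def)

lemma loewner_continuous: "continuous_on (uhp \<times> {0..}) (\<lambda>(z, t). loewner z t)"
proof -
  interpret c0: charges n N q "kk 0" by (rule charges)
  have ckk: "continuous_on X (\<lambda>t. kk t j)" for X j unfolding kk_def by (intro continuous_intros)
  have cacoef: "continuous_on X a_coef" for X unfolding a_coef_def using B_pos by (intro continuous_intros) auto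
  have cbcoef: "continuous_on X b_coef" for X unfolding b_coef_def moment_def using B_pos by (intro continuous_intros ckk cacoef) auto
  let ?X = "uhp \<times> {0::real..}"
  have cz: "continuous_on ?X (\<lambda>x. zeta (fst x) (snd x))"
    unfolding zeta_def using a_coef_pos
    by (intro continuous_intros continuous_on_compose2[OF cacoef[of UNIV]] continuous_on_compose2[OF cbcoef[of UNIV]]) (auto simp: less_imp_neq[symmetric] order_less_imp_not_eq2)
  have cH: "continuous_on ?X (\<lambda>x. Ht (snd x) (zeta (fst x) (snd x)) - of_real (\<gamma> * snd x))"
    unfolding charges.H_def[OF charges]
  proof (intro continuous_intros cz continuous_on_compose2[OF ckk[of UNIV]])
    fix j and x :: "complex \<times> real" assume "x \<in> ?X"
    then have "0 < Im (zeta (fst x) (snd x))" using zeta_uhp by (auto simp: uhp_def)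
    then show "zeta (fst x) (snd x) - of_real (kk (snd x) j) \<notin> \<real>\<^sub>\<le>\<^sub>0"
      by (auto simp: complex_nonpos_Reals_iff)
  qed auto
  have "continuous_on ?X (\<lambda>x. Hi 0 (Ht (snd x) (zeta (fst x) (snd x)) - of_real (\<gamma> * snd x)))"
    by (rule continuous_on_compose2[OF c0.continuous_on_Hinv cH]) (use Ht_in_range zeta_uhp in auto)
  then show ?thesis by (simp add: case_prod_beta' loewner_zeta transition_def)
qed

lemma loewner_holomorphic: "0 \<le> t \<Longrightarrow> (\<lambda>z. loewner z t) holomorphic_on uhp"
  using has_field_derivative_loewner holomorphic_on_open[OF open_uhp] by blast

lemma loewner_pde_solution: "pde_solution (Q d \<gamma>) loewner"
  unfolding pde_solution_def using loewner_continuous loewner_holomorphic loewner_0 loewner_pde by auto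

lemma loewner_inj:
  assumes t: "0 \<le> t"
  shows "inj_on (\<lambda>z. loewner z t) uhp"
proof (rule inj_onI)
  fix z z' assume z: "z \<in> uhp" "z' \<in> uhp" and eq: "loewner z t = loewner z' t"
  have "Ht 0 (transition t (zeta z t)) = Ht 0 (transition t (zeta z' t))" using eq by (simp only: loewner_zeta)
  then have "Ht t (zeta z t) = Ht t (zeta z' t)"
    unfolding H_transition[OF t zeta_uhp[OF z(1)]] H_transition[OF t zeta_uhp[OF z(2)]] by simp
  then have "zeta z t = zeta z' t" using charges.inj_H[OF charges] zeta_uhp z by (auto dest: inj_onD)
  then show "z = z'" using a_coef_pos[of t] by (simp add: zeta_def)
qed

lemma loewner_image:
  assumes t: "0 \<le> t"
  shows "(\<lambda>z. loewner z t) ` uhp = Hi 0 ` shifted_image t"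
proof (intro equalityI subsetI)
  fix y assume "y \<in> (\<lambda>z. loewner z t) ` uhp"
  then obtain z where "z \<in> uhp" "y = loewner z t" by blast
  then show "y \<in> Hi 0 ` shifted_image t" using Ht_in_shifted_image[OF zeta_uhp] by (auto simp: loewner_zeta transition_def)
next
  fix y assume "y \<in> Hi 0 ` shifted_image t"
  then obtain v z where v: "v \<in> shifted_image t" "y = Hi 0 v" "z \<in> uhp" "v + of_real (\<gamma> * t) = Ht t z" by (auto simp: shifted_image_def)
  then have "v = Ht t z - of_real (\<gamma> * t)" by (metis add_diff_cancel)
  then have "y = loewner (of_real (a_coef t) * z + of_real (b_coef t)) t" using v zeta_bij by (simp add: loewner_zeta transition_def)
  then show "y \<in> (\<lambda>z. loewner z t) ` uhp" using affine_uhp[OF v(3)] by blast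
qed

lemma loewner_decreasing: "0 \<le> s \<Longrightarrow> s \<le> t \<Longrightarrow> (\<lambda>z. loewner z t) ` uhp \<subseteq> (\<lambda>z. loewner z s) ` uhp"
  using shifted_image_mono by (simp add: loewner_image image_mono)

lemma loewner_omitted:
  assumes t: "0 \<le> t"
  shows "uhp - (\<lambda>z. loewner z t) ` uhp = (\<Union>i\<in>I. Gam i ` {0<..t})"
proof -
  interpret c0: charges n N q "kk 0" by (rule charges)
  have inj: "inj_on (Hi 0) (shifted_image 0)" unfolding shifted_image_0 by (rule inj_on_inverseI[of _ c0.H]) (rule c0.H_Hinv)
  have "uhp = Hi 0 ` shifted_image 0" unfolding shifted_image_0 using c0.Hinv_H by (auto simp: image_image)
  then have "uhp - (\<lambda>z. loewner z t) ` uhp = Hi 0 ` (shifted_image 0 - shifted_image t)"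
    unfolding loewner_image[OF t] using inj_on_image_set_diff[OF inj, of "shifted_image 0" "shifted_image t"] shifted_image_mono[OF order_refl t] by auto
  also have "\<dots> = (\<Union>i\<in>I. Hi 0 ` (tip_h i ` {0<..t}))" unfolding shifted_image_diff[OF t] by (rule image_UN)
  also have "\<dots> = (\<Union>i\<in>I. Gam i ` {0<..t})"
    by (intro SUP_cong refl) (auto simp: Gam_def image_image intro!: image_cong)
  finally show ?thesis .
qed

lemma loewner_normalized:
  assumes t: "0 \<le> t"
  shows "((\<lambda>z. loewner z t - z) \<longlongrightarrow> 0) at_inf_uhp"
proof -
  have "(\<lambda>z. transition t z - (of_real (a_coef t) * z + of_real (b_coef t))) \<in> O[at_inf_uhp](\<lambda>z. 1 / z)"
    using expansion_a_coef_b_coef[OF t] by (simp add: expansion_def transition_def Hi_0 Ht_eq t)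
  from filterlim_compose[OF bigo_inverse_tendsto_0[OF this] filterlim_affine_at_inf_uhp[OF a_coef_pos[of t], of "b_coef t"]]
  have "((\<lambda>z. transition t (zeta z t) - (of_real (a_coef t) * zeta z t + of_real (b_coef t))) \<longlongrightarrow> 0) at_inf_uhp"
    by (simp add: zeta_def)
  moreover have "of_real (a_coef t) * zeta z t + of_real (b_coef t) = z" for z using a_coef_pos[of t] by (simp add: zeta_def)
  ultimately show ?thesis by (simp add: loewner_zeta)
qed

lemma tips_Gam: "tip_trajectories loewner I Gam"
  unfolding tip_trajectories_def
proof (intro conjI allI impI ballI)
  fix t :: real assume t: "0 \<le> t"
  show "disjoint_family_on (\<lambda>i. Gam i ` {0..t}) I"
    unfolding disjoint_family_on_def
  proof (intro ballI impI)
    fix i j assume ij: "i \<in> I" "j \<in> I" "i \<noteq> j"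
    show "Gam i ` {0..t} \<inter> Gam j ` {0..t} = {}"
      using Gam_inj[OF ij(1,2)] ij(3) by fastforce
  qed
qed (use continuous_Gam slit_Gam loewner_omitted in auto)

lemma tips_Gamma:
  "tip_trajectories loewner ({1..nP d - 1} <+> {1..nM d}) (case_sum (GammaP d \<gamma>) (GammaM d \<gamma>))"
proof (rule tip_trajectories_reindex[OF tips_Gam])
  let ?e = "case_sum (\<lambda>\<nu>. \<nu>) (\<lambda>\<mu>. N + \<mu>)"
  show "bij_betw ?e ({1..nP d - 1} <+> {1..nM d}) I"
    unfolding bij_betw_def
  proof
    show "inj_on ?e ({1..nP d - 1} <+> {1..nM d})" by (auto simp: inj_on_def)
    show "?e ` ({1..nP d - 1} <+> {1..nM d}) = I" unfolding I_split by (auto simp: Plus_def image_Un image_image)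
  qed
  fix j and t :: real assume "j \<in> {1..nP d - 1} <+> {1..nM d}" "0 \<le> t"
  then show "case_sum (GammaP d \<gamma>) (GammaM d \<gamma>) j t = Gam (?e j) t" using GammaP_eq GammaM_eq by auto
qed

lemma multi_slit_loewner: "multi_slit_loewner_chain loewner"
  unfolding multi_slit_loewner_chain_def
proof (intro conjI allI impI)
  obtain e where "bij_betw e {0..<card I} I" using ex_bij_betw_nat_finite[of I] by auto
  then have "bij_betw e {..<card I} I" by (simp add: atLeast0LessThan)
  from tip_trajectories_reindex[OF tips_Gam this, of "\<lambda>i. Gam (e i)"]
  show "\<exists>(n::nat) G. tip_trajectories loewner {..<n} G" by auto
  show "(\<lambda>z. loewner z t) ` uhp \<subseteq> uhp" if "0 \<le> t" for t using that transition_uhp zeta_uhp by (auto simp: loewner_zeta)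
qed (use loewner_holomorphic loewner_inj loewner_normalized loewner_decreasing in auto)

lemma range_loewner:
  assumes t: "0 \<le> t"
  shows "(\<lambda>z. loewner z t) ` uhp = uhp - ((\<Union>\<nu>\<in>{1..nP d - 1}. GammaP d \<gamma> \<nu> ` {0..t}) \<union> (\<Union>\<mu>\<in>{1..nM d}. GammaM d \<gamma> \<mu> ` {0..t}))"
proof -
  have P: "(\<Union>\<nu>\<in>{1..nP d - 1}. GammaP d \<gamma> \<nu> ` {0..t}) = (\<Union>i\<in>{1..nP d - 1}. Gam i ` {0..t})"
    by (intro SUP_cong refl image_cong) (use GammaP_eq in auto)
  have "GammaM d \<gamma> \<mu> ` {0..t} = Gam (N + \<mu>) ` {0..t}" if "\<mu> \<in> {1..nM d}" for \<mu>
    by (rule image_cong[OF refl]) (use GammaM_eq[OF that] in simp)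
  then have M: "(\<Union>\<mu>\<in>{1..nM d}. GammaM d \<gamma> \<mu> ` {0..t}) = (\<Union>i\<in>(\<lambda>\<mu>. N + \<mu>) ` {1..nM d}. Gam i ` {0..t})"
    by (simp only: UN_simps(10) cong: SUP_cong)
  have tips: "(\<Union>i\<in>I. Gam i ` {0..t}) \<inter> uhp = (\<Union>i\<in>I. Gam i ` {0<..t})"
  proof (intro equalityI subsetI)
    fix y assume "y \<in> (\<Union>i\<in>I. Gam i ` {0..t}) \<inter> uhp"
    then obtain i s where i: "i \<in> I" "s \<in> {0..t}" "y = Gam i s" "y \<in> uhp" by blast
    then have "s \<noteq> 0" by (auto simp: Gam_def uhp_def)
    then have "s \<in> {0<..t}" using i by simp
    then show "y \<in> (\<Union>i\<in>I. Gam i ` {0<..t})" using i by blast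
  next
    fix y assume "y \<in> (\<Union>i\<in>I. Gam i ` {0<..t})"
    then obtain i s where "i \<in> I" "s \<in> {0<..t}" "y = Gam i s" by blast
    then show "y \<in> (\<Union>i\<in>I. Gam i ` {0..t}) \<inter> uhp" using Gam_uhp by force
  qed
  have sub: "(\<lambda>z. loewner z t) ` uhp \<subseteq> uhp" using t transition_uhp zeta_uhp by (auto simp: loewner_zeta)
  have "X = u - U" if "X \<subseteq> u" "u - X = T" "U \<inter> u = T" for X u U T :: "complex set" using that by blast
  from this[OF sub loewner_omitted[OF t] tips]
  have "(\<lambda>z. loewner z t) ` uhp = uhp - (\<Union>i\<in>I. Gam i ` {0..t})" .
  then show ?thesis unfolding P M I_split UN_Un .
qed

section \<open>Limits of the tips\<close>

text \<open>
  The heights of the right slits increase up to \<open>0\<close>, and the \<open>\<nu>\<close>-th left slit lies below \<open>0\<close> by the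
  assumption on the positive charges other than the first. So there is a first right slit above it.
\<close>

lemma mu_idx_props:
  assumes \<nu>: "\<nu> \<in> {1..N - 1}"
  shows "mu_idx d \<nu> \<in> {1..nM d}" "ht (N + mu_idx d \<nu> - 1) < ht \<nu>" "ht \<nu> < ht (N + mu_idx d \<nu>)"
proof -
  interpret charges n N q "kk 0" by (rule charges)
  have \<nu>N: "\<nu> \<le> N" "\<nu> \<in> I" using \<nu> by auto
  let ?s = "\<Sum>j=\<nu>+1..N. bP d j"
  have lt: "(\<Sum>j=1..\<mu>. bM d j) < ?s \<longleftrightarrow> ht (N + \<mu>) < ht \<nu>" "?s < (\<Sum>j=1..\<mu>. bM d j) \<longleftrightarrow> ht \<nu> < ht (N + \<mu>)" if "\<mu> \<le> nM d" for \<mu>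
  proof -
    have "ht \<nu> = pi * (?s - sumM d)" using height_plus[OF \<nu>N(1)] by (simp add: yP_def)
    moreover have "ht (N + \<mu>) = pi * ((\<Sum>j=1..\<mu>. bM d j) - sumM d)"
      unfolding height_minus[OF that] yM_def sumM_split[OF that] by simp
    ultimately show "(\<Sum>j=1..\<mu>. bM d j) < ?s \<longleftrightarrow> ht (N + \<mu>) < ht \<nu>" "?s < (\<Sum>j=1..\<mu>. bM d j) \<longleftrightarrow> ht \<nu> < ht (N + \<mu>)"
      using mult_less_cancel_left_pos[OF pi_gt_zero] by auto
  qed
  have char: "\<mu> \<in> {1..nM d} \<and> (\<Sum>j=1..\<mu> - 1. bM d j) < ?s \<and> ?s < (\<Sum>j=1..\<mu>. bM d j) \<longleftrightarrow>
      \<mu> \<in> {1..nM d} \<and> ht (N + \<mu> - 1) < ht \<nu> \<and> ht \<nu> < ht (N + \<mu>)" for \<mu>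
    using lt[of \<mu>] lt[of "\<mu> - 1"] by (cases "\<mu> = 0") auto
  have "ht \<nu> < 0"
  proof -
    have "ht \<nu> \<le> ht 1" using \<nu> by (intro height_antimono) auto
    moreover have "ht 1 < 0"
      using standing height_plus[of 1] N2 pi_gt_zero by (simp add: yP_def standing_assumptions_def mult_pos_neg numeral_2_eq_2)
    ultimately show ?thesis by simp
  qed
  then have ex: "ht \<nu> < ht (N + nM d)" using height_n by simp
  define \<mu> where "\<mu> = (LEAST \<mu>. ht \<nu> < ht (N + \<mu>))"
  have \<mu>1: "ht \<nu> < ht (N + \<mu>)" unfolding \<mu>_def by (rule LeastI[of "\<lambda>\<mu>. ht \<nu> < ht (N + \<mu>)", OF ex])
  have \<mu>2: "\<mu> \<le> nM d" unfolding \<mu>_def by (rule Least_le[of "\<lambda>\<mu>. ht \<nu> < ht (N + \<mu>)", OF ex])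
  have "ht N < ht \<nu>" using height_bounds(1)[OF \<nu>N(2)] .
  then have \<mu>0: "\<mu> \<noteq> 0" using \<mu>1 by (cases "\<mu> = 0") auto
  then have "\<not> ht \<nu> < ht (N + (\<mu> - 1))" using not_less_Least[of "\<mu> - 1" "\<lambda>\<mu>. ht \<nu> < ht (N + \<mu>)"] by (simp add: \<mu>_def)
  moreover have "ht \<nu> \<noteq> ht (N + (\<mu> - 1))"
    using inj_height \<nu> \<mu>2 \<mu>0 by (auto dest!: inj_onD)
  ultimately have "ht (N + \<mu> - 1) < ht \<nu>" using \<mu>0 by simp
  then have P: "\<mu> \<in> {1..nM d} \<and> ht (N + \<mu> - 1) < ht \<nu> \<and> ht \<nu> < ht (N + \<mu>)" using \<mu>1 \<mu>2 \<mu>0 by auto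
  have "\<exists>!\<mu>. \<mu> \<in> {1..nM d} \<and> ht (N + \<mu> - 1) < ht \<nu> \<and> ht \<nu> < ht (N + \<mu>)"
  proof (rule ex1I[of _ \<mu>])
    show "\<mu> \<in> {1..nM d} \<and> ht (N + \<mu> - 1) < ht \<nu> \<and> ht \<nu> < ht (N + \<mu>)" by (rule P)
    fix \<mu>' assume P': "\<mu>' \<in> {1..nM d} \<and> ht (N + \<mu>' - 1) < ht \<nu> \<and> ht \<nu> < ht (N + \<mu>')"
    have "False" if "\<mu>a < \<mu>b" "\<mu>b \<le> nM d" "ht (N + \<mu>b - 1) < ht \<nu>" "ht \<nu> < ht (N + \<mu>a)" for \<mu>a \<mu>b
    proof -
      have "N + \<mu>a \<le> N + \<mu>b - 1" "N + \<mu>b - 1 \<le> n" using that by linarith+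
      then show False using height_mono[of "N + \<mu>a" "N + \<mu>b - 1"] that by linarith
    qed
    from this[of \<mu> \<mu>'] this[of \<mu>' \<mu>] show "\<mu>' = \<mu>" using P P' by (metis atLeastAtMost_iff linorder_neqE_nat)
  qed
  from theI'[OF this] show "mu_idx d \<nu> \<in> {1..nM d}" "ht (N + mu_idx d \<nu> - 1) < ht \<nu>" "ht \<nu> < ht (N + mu_idx d \<nu>)"
    unfolding mu_idx_def char by auto
qed

lemma GammaP_limit:
  assumes \<nu>: "\<nu> \<in> {1..N - 1}"
  shows "(GammaP d \<gamma> \<nu> \<longlongrightarrow> of_real (kM d (mu_idx d \<nu>))) at_top"
proof -
  note m = mu_idx_props[OF \<nu>]
  have "(Gam \<nu> \<longlongrightarrow> of_real (k0 (N + mu_idx d \<nu>))) at_top"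
    by (rule Gam_tendsto_plus) (use \<nu> m in auto)
  moreover have "\<forall>\<^sub>F t in at_top. Gam \<nu> t = GammaP d \<gamma> \<nu> t"
    using eventually_ge_at_top[of 0] by eventually_elim (simp add: GammaP_eq[OF \<nu>])
  ultimately have "(GammaP d \<gamma> \<nu> \<longlongrightarrow> of_real (k0 (N + mu_idx d \<nu>))) at_top" by (rule Lim_transform_eventually)
  then show ?thesis using m(1) by (simp add: k0_def)
qed

text \<open>
  The heights of the left slits cut the image into the strips \<open>S\<^sub>j\<^sup>+\<close>, and the tip lies in exactly
  one of them, as its height is different from theirs. Its limit is known for that strip, and limits
  are unique.
\<close>

lemma GammaM_limit:
  assumes \<mu>: "\<mu> \<in> {1..nM d}" and j: "j \<in> {1..N}"
  shows "(GammaM d \<gamma> \<mu> \<longlongrightarrow> of_real (kP d j)) at_top \<longleftrightarrow> h d 0 (of_real (rhoM d \<mu> 0)) \<in> SP d j"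
proof -
  interpret charges n N q "kk 0" by (rule charges)
  let ?i = "N + \<mu>"
  have i: "?i \<in> I" using \<mu> by auto
  have SP: "h d 0 (of_real (rhoM d \<mu> 0)) \<in> SP d l \<longleftrightarrow> ht l < ht ?i \<and> ht ?i < ht (l - 1)" if "l \<in> {1..N}" for l
  proof -
    have "l \<le> N" "l - 1 \<le> N" using that by auto
    then show ?thesis using h_crit[OF order_refl i] rhoM_eq[OF order_refl \<mu>]
      by (simp add: SP_def height_plus[symmetric])
  qed
  have lim: "(GammaM d \<gamma> \<mu> \<longlongrightarrow> of_real (kP d l)) at_top" if l: "l \<in> {1..N}" and y: "ht l < ht ?i" "ht ?i < ht (l - 1)" for l
  proof -
    have "(Gam ?i \<longlongrightarrow> of_real (k0 l)) at_top" by (rule Gam_tendsto_minus) (use \<mu> l y in auto)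
    moreover have "\<forall>\<^sub>F t in at_top. Gam ?i t = GammaM d \<gamma> \<mu> t"
      using eventually_ge_at_top[of 0] by eventually_elim (simp add: GammaM_eq[OF \<mu>])
    ultimately have "(GammaM d \<gamma> \<mu> \<longlongrightarrow> of_real (k0 l)) at_top" by (rule Lim_transform_eventually)
    then show ?thesis using l by (simp add: k0_def)
  qed
  show ?thesis
  proof
    assume "h d 0 (of_real (rhoM d \<mu> 0)) \<in> SP d j"
    then show "(GammaM d \<gamma> \<mu> \<longlongrightarrow> of_real (kP d j)) at_top" using SP[OF j] lim[OF j] by blast
  next
    assume L: "(GammaM d \<gamma> \<mu> \<longlongrightarrow> of_real (kP d j)) at_top"
    have ex: "ht N < ht ?i" using height_bounds(1)[OF i] .
    define l where "l = (LEAST l. ht l < ht ?i)"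
    have l1: "ht l < ht ?i" unfolding l_def by (rule LeastI[of "\<lambda>l. ht l < ht ?i", OF ex])
    have l2: "l \<le> N" unfolding l_def by (rule Least_le[of "\<lambda>l. ht l < ht ?i", OF ex])
    have l0: "l \<noteq> 0" using l1 height_bounds(2)[OF i] by (cases "l = 0") auto
    then have "\<not> ht (l - 1) < ht ?i" using not_less_Least[of "l - 1" "\<lambda>l. ht l < ht ?i"] by (simp add: l_def)
    moreover have "ht (l - 1) \<noteq> ht ?i" using inj_height l2 l0 i by (auto dest!: inj_onD)
    ultimately have l3: "ht ?i < ht (l - 1)" by simp
    have l: "l \<in> {1..N}" using l0 l2 by simp
    have "of_real (kP d l) = (of_real (kP d j) :: complex)"
      by (rule tendsto_unique[OF _ lim[OF l l1 l3] L]) simp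
    then have "k0 l = k0 j" using l j by (simp add: k0_def)
    then have "l = j" using k0_plus[OF l j] k0_plus[OF j l] by (cases l j rule: linorder_cases) auto
    then show "h d 0 (of_real (rhoM d \<mu> 0)) \<in> SP d j" using SP[OF j] l1 l3 by simp
  qed
qed

end

theorem theorem5p2:
  fixes d :: slit_data and \<gamma> :: real
  assumes "standing_assumptions d"
    and "admissible d"
    and "(SUP \<mu>\<in>{1..nM d - 1}. ereal (rateM d \<mu>)) < (INF \<nu>\<in>{1..nP d - 1}. ereal (rateP d \<nu>))"
    and "\<gamma> > 0"
    and "(SUP \<mu>\<in>{1..nM d - 1}. ereal (rateM d \<mu>)) < ereal \<gamma>"
    and "ereal \<gamma> < (INF \<nu>\<in>{1..nP d - 1}. ereal (rateP d \<nu>))"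
  shows "\<exists>f.
      pde_solution (Q d \<gamma>) f \<and>
      (\<forall>g. pde_solution (Q d \<gamma>) g \<longrightarrow> (\<forall>z\<in>uhp. \<forall>t\<ge>0. g z t = f z t)) \<and>
      multi_slit_loewner_chain f \<and>
      (\<forall>t\<ge>0. (\<lambda>z. f z t) ` uhp =
         uhp - ((\<Union>\<nu>\<in>{1..nP d - 1}. GammaP d \<gamma> \<nu> ` {0..t}) \<union>
                (\<Union>\<mu>\<in>{1..nM d}. GammaM d \<gamma> \<mu> ` {0..t}))) \<and>
      tip_trajectories f ({1..nP d - 1} <+> {1..nM d}) (case_sum (GammaP d \<gamma>) (GammaM d \<gamma>)) \<and>
      (\<forall>t>0. (\<forall>\<nu>\<in>{1..nP d - 1}. h d t (of_real (rhoP d \<nu> t)) - of_real (\<gamma> * t) \<in> h d 0 ` uhp) \<and>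
             (\<forall>\<mu>\<in>{1..nM d}. h d t (of_real (rhoM d \<mu> t)) - of_real (\<gamma> * t) \<in> h d 0 ` uhp)) \<and>
      (\<forall>\<nu>\<in>{1..nP d - 1}.
         GammaP d \<gamma> \<nu> 0 = of_real (rhoP d \<nu> 0) \<and>
         (GammaP d \<gamma> \<nu> \<longlongrightarrow> of_real (kM d (mu_idx d \<nu>))) at_top) \<and>
      (\<forall>\<mu>\<in>{1..nM d}.
         GammaM d \<gamma> \<mu> 0 = of_real (rhoM d \<mu> 0) \<and>
         (\<forall>j\<in>{1..nP d}.
            (GammaM d \<gamma> \<mu> \<longlongrightarrow> of_real (kP d j)) at_top \<longleftrightarrow>
            h d 0 (of_real (rhoM d \<mu> 0)) \<in> SP d j))"
proof -
  interpret slit_flow d \<gamma>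
  proof
    show "rateM d \<mu> < \<gamma>" if "\<mu> \<in> {1..nM d - 1}" for \<mu>
      using le_less_trans[OF SUP_upper[OF that, of "\<lambda>\<mu>. ereal (rateM d \<mu>)"] assms(5)] by simp
    show "\<gamma> < rateP d \<nu>" if "\<nu> \<in> {1..nP d - 1}" for \<nu>
      using less_le_trans[OF assms(6) INF_lower[OF that, of "\<lambda>\<nu>. ereal (rateP d \<nu>)"]] by simp
  qed (use assms in auto)
  show ?thesis
  proof (intro exI[of _ loewner] conjI allI impI ballI)
    show "g z t = loewner z t" if "pde_solution (Q d \<gamma>) g" "z \<in> uhp" "0 \<le> t" for g z t
      by (rule pde_solution_unique[OF loewner_pde_solution that(1) loewner_inj loewner_decreasing that(2,3)])
    show "h d t (of_real (rhoP d \<nu> t)) - of_real (\<gamma> * t) \<in> h d 0 ` uhp" if t: "0 < t" and \<nu>: "\<nu> \<in> {1..nP d - 1}" for t \<nu>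
    proof -
      have "\<nu> \<in> I" using \<nu> by auto
      then show ?thesis using tip_h_eq[of t \<nu>] tip_h_in_shifted_image_0[of \<nu> t] t rhoP_eq[OF _ \<nu>, of t] Ht_eq[of 0] by (simp add: shifted_image_0)
    qed
    show "h d t (of_real (rhoM d \<mu> t)) - of_real (\<gamma> * t) \<in> h d 0 ` uhp" if t: "0 < t" and \<mu>: "\<mu> \<in> {1..nM d}" for t \<mu>
    proof -
      have "N + \<mu> \<in> I" using \<mu> by auto
      then show ?thesis using tip_h_eq[of t "N + \<mu>"] tip_h_in_shifted_image_0[of "N + \<mu>" t] t rhoM_eq[OF _ \<mu>, of t] Ht_eq[of 0] by (simp add: shifted_image_0)
    qed
  qed (use loewner_pde_solution multi_slit_loewner range_loewner tips_Gamma GammaP_limit GammaM_limit in \<open>auto simp: GammaP_def GammaM_def\<close>)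
qed

end
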